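(* Let $\lambda,\mu\in C^1([-1,1])$ be positive with $\lambda(w)<\mu(-w)$ for all $w\in[-1,1]$, and $b,c\in C([-1,1])$. Consider $$u_t+\lambda(w)u_w=b(w)v,\qquad v_t-\mu(w)v_w=c(w)u,\qquad w\in[-1,1],\ t\ge0,\qquad u(-1,t)=U_1(t),\ v(1,t)=U_2(t),$$ with initial data $(u_0,v_0)\in L^2([-1,1])^2$. Then there exist bounded kernel functions $L^{11},L^{12},L^{21},L^{22}$ on $E=\{(z,w)\in[-1,1]^2:|z|\le|w|\}$ such that under the feedback laws $$U_1(t)=-\int_{-1}^1 u(z,t)L^{11}(z,-1)\,dz-\int_{-1}^1 v(z,t)L^{12}(z,-1)\,dz,\qquad U_2(t)=\int_{-1}^1 u(z,t)L^{21}(z,1)\,dz+\int_{-1}^1 v(z,t)L^{22}(z,1)\,dz$$ the closed-loop state $(u,v)$ reaches the zero equilibrium in finite time.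
   Context: In the paper the kernels are obtained from the transformation $\alpha=u-\int_{-w}^{w}(uL^{11}+vL^{12})dz$, $\beta=v-\int_{-w}^{w}(uL^{21}+vL^{22})dz$ mapping the closed loop to the target system $\alpha_t+\lambda\alpha_w=q(w)\beta(-w,t)+\int_{-w}^wK^+(z,w)\alpha(z,t)dz+\int_{-w}^wK^-(z,w)\beta(z,t)dz$, $\beta_t-\mu\beta_w=0$, $\alpha(-1,t)=\beta(1,t)=0$, with $q(w)=(\lambda(w)-\mu(-w))L^{12}(-w,w)$ and bounded $K^\pm$. *)

theory Defs
  imports "HOL-Analysis.Analysis"
begin

definition L2_on :: "(real \<Rightarrow> real) \<Rightarrow> bool" where
  "L2_on f \<longleftrightarrow> f \<in> borel_measurable lborel \<and> set_integrable lborel {-1..1} (\<lambda>w. (f w)^2)"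

definition test_fun :: "(real \<Rightarrow> real \<Rightarrow> real) \<Rightarrow> (real \<Rightarrow> real \<Rightarrow> real) \<Rightarrow> (real \<Rightarrow> real \<Rightarrow> real) \<Rightarrow> bool" where
  "test_fun phi phiw phit \<longleftrightarrow>
     (\<forall>w t. ((\<lambda>x. phi x t) has_real_derivative phiw w t) (at w)) \<and>
     (\<forall>w t. ((\<lambda>s. phi w s) has_real_derivative phit w t) (at t)) \<and>
     continuous_on UNIV (\<lambda>(w,t). phi w t) \<and>
     continuous_on UNIV (\<lambda>(w,t). phiw w t) \<and>
     continuous_on UNIV (\<lambda>(w,t). phit w t) \<and>
     (\<exists>S. \<forall>w t. t \<ge> S \<longrightarrow> phi w t = 0)"

definition fb1 :: "(real \<Rightarrow> real \<Rightarrow> real) \<Rightarrow> (real \<Rightarrow> real \<Rightarrow> real) \<Rightarrow> (real \<Rightarrow> real) \<Rightarrow> (real \<Rightarrow> real) \<Rightarrow> real" where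
  "fb1 L11 L12 f g = - (LINT z:{-1..1}|lborel. f z * L11 z (-1)) - (LINT z:{-1..1}|lborel. g z * L12 z (-1))"

definition fb2 :: "(real \<Rightarrow> real \<Rightarrow> real) \<Rightarrow> (real \<Rightarrow> real \<Rightarrow> real) \<Rightarrow> (real \<Rightarrow> real) \<Rightarrow> (real \<Rightarrow> real) \<Rightarrow> real" where
  "fb2 L21 L22 f g = (LINT z:{-1..1}|lborel. f z * L21 z 1) + (LINT z:{-1..1}|lborel. g z * L22 z 1)"

text \<open>Weak (L^2, time-continuous) solution (u,v), u = u w t, of
  u_t + lam(w) u_w = b(w) v,  v_t - mu(w) v_w = c(w) u  on [-1,1] x [0,oo),
  u(-1,t) = U1(u(.,t),v(.,t)),  v(1,t) = U2(u(.,t),v(.,t)),  (u,v)(.,0) = (u0,v0).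
  lam', mu' are the derivatives of lam, mu on [-1,1].\<close>
definition closed_loop_solution ::
  "(real \<Rightarrow> real) \<Rightarrow> (real \<Rightarrow> real) \<Rightarrow> (real \<Rightarrow> real) \<Rightarrow> (real \<Rightarrow> real) \<Rightarrow>
   (real \<Rightarrow> real) \<Rightarrow> (real \<Rightarrow> real) \<Rightarrow>
   ((real \<Rightarrow> real) \<Rightarrow> (real \<Rightarrow> real) \<Rightarrow> real) \<Rightarrow> ((real \<Rightarrow> real) \<Rightarrow> (real \<Rightarrow> real) \<Rightarrow> real) \<Rightarrow>
   (real \<Rightarrow> real) \<Rightarrow> (real \<Rightarrow> real) \<Rightarrow> (real \<Rightarrow> real \<Rightarrow> real) \<Rightarrow> (real \<Rightarrow> real \<Rightarrow> real) \<Rightarrow> bool" where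
  "closed_loop_solution lam lam' mu mu' b c U1 U2 u0 v0 u v \<longleftrightarrow>
     (\<lambda>p::real\<times>real. u (fst p) (snd p)) \<in> borel_measurable lborel \<and>
     (\<lambda>p::real\<times>real. v (fst p) (snd p)) \<in> borel_measurable lborel \<and>
     (\<forall>t\<ge>0. L2_on (\<lambda>w. u w t) \<and> L2_on (\<lambda>w. v w t)) \<and>
     (\<forall>t0\<ge>0. ((\<lambda>t. LINT w:{-1..1}|lborel. (u w t - u w t0)^2) \<longlongrightarrow> 0) (at t0 within {0..}) \<and>
              ((\<lambda>t. LINT w:{-1..1}|lborel. (v w t - v w t0)^2) \<longlongrightarrow> 0) (at t0 within {0..})) \<and>
     (AE w in lborel. w \<in> {-1..1} \<longrightarrow> u w 0 = u0 w \<and> v w 0 = v0 w) \<and>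
     (\<forall>phi phiw phit. test_fun phi phiw phit \<and> (\<forall>t. phi 1 t = 0) \<longrightarrow>
        - (LINT w:{-1..1}|lborel. u0 w * phi w 0)
        - (LINT p:({-1..1} \<times> {0..})|lborel.
              u (fst p) (snd p) * (phit (fst p) (snd p) + lam' (fst p) * phi (fst p) (snd p)
                                   + lam (fst p) * phiw (fst p) (snd p)))
        - (LINT t:{0..}|lborel. lam (-1) * U1 (\<lambda>z. u z t) (\<lambda>z. v z t) * phi (-1) t)
        = (LINT p:({-1..1} \<times> {0..})|lborel.
              b (fst p) * v (fst p) (snd p) * phi (fst p) (snd p))) \<and>
     (\<forall>psi psiw psit. test_fun psi psiw psit \<and> (\<forall>t. psi (-1) t = 0) \<longrightarrow>
        - (LINT w:{-1..1}|lborel. v0 w * psi w 0)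
        - (LINT p:({-1..1} \<times> {0..})|lborel. v (fst p) (snd p) * psit (fst p) (snd p))
        + (LINT p:({-1..1} \<times> {0..})|lborel.
              v (fst p) (snd p) * (mu' (fst p) * psi (fst p) (snd p) + mu (fst p) * psiw (fst p) (snd p)))
        - (LINT t:{0..}|lborel. mu 1 * U2 (\<lambda>z. u z t) (\<lambda>z. v z t) * psi 1 t)
        = (LINT p:({-1..1} \<times> {0..})|lborel.
              c (fst p) * u (fst p) (snd p) * psi (fst p) (snd p)))"

definition kernel_dom :: "(real \<times> real) set" where
  "kernel_dom = {(z,w). z \<in> {-1..1} \<and> w \<in> {-1..1} \<and> \<bar>z\<bar> \<le> \<bar>w\<bar>}"

definition bounded_kernel :: "(real \<Rightarrow> real \<Rightarrow> real) \<Rightarrow> bool" where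
  "bounded_kernel L \<longleftrightarrow> (\<lambda>p::real\<times>real. L (fst p) (snd p)) \<in> borel_measurable lborel \<and>
     bounded ((\<lambda>(z,w). L z w) ` kernel_dom)"

end

theory Submission
  imports Defs
begin

text \<open>
  The left actuator is not needed: take \<open>U\<^sub>1 = 0\<close> and let \<open>U\<^sub>2\<close> be a one-sided backstepping feedback, whose kernels live on
  \<open>-1 \<le> z \<le> w \<le> 1\<close>. Under the Volterra transformation of \<open>v\<close> alone the new variable is purely transported, so the trace
  \<open>v(-1,t)\<close> dies out after the travel time \<open>tau\<close> of \<open>v\<close>; as \<open>u(-1,t) = 0\<close>, the state is then swept out within the travel time
  \<open>sigma\<close> of \<open>u\<close>. Since solutions are weak, this is carried out by duality: for every source supported in
  \<open>t > tau + sigma\<close> the adjoint system is solved in the space direction from \<open>w = 1\<close> with zero data, and the kernels turn this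
  solution into an admissible test pair that pairs the state with the source alone.
  Existence holds for any continuous feedback gains: after subtracting the transported rough data, the mild equations are a
  contraction on continuous functions in a norm with exponential weight in time.
\<close>

section \<open>Calculus in two variables and weighted fixed points\<close>

text \<open>The state is only square integrable, so a transformation of it cannot be differentiated
  directly; the adjoint moves all derivatives to test functions, and extinction follows for every
  weak solution without a uniqueness theorem. The kernels are merely continuous, with derivatives
  only along characteristics. Every computation therefore takes place in a characteristic
  coordinate, where time derivatives fall on the source or its trace; averaging the source over a
  time window supplies that smoothness.

  Solving the adjoint in space from \<open>w = 1\<close> makes \<open>phi(1,.) = 0\<close>
  automatic, while the second admissibility condition \<open>psi(-1,.) = 0\<close> fails by the
  trace \<open>x\<close>. Transporting this trace along the \<open>v\<close>-characteristics carries
  it to \<open>w = 1\<close> with a time advance: there it reads \<open>x(tau + t)\<close>, the very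
  factor that multiplies the gains.

  The extinction time comes from the requirement that the initial data drop out. For a source
  starting at \<open>T1\<close> the Cauchy solution is zero before \<open>T1 - sigma\<close>, and
  the kernel response at time \<open>t\<close> looks ahead to \<open>t + tau\<close>; both vanish at
  \<open>t = 0\<close> once \<open>T1 > tau + sigma\<close>.\<close>

definition cont2 :: "(real \<Rightarrow> real \<Rightarrow> real) \<Rightarrow> bool" where
  "cont2 f \<longleftrightarrow> continuous_on UNIV (\<lambda>p. f (fst p) (snd p))"

lemma cont2_comp:
  assumes "cont2 f" "continuous_on S g" "continuous_on S h"
  shows "continuous_on S (\<lambda>x. f (g x) (h x))"
proof -
  have "continuous_on S ((\<lambda>p. f (fst p) (snd p)) \<circ> (\<lambda>x. (g x, h x)))"
    using assms unfolding cont2_def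
    by (intro continuous_on_compose continuous_on_Pair) (auto intro: continuous_on_subset)
  then show ?thesis by (simp add: o_def)
qed

lemma cont1_comp:
  fixes f :: "real \<Rightarrow> real"
  assumes "continuous_on UNIV f" "continuous_on S g"
  shows "continuous_on S (\<lambda>x. f (g x))"
  by (rule continuous_on_compose2[OF assms]) simp

text \<open>Oriented integral: with coefficients extended to the whole line, moving limits need not
  keep their order, and the derivative rules in both limits then hold at every real point.\<close>

definition oint :: "(real \<Rightarrow> real) \<Rightarrow> real \<Rightarrow> real \<Rightarrow> real" where
  "oint f x y = (if x \<le> y then integral {x..y} f else - integral {y..x} f)"

lemma oint_le: "x \<le> y \<Longrightarrow> oint f x y = integral {x..y} f"
  by (simp add: oint_def)

lemma oint_swap: "oint f x y = - oint f y x"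
  by (auto simp: oint_def)

lemma oint_refl [simp]: "oint f x x = 0"
  by (simp add: oint_def)

context
  fixes f :: "real \<Rightarrow> real"
  assumes cf: "continuous_on UNIV f"
begin

lemma cont_on_any: "continuous_on S f"
  by (rule continuous_on_subset[OF cf]) simp

lemma cont_integrable_on: "f integrable_on {x..y}"
  by (intro integrable_continuous_interval cont_on_any)

lemma oint_base:
  assumes "l \<le> x" "l \<le> y"
  shows "oint f x y = integral {l..y} f - integral {l..x} f"
proof (cases "x \<le> y")
  case True
  then show ?thesis
    using Henstock_Kurzweil_Integration.integral_combine[OF assms(1) True cont_integrable_on]
    by (simp add: oint_def)
next
  case False
  then show ?thesis
    using Henstock_Kurzweil_Integration.integral_combine[OF assms(2) _ cont_integrable_on, of x]
    by (simp add: oint_def)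
qed

lemma oint_combine: "oint f x y + oint f y z = oint f x z"
  using oint_base[of "min x (min y z)"] by simp

lemma oint_deriv: "((\<lambda>y. oint f x y) has_real_derivative f y) (at y)"
proof -
  \<comment> \<open>Strictly below both points, so \<open>y\<close> is interior to the interval on
    which the one-sided fundamental theorem applies and a two-sided derivative results.\<close>
  define l where "l = min x y - 1"
  have "((\<lambda>u. integral {l..u} f) has_real_derivative f y) (at y within {l..y+1})"
    by (rule integral_has_real_derivative) (auto simp: cont_on_any l_def)
  then have "((\<lambda>u. integral {l..u} f) has_real_derivative f y) (at y within {l<..<y+1})"
    by (rule DERIV_subset) auto
  then have "((\<lambda>u. integral {l..u} f) has_real_derivative f y) (at y)"
    by (subst (asm) at_within_open) (auto simp: l_def)
  then have "((\<lambda>u. integral {l..u} f - integral {l..x} f) has_real_derivative f y - 0) (at y)"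
    by (intro derivative_intros)
  then have D: "((\<lambda>u. integral {l..u} f - integral {l..x} f) has_real_derivative f y) (at y)"
    by simp
  have E: "\<forall>\<^sub>F u in nhds y. integral {l..u} f - integral {l..x} f = oint f x u"
  proof -
    have "\<forall>\<^sub>F u in nhds y. u \<in> {l<..}"
      by (intro eventually_nhds_in_open) (auto simp: l_def)
    then show ?thesis
      by eventually_elim (subst oint_base[of l], auto simp: l_def)
  qed
  show ?thesis
    by (rule iffD1[OF DERIV_cong_ev[OF refl E refl] D])
qed

lemma oint_deriv_lower: "((\<lambda>x. oint f x y) has_real_derivative - f x) (at x)"
proof -
  have "((\<lambda>x. - oint f y x) has_real_derivative - f x) (at x)"
    by (intro derivative_intros oint_deriv)
  moreover have "(\<lambda>x. oint f x y) = (\<lambda>x. - oint f y x)" by (rule ext) (rule oint_swap)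
  ultimately show ?thesis by (simp only:)
qed

text \<open>Linear reparametrisation over the fixed interval \<open>{0..1}\<close>: moving limits
  become parameters of the integrand, which is how joint continuity of integrals with moving limits
  is obtained.\<close>

lemma oint_affine:
  "oint f x y = (y - x) * integral {0..1} (\<lambda>s. f (x + s * (y - x)))"
proof -
  have "((\<lambda>s. (y - x) * f (x + s * (y - x))) has_integral (oint f x (x + 1 * (y - x)) - oint f x (x + 0 * (y-x)))) {0..1}"
  proof (rule fundamental_theorem_of_calculus)
    fix s :: real
    have "((\<lambda>s. oint f x (x + s * (y - x))) has_real_derivative (f (x + s * (y - x)) * (y - x))) (at s)"
      by (rule DERIV_chain2[OF oint_deriv]) (auto intro!: derivative_eq_intros)
    then show "((\<lambda>s. oint f x (x + s * (y - x))) has_vector_derivative (y - x) * f (x + s * (y - x))) (at s within {0..1})"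
      by (simp add: has_real_derivative_iff_has_vector_derivative[symmetric] mult.commute has_field_derivative_at_within)
  qed simp
  then have "((\<lambda>s. (y - x) * f (x + s * (y - x))) has_integral oint f x y) {0..1}" by simp
  from integral_unique[OF this] show ?thesis
    by (simp only: Henstock_Kurzweil_Integration.integral_mult_right)
qed

end

lemma oint_cong: "(\<And>s. min x y \<le> s \<Longrightarrow> s \<le> max x y \<Longrightarrow> f s = g s) \<Longrightarrow> oint f x y = oint g x y"
  unfolding oint_def
  using Henstock_Kurzweil_Integration.integral_cong[of "{x..y}" f g] Henstock_Kurzweil_Integration.integral_cong[of "{y..x}" f g]
  by (simp add: min_def max_def split: if_splits)

lemma continuous_on_oint:
  fixes g :: "'a::topological_space \<Rightarrow> real \<Rightarrow> real"
  assumes g: "continuous_on UNIV (\<lambda>(p, s). g p s)"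
    and l: "continuous_on UNIV l" and r: "continuous_on UNIV r"
  shows "continuous_on UNIV (\<lambda>p. oint (g p) (l p) (r p))"
proof -
  have gp: "continuous_on UNIV (g p)" for p
    using continuous_on_compose2[OF g, where f = "Pair p" and s = UNIV] by (simp add: continuous_on_Pair[OF continuous_on_const continuous_on_id])
  have l': "continuous_on UNIV (\<lambda>x::'a \<times> real. l (fst x))"
    using continuous_on_compose2[OF l continuous_on_fst[OF continuous_on_id]] by auto
  have r': "continuous_on UNIV (\<lambda>x::'a \<times> real. r (fst x))"
    using continuous_on_compose2[OF r continuous_on_fst[OF continuous_on_id]] by auto
  have c: "continuous_on UNIV (\<lambda>x::'a \<times> real. (fst x, l (fst x) + snd x * (r (fst x) - l (fst x))))"
    by (intro continuous_intros l' r')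
  have "continuous_on UNIV (\<lambda>x::'a \<times> real. g (fst x) (l (fst x) + snd x * (r (fst x) - l (fst x))))"
    using continuous_on_compose2[OF g c] by simp
  then have "continuous_on (UNIV \<times> cbox 0 1) (\<lambda>(p, s). g p (l p + s * (r p - l p)))"
    by (simp add: split_beta) (erule continuous_on_subset, simp)
  then have "continuous_on UNIV (\<lambda>p. integral (cbox 0 1) (\<lambda>s. g p (l p + s * (r p - l p))))"
    by (rule integral_continuous_on_param)
  then have "continuous_on UNIV (\<lambda>p. (r p - l p) * integral (cbox 0 1) (\<lambda>s. g p (l p + s * (r p - l p))))"
    by (rule continuous_on_mult[OF continuous_on_diff[OF r l]])
  moreover have E: "(\<lambda>p. oint (g p) (l p) (r p)) = (\<lambda>p. (r p - l p) * integral (cbox 0 1) (\<lambda>s. g p (l p + s * (r p - l p))))"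
    unfolding box_real by (rule ext, rule oint_affine[OF gp])
  ultimately show ?thesis unfolding E by blast
qed

lemma cont2_oint:
  assumes g: "continuous_on UNIV (\<lambda>x. g (fst (fst x)) (snd (fst x)) (snd x))"
    and l: "cont2 l" and r: "cont2 r"
  shows "cont2 (\<lambda>x y. oint (g x y) (l x y) (r x y))"
proof -
  have "continuous_on UNIV (\<lambda>(p, s). g (fst p) (snd p) s)"
    unfolding case_prod_unfold by (rule g)
  then show ?thesis using l r unfolding cont2_def
    by (rule continuous_on_oint[where g = "\<lambda>p. g (fst p) (snd p)" and l = "\<lambda>p. l (fst p) (snd p)"
          and r = "\<lambda>p. r (fst p) (snd p)"])
qed

text \<open>Growth at rate at least \<open>k\<close> gives strict monotonicity, hence injectivity.
  It also makes the values unbounded in both directions, so the intermediate value theorem gives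
  surjectivity; read backwards it is a Lipschitz bound \<open>1 / k\<close> for the inverse. Applied
  to travel times, it makes characteristic labels usable as coordinates.\<close>

lemma expanding_homeo:
  fixes f :: "real \<Rightarrow> real"
  assumes f: "continuous_on UNIV f" and k: "0 < k" and ex_all: "\<forall>x y. x \<le> y \<longrightarrow> k * (y - x) \<le> f y - f x"
  shows "f (inv f q) = q" "inv f (f z) = z" "continuous_on UNIV (inv f)"
    "f x \<le> f y \<longleftrightarrow> x \<le> y" "inv f x \<le> inv f y \<longleftrightarrow> x \<le> y"
proof -
  note ex = ex_all[rule_format]
  have le: "f x \<le> f y \<longleftrightarrow> x \<le> y" for x y
  proof
    show "x \<le> y" if "f x \<le> f y"
    proof (rule ccontr)
      assume "\<not> x \<le> y"
      then have "k * (x - y) \<le> f x - f y" "0 < k * (x - y)" using ex[of y x] k by auto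
      with that show False by linarith
    qed
    show "f x \<le> f y" if "x \<le> y"
      using ex[OF that] k that by (smt (verit) mult_nonneg_nonneg)
  qed
  have "inj f" by (rule injI) (metis le order_antisym order_refl)
  have ex_pre: "\<exists>x. f x = q" for q
  proof -
    \<comment> \<open>Radius at which the guaranteed growth \<open>k * R\<close> covers the distance
      from \<open>f 0\<close> to \<open>q\<close>.\<close>
    define R where "R = \<bar>q - f 0\<bar> / k"
    have R: "0 \<le> R" "k * R = \<bar>q - f 0\<bar>" using k by (auto simp: R_def)
    have "f (-R) \<le> q" "q \<le> f R" using ex[of "-R" 0] ex[of 0 R] R by auto
    then show ?thesis
      using IVT'[of f "-R" q R] f R by (auto intro: continuous_on_subset)
  qed
  have s: "f (inv f q) = q" for q
    using ex_pre[of q] by (auto simp: f_inv_into_f)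
  show "f (inv f q) = q" by (rule s)
  show "inv f (f z) = z" using \<open>inj f\<close> by simp
  show le': "f x \<le> f y \<longleftrightarrow> x \<le> y" for x y by (rule le)
  show le2: "inv f x \<le> inv f y \<longleftrightarrow> x \<le> y" for x y using le[of "inv f x" "inv f y"] s by simp
  have "(1/k)-lipschitz_on UNIV (inv f)"
  proof (rule lipschitz_onI)
    have aux: "dist (inv f x) (inv f y) \<le> 1 / k * dist x y" if "y \<le> x" for x y
    proof -
      have "k * (inv f x - inv f y) \<le> x - y"
        using ex[of "inv f y" "inv f x"] that le2[of y x] s by simp
      then show ?thesis using that le2[of y x] k by (simp add: dist_real_def field_simps)
    qed
    show "dist (inv f x) (inv f y) \<le> 1 / k * dist x y" for x y
      using aux[of x y] aux[of y x] by (cases "x \<le> y") (auto simp: dist_commute)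
  qed (use k in auto)
  then show "continuous_on UNIV (inv f)" by (rule lipschitz_on_continuous_on)
qed

text \<open>Derivatives along characteristics and in time are known; this recovers the remaining partial derivative.\<close>

lemma chain_partials:
  fixes F Fx :: "real \<Rightarrow> real \<Rightarrow> real" and Fy g' :: real
  assumes Fx: "\<And>x y. ((\<lambda>x. F x y) has_real_derivative Fx x y) (at x)"
    and Fy: "((\<lambda>y. F (g z) y) has_real_derivative Fy) (at z)"
    and Fx_cont: "cont2 Fx"
    and g: "(g has_real_derivative g') (at z)"
  shows "((\<lambda>z. F (g z) z) has_real_derivative Fx (g z) z * g' + Fy) (at z)"
proof -
  \<comment> \<open>One partial derivative is jointly continuous and the other exists at the point
    in question; together they give total differentiability, and the chain rule along the curve
    \<open>(z, g z)\<close> applies.\<close>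
  have sw: "continuous_on UNIV (\<lambda>(y, x). blinfun_scaleR_left (Fx x y))"
    unfolding split_beta
    by (intro continuous_intros cont2_comp[OF Fx_cont])
  have "((\<lambda>(y, x). F x y) has_derivative (\<lambda>(ty, tx). Fy * ty + blinfun_scaleR_left (Fx (g z) z) tx)) (at (z, g z) within UNIV \<times> UNIV)"
    apply (rule has_derivative_partialsI[where fy = "\<lambda>y x. blinfun_scaleR_left (Fx x y)"])
    using Fx Fy sw
    apply (simp_all add: has_field_derivative_def continuous_on_eq_continuous_at mult_commute_abs)
    done
  then have 1: "((\<lambda>p. F (snd p) (fst p)) has_derivative (\<lambda>p. Fy * fst p + snd p * Fx (g z) z)) (at (z, g z))"
    by (simp add: split_beta')
  have 2: "((\<lambda>z. (z, g z)) has_derivative (\<lambda>h. (h, g' * h))) (at z)"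
    using g by (auto intro!: derivative_eq_intros simp: has_field_derivative_def)
  from has_derivative_compose[OF 2, of "\<lambda>p. F (snd p) (fst p)" "\<lambda>p. Fy * fst p + snd p * Fx (g z) z"] 1
  have "((\<lambda>z. F (g z) z) has_derivative (\<lambda>h. Fy * h + g' * h * Fx (g z) z)) (at z)"
    by (simp add: mult_ac)
  then show ?thesis
    unfolding has_field_derivative_def by (rule has_derivative_eq_rhs) (auto simp: algebra_simps)
qed

text \<open>Splitting at the base point 0 leaves integrals with one moving limit. Each is a function
  of that limit and of \<open>z\<close>, with partial derivatives from the fundamental theorem and
  from differentiation under the integral; \<open>chain_partials\<close> combines them.\<close>

lemma leibniz_variable:
  fixes f fz :: "real \<Rightarrow> real \<Rightarrow> real"
  assumes f: "cont2 f" and fz: "cont2 fz"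
    and df: "\<And>q z. ((\<lambda>z. f q z) has_real_derivative fz q z) (at z)"
    and al: "((al::real \<Rightarrow> real) has_real_derivative al') (at z)" and be: "((be::real \<Rightarrow> real) has_real_derivative be') (at z)"
  shows "((\<lambda>z. oint (\<lambda>q. f q z) (al z) (be z)) has_real_derivative
     f (be z) z * be' - f (al z) z * al' + oint (\<lambda>q. fz q z) (al z) (be z)) (at z)"
proof -
  have cf: "continuous_on S (\<lambda>q. f q z)" and cfz: "continuous_on S (\<lambda>q. fz q z)" for z S
    by (intro cont2_comp[OF f] cont2_comp[OF fz] continuous_intros)+
  have par: "((\<lambda>z. oint (\<lambda>q. f q z) x y) has_real_derivative oint (\<lambda>q. fz q z) x y) (at z)"
    if "x \<le> y" for x y z
  proof -
    have "((\<lambda>z. integral (cbox x y) (\<lambda>q. f q z)) has_real_derivative integral (cbox x y) (\<lambda>q. fz q z)) (at z within UNIV)"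
      by (rule leibniz_rule_field_derivative)
        (simp_all add: split_beta df integrable_continuous_interval cf cont2_comp[OF fz]
          continuous_on_fst continuous_on_snd)
    then show ?thesis using that by (simp add: oint_le)
  qed
  have par': "((\<lambda>z. oint (\<lambda>q. f q z) x y) has_real_derivative oint (\<lambda>q. fz q z) x y) (at z)" for x y z
  proof (cases "x \<le> y")
    case False
    then show ?thesis using DERIV_minus[OF par[of y x z]]
      by (simp add: oint_def)
  qed (rule par)
  have one: "((\<lambda>z. oint (\<lambda>q. f q z) 0 (g z)) has_real_derivative
     f (g z) z * g' + oint (\<lambda>q. fz q z) 0 (g z)) (at z)" if "(g has_real_derivative g') (at z)" for g g'
    by (rule chain_partials[where F = "\<lambda>x z. oint (\<lambda>q. f q z) 0 x" and Fx = f])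
      (rule oint_deriv cf f par' that)+
  have eq: "oint h x y = oint h 0 y - oint h 0 x" if "continuous_on UNIV h" for h x y
    using oint_combine[OF that, of 0 x y] by simp
  have "((\<lambda>z. oint (\<lambda>q. f q z) 0 (be z) - oint (\<lambda>q. f q z) 0 (al z)) has_real_derivative
     (f (be z) z * be' + oint (\<lambda>q. fz q z) 0 (be z)) - (f (al z) z * al' + oint (\<lambda>q. fz q z) 0 (al z))) (at z)"
    by (intro derivative_intros one al be)
  moreover have "(\<lambda>z. oint (\<lambda>q. f q z) (al z) (be z))
      = (\<lambda>z. oint (\<lambda>q. f q z) 0 (be z) - oint (\<lambda>q. f q z) 0 (al z))"
    by (rule ext) (rule eq[OF cf])
  ultimately show ?thesis
    using eq[OF cfz[of UNIV z], of "al z" "be z"] by (simp only:) (simp add: algebra_simps)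
qed

text \<open>Source of the contraction factors: against a weight that decays at rate \<open>k\<close>
  away from one end point, integration gains the factor \<open>1 / k\<close> whatever the length of
  the interval.\<close>

lemma exp_abs_integral_bound:
  fixes h :: "real \<Rightarrow> real"
  assumes lr: "l \<le> r" and z: "z = l \<or> z = r" and k: "0 < k" and E: "0 \<le> E"
    and h: "continuous_on {l..r} h" and b: "\<And>s. s \<in> {l..r} \<Longrightarrow> \<bar>h s\<bar> \<le> E * exp (- k * \<bar>s - z\<bar>)"
  shows "\<bar>integral {l..r} h\<bar> \<le> E / k"
proof -
  define P where "P s = (if z = l then - exp (- k * (s - l)) / k else exp (- k * (r - s)) / k)" for s
  have P: "((\<lambda>s. exp (- k * \<bar>s - z\<bar>)) has_integral (P r - P l)) {l..r}"
  proof (rule fundamental_theorem_of_calculus[OF lr])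
    fix s assume s: "s \<in> {l..r}"
    have "(P has_real_derivative (exp (- k * \<bar>s - z\<bar>))) (at s within {l..r})"
    proof (cases "z = l")
      case True
      then show ?thesis unfolding P_def using s k by (auto intro!: derivative_eq_intros)
    next
      case False
      then show ?thesis unfolding P_def using s k z by (auto intro!: derivative_eq_intros)
    qed
    then show "(P has_vector_derivative (exp (- k * \<bar>s - z\<bar>))) (at s within {l..r})"
      by (simp add: has_real_derivative_iff_has_vector_derivative)
  qed
  have Pb: "P r - P l \<le> 1 / k"
    using k z lr unfolding P_def by (auto simp: divide_simps)
  have "norm (integral {l..r} h) \<le> integral {l..r} (\<lambda>s. E * exp (- k * \<bar>s - z\<bar>))"
    using b h P by (intro integral_norm_bound_integral integrable_continuous_interval) (simp_all, intro continuous_intros)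
  also have "\<dots> = E * (P r - P l)"
    using integral_unique[OF P] by simp
  also have "\<dots> \<le> E * (1 / k)" using Pb E by (rule mult_left_mono)
  finally show ?thesis by simp
qed

text \<open>Banach's theorem in the bounded continuous functions with values in
  \<open>real^'i\<close>, after division by the weights; the unknowns themselves may grow. The
  factor \<open>CARD('i)\<close> comes from estimating the Euclidean norm by the sum of the
  components.\<close>

lemma weighted_fixed_point:
  fixes G :: "('i::finite \<Rightarrow> real \<Rightarrow> real \<Rightarrow> real) \<Rightarrow> ('i \<Rightarrow> real \<Rightarrow> real \<Rightarrow> real)"
  assumes om: "\<And>i. cont2 (om i)" "\<And>i x y. om i x y > 0"
    and cont: "\<And>f i. (\<And>i. cont2 (f i)) \<Longrightarrow> cont2 (G f i)"
    and bd0: "\<And>i x y. \<bar>G (\<lambda>_ _ _. 0) i x y\<bar> \<le> Cz * om i x y"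
    and contr: "\<And>f g D i x y. (\<And>i. cont2 (f i)) \<Longrightarrow> (\<And>i. cont2 (g i)) \<Longrightarrow> 0 \<le> D \<Longrightarrow>
        (\<And>i x y. \<bar>f i x y - g i x y\<bar> \<le> D * om i x y) \<Longrightarrow> \<bar>G f i x y - G g i x y\<bar> \<le> q * D * om i x y"
    and q: "0 \<le> q" "real CARD('i) * q < 1"
  shows "\<exists>f C. (\<forall>i. cont2 (f i)) \<and> (\<forall>i x y. \<bar>f i x y\<bar> \<le> C * om i x y) \<and> (\<forall>i x y. f i x y = G f i x y)"
proof -
  \<comment> \<open>\<open>U\<close> restores the weight, and \<open>H\<close> below is
    \<open>G\<close> conjugated with this rescaling, so a fixed point of \<open>H\<close> yields one
    of \<open>G\<close>.\<close>
  define U :: "((real \<times> real) \<Rightarrow>\<^sub>C (real^'i)) \<Rightarrow> 'i \<Rightarrow> real \<Rightarrow> real \<Rightarrow> real"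
    where "U b i x y = om i x y * (b (x, y) $ i)" for b i x y
  have Uc: "cont2 (U b i)" for b i
    unfolding cont2_def U_def using om(1)[of i]
    by (auto intro!: continuous_intros simp: cont2_def intro: continuous_on_component)
  define H where "H b = Bcontfun (\<lambda>p. \<chi> i. G (U b) i (fst p) (snd p) / om i (fst p) (snd p))" for b
  have Ub: "\<bar>U b i x y\<bar> \<le> norm b * om i x y" for b i x y
  proof -
    have "\<bar>b (x, y) $ i\<bar> \<le> norm b"
      using component_le_norm_cart[of "b (x,y)" i] norm_bounded[of b "(x,y)"] by linarith
    then show ?thesis unfolding U_def using om(2)[of i x y]
      by (simp add: abs_mult mult.commute mult_right_mono)
  qed
  have Gb: "\<bar>G (U b) i x y\<bar> \<le> (q * norm b + Cz) * om i x y" for b i x y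
  proof -
    have "\<bar>G (U b) i x y - G (\<lambda>_ _ _. 0) i x y\<bar> \<le> q * norm b * om i x y"
      by (rule contr) (simp_all add: Uc Ub, simp add: cont2_def)
    with bd0[of i x y] show ?thesis by (simp add: algebra_simps)
  qed
  have cl: "(\<lambda>p. \<chi> i. G (U b) i (fst p) (snd p) / om i (fst p) (snd p)) \<in> bcontfun" for b
  proof (rule bcontfun_normI)
    show "continuous_on UNIV (\<lambda>p. \<chi> i. G (U b) i (fst p) (snd p) / om i (fst p) (snd p))"
    proof (rule continuous_on_vec_lambda, rule continuous_on_divide)
      fix i show "continuous_on UNIV (\<lambda>p. G (U b) i (fst p) (snd p))"
        using cont[OF Uc] unfolding cont2_def .
      show "continuous_on UNIV (\<lambda>p. om i (fst p) (snd p))" using om(1) unfolding cont2_def .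
      show "\<forall>p\<in>UNIV. om i (fst p) (snd p) \<noteq> 0" using om(2) by (metis less_irrefl)
    qed
    fix p
    have "norm (\<chi> i. G (U b) i (fst p) (snd p) / om i (fst p) (snd p))
      \<le> (\<Sum>i\<in>UNIV. \<bar>(\<chi> i. G (U b) i (fst p) (snd p) / om i (fst p) (snd p)) $ i\<bar>)"
      by (rule norm_le_l1_cart)
    also have "\<dots> \<le> (\<Sum>i\<in>(UNIV::'i set). q * norm b + Cz)"
      using Gb[of b] om(2) by (intro sum_mono) (simp add: abs_divide abs_of_pos divide_le_eq)
    finally show "norm (\<chi> i. G (U b) i (fst p) (snd p) / om i (fst p) (snd p)) \<le> (\<Sum>i\<in>(UNIV::'i set). q * norm b + Cz)" .
  qed
  have Happ: "H b p $ i = G (U b) i (fst p) (snd p) / om i (fst p) (snd p)" for b p i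
    unfolding H_def using Bcontfun_inverse[OF cl[of b]] by simp
  have lip: "dist (H b) (H b') \<le> (real CARD('i) * q) * dist b b'" for b b'
  proof (rule dist_bound)
    fix p
    have d: "\<bar>U b i x y - U b' i x y\<bar> \<le> dist b b' * om i x y" for i x y
    proof -
      have "\<bar>b (x, y) $ i - b' (x,y) $ i\<bar> \<le> dist b b'"
        using component_le_norm_cart[of "b (x,y) - b' (x,y)" i] dist_bounded[of b "(x,y)" b']
        by (simp add: dist_norm)
      then show ?thesis unfolding U_def using om(2)[of i x y]
        by (simp add: abs_mult mult.commute mult_right_mono flip: left_diff_distrib right_diff_distrib)
    qed
    have "dist (H b p) (H b' p) \<le> (\<Sum>i\<in>UNIV. \<bar>(H b p - H b' p) $ i\<bar>)"
      unfolding dist_norm by (rule norm_le_l1_cart)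
    also have "\<dots> \<le> (\<Sum>i\<in>(UNIV::'i set). q * dist b b')"
    proof (rule sum_mono)
      fix i
      have "\<bar>G (U b) i (fst p) (snd p) - G (U b') i (fst p) (snd p)\<bar> \<le> q * dist b b' * om i (fst p) (snd p)"
        by (rule contr) (auto simp: Uc d)
      then show "\<bar>(H b p - H b' p) $ i\<bar> \<le> q * dist b b'"
        using om(2)[of i "fst p" "snd p"]
        by (simp add: Happ abs_divide abs_of_pos divide_le_eq flip: diff_divide_distrib)
    qed
    finally show "dist (H b p) (H b' p) \<le> (real CARD('i) * q) * dist b b'" by simp
  qed
  obtain b where b: "H b = b"
    using banach_fix_type[of "real CARD('i) * q" H] q lip by auto
  have E: "U b i x y = G (U b) i x y" for i x y
    using Happ[of b "(x,y)" i] om(2)[of i x y] unfolding b U_def[of b i x y] by (simp add: field_simps)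
  show ?thesis
    by (rule exI[of _ "U b"], rule exI[of _ "norm b"], intro conjI allI) (rule Uc Ub E)+
qed

text \<open>Local counterpart of the fixed point argument: a bound on \<open>Z\<close> that
  reproduces itself with half the constant can be iterated down to zero. It suits regions
  \<open>Z\<close> that the integration paths never leave.\<close>

lemma weighted_vanish:
  fixes f :: "'i \<Rightarrow> real \<Rightarrow> real \<Rightarrow> real"
  assumes b: "\<And>i x y. (x, y) \<in> Z \<Longrightarrow> \<bar>f i x y\<bar> \<le> C * om i x y" and C: "0 \<le> C"
    and half: "\<And>D i x y. 0 \<le> D \<Longrightarrow> (\<And>i x y. (x, y) \<in> Z \<Longrightarrow> \<bar>f i x y\<bar> \<le> D * om i x y) \<Longrightarrow> (x, y) \<in> Z
        \<Longrightarrow> \<bar>f i x y\<bar> \<le> D / 2 * om i x y"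
    and xy: "(x, y) \<in> Z"
  shows "f i x y = 0"
proof -
  have *: "\<forall>i x y. (x, y) \<in> Z \<longrightarrow> \<bar>f i x y\<bar> \<le> C * (1/2)^n * om i x y" for n
  proof (induction n)
    case 0 then show ?case using b by simp
  next
    case (Suc n)
    then show ?case using half[of "C * (1/2)^n"] C by (simp add: field_simps)
  qed
  have "(\<lambda>n. C * (1/2)^n * om i x y) \<longlonglongrightarrow> C * 0 * om i x y"
    by (intro tendsto_intros LIMSEQ_realpow_zero) auto
  then have "\<bar>f i x y\<bar> \<le> C * 0 * om i x y"
    by (rule LIMSEQ_le_const) (use * xy in auto)
  then show ?thesis by simp
qed

section \<open>Characteristics and the backstepping kernel\<close>

definition clamp1 :: "real \<Rightarrow> real" where
  "clamp1 z = max (-1) (min 1 z)"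

lemma clamp1_bounds [simp]: "-1 \<le> clamp1 z" "clamp1 z \<le> 1"
  by (auto simp: clamp1_def)

lemma clamp1_id [simp]: "-1 \<le> z \<Longrightarrow> z \<le> 1 \<Longrightarrow> clamp1 z = z"
  by (auto simp: clamp1_def)

text \<open>The coefficients live on the whole line: outside \<open>[-1,1]\<close> they are arbitrary extensions, which avoids one-sided derivatives at the end points.\<close>

locale hyp_system =
  fixes lam lam' mu mu' b c :: "real \<Rightarrow> real" and l0 L0 B0 :: real
  assumes lam_deriv: "\<And>w. (lam has_real_derivative lam' w) (at w)"
    and mu_deriv: "\<And>w. (mu has_real_derivative mu' w) (at w)"
    and cont_lam': "continuous_on UNIV lam'" and cont_mu': "continuous_on UNIV mu'"
    and l0: "0 < l0"
    and lam_bds: "\<And>w. l0 \<le> lam w" "\<And>w. lam w \<le> L0"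
    and mu_bds: "\<And>w. l0 \<le> mu w" "\<And>w. mu w \<le> L0"
    and cont_b: "continuous_on UNIV b" and cont_c: "continuous_on UNIV c"
    and b_bd: "\<And>w. \<bar>b w\<bar> \<le> B0" and c_bd: "\<And>w. \<bar>c w\<bar> \<le> B0"
begin

lemma L0: "0 < L0" using l0 lam_bds by (meson less_le_trans)
lemma B0: "0 \<le> B0" using b_bd by (meson abs_ge_zero order_trans)
lemma lam_pos: "0 < lam w" using l0 lam_bds by (meson less_le_trans)
lemma mu_pos: "0 < mu w" using l0 mu_bds by (meson less_le_trans)
lemma cont_lam: "continuous_on UNIV lam"
  using lam_deriv by (auto intro!: DERIV_continuous_on simp: continuous_on_eq_continuous_at dest: DERIV_isCont)
lemma cont_mu: "continuous_on UNIV mu"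
  using mu_deriv by (auto simp: continuous_on_eq_continuous_at dest: DERIV_isCont)

text \<open>\<open>a w\<close> is the time a \<open>u\<close>-signal needs from \<open>-1\<close> to \<open>w\<close>, \<open>m w\<close> the time a \<open>v\<close>-signal needs from \<open>w\<close> to \<open>-1\<close>; so \<open>t - a w\<close> and \<open>t + m w\<close> label the characteristics.\<close>

definition a where "a w = oint (\<lambda>s. 1 / lam s) (-1) w"
definition m where "m w = oint (\<lambda>s. 1 / mu s) (-1) w"
text \<open>On a curve \<open>th + a z = q\<close> the diagonal \<open>th = m z\<close> is reached
  where \<open>n z = q\<close>, so \<open>inv n q\<close> is the point at which a kernel
  characteristic meets it.\<close>

definition n where "n w = a w + m w"
definition sigma where "sigma = a 1"
definition tau where "tau = m 1"
definition K1 where "K1 s = c s / mu s"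
definition K2 where "K2 s = b s / lam s"
text \<open>The summand 1 keeps the bound positive when \<open>B0 = 0\<close>; the exponential rates
  below are multiples of \<open>KB\<close>.\<close>

definition KB where "KB = B0 / l0 + 1"

lemma KB: "0 < KB" "\<bar>K1 s\<bar> \<le> KB" "\<bar>K2 s\<bar> \<le> KB"
proof -
  show "0 < KB" using B0 l0 by (simp add: KB_def add_nonneg_pos)
  show "\<bar>K1 s\<bar> \<le> KB"
  proof -
    have "\<bar>c s\<bar> / mu s \<le> B0 / l0" using c_bd mu_bds l0 B0 by (intro frac_le) auto
    then show ?thesis using mu_pos[of s] by (simp add: K1_def KB_def abs_divide abs_of_pos)
  qed
  show "\<bar>K2 s\<bar> \<le> KB"
  proof -
    have "\<bar>b s\<bar> / lam s \<le> B0 / l0" using b_bd lam_bds l0 B0 by (intro frac_le) auto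
    then show ?thesis using lam_pos[of s] by (simp add: K2_def KB_def abs_divide abs_of_pos)
  qed
qed

lemma cont_inv_speed: "continuous_on UNIV (\<lambda>s. 1 / lam s)" "continuous_on UNIV (\<lambda>s. 1 / mu s)"
  using lam_pos mu_pos by (auto intro!: continuous_on_divide cont_lam cont_mu continuous_on_const simp: less_imp_neq[symmetric])

lemma a_deriv: "(a has_real_derivative 1 / lam w) (at w)"
  using oint_deriv[OF cont_inv_speed(1), of "-1" w] by (simp add: a_def[abs_def])
lemma m_deriv: "(m has_real_derivative 1 / mu w) (at w)"
  using oint_deriv[OF cont_inv_speed(2), of "-1" w] by (simp add: m_def[abs_def])
lemma n_deriv: "(n has_real_derivative (1 / lam w + 1 / mu w)) (at w)"
  unfolding n_def[abs_def] by (intro DERIV_add a_deriv m_deriv)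

lemma a_m1 [simp]: "a (-1) = 0" and m_m1 [simp]: "m (-1) = 0"
  by (simp_all add: a_def m_def)

lemma a_expand: "x \<le> y \<Longrightarrow> (1 / L0) * (y - x) \<le> a y - a x"
  and m_expand: "x \<le> y \<Longrightarrow> (1 / L0) * (y - x) \<le> m y - m x"
proof -
  have *: "(1 / L0) * (y - x) \<le> f y - f x"
    if "x \<le> y" and d: "\<And>w. (f has_real_derivative 1 / k w) (at w)" and k: "\<And>w. 0 < k w" "\<And>w. k w \<le> L0"
    for f k :: "real \<Rightarrow> real"
  proof (cases "x = y")
    case False
    then obtain z where "f y - f x = (y - x) * (1 / k z)"
      using MVT2[of x y f "\<lambda>w. 1 / k w"] d \<open>x \<le> y\<close> by auto
    moreover have "1 / L0 \<le> 1 / k z" using k by (simp add: frac_le)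
    ultimately show ?thesis using \<open>x \<le> y\<close> mult_left_mono[of "1 / L0" "1 / k z" "y - x"]
      by (simp add: mult.commute)
  qed simp
  show "x \<le> y \<Longrightarrow> (1 / L0) * (y - x) \<le> a y - a x" by (rule *[OF _ a_deriv lam_pos lam_bds(2)])
  show "x \<le> y \<Longrightarrow> (1 / L0) * (y - x) \<le> m y - m x" by (rule *[OF _ m_deriv mu_pos mu_bds(2)])
qed

lemma n_expand: "x \<le> y \<Longrightarrow> (1 / L0) * (y - x) \<le> n y - n x"
  using a_expand[of x y] m_expand[of x y] L0 unfolding n_def
  by (smt (verit) divide_nonneg_pos mult_nonneg_nonneg)

lemma cont_a0: "continuous_on UNIV a" and cont_m0: "continuous_on UNIV m" and cont_n0: "continuous_on UNIV n"
  using a_deriv m_deriv n_deriv by (auto simp: continuous_on_eq_continuous_at dest: DERIV_isCont)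

lemma iL0: "0 < 1 / L0" using L0 by simp

lemma travel_times_expanding:
  "\<forall>x y. x \<le> y \<longrightarrow> (1 / L0) * (y - x) \<le> a y - a x"
  "\<forall>x y. x \<le> y \<longrightarrow> (1 / L0) * (y - x) \<le> m y - m x"
  "\<forall>x y. x \<le> y \<longrightarrow> (1 / L0) * (y - x) \<le> n y - n x"
  using a_expand m_expand n_expand by auto

lemmas a_homeo = expanding_homeo[OF cont_a0 iL0 travel_times_expanding(1)]
lemmas m_homeo = expanding_homeo[OF cont_m0 iL0 travel_times_expanding(2)]
lemmas n_homeo = expanding_homeo[OF cont_n0 iL0 travel_times_expanding(3)]

lemma cont_K0: "continuous_on UNIV K1" "continuous_on UNIV K2"
  unfolding K1_def[abs_def] K2_def[abs_def] using lam_pos mu_pos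
  by (auto intro!: continuous_on_divide cont_lam cont_mu cont_b cont_c simp: less_imp_neq[symmetric])

lemma cont_clamp1: "continuous_on UNIV clamp1"
  unfolding clamp1_def[abs_def] by (intro continuous_intros)

lemmas cont_of =
  cont1_comp[OF cont_a0] cont1_comp[OF cont_m0] cont1_comp[OF cont_n0] cont1_comp[OF cont_K0(1)] cont1_comp[OF cont_K0(2)]
  cont1_comp[OF a_homeo(3)] cont1_comp[OF m_homeo(3)] cont1_comp[OF n_homeo(3)] cont1_comp[OF cont_clamp1]
  cont1_comp[OF cont_lam] cont1_comp[OF cont_mu]

lemma am_range:
  assumes "-1 \<le> z" "z \<le> 1"
  shows "0 \<le> a z" "a z \<le> sigma" "0 \<le> m z" "m z \<le> tau"
  using assms a_homeo(4)[of "-1" z] a_homeo(4)[of z 1] m_homeo(4)[of "-1" z] m_homeo(4)[of z 1]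
  by (simp_all add: sigma_def tau_def)

lemma sigma_tau_nonneg: "0 \<le> sigma" "0 \<le> tau"
  using am_range[of 1] by auto

text \<open>The value forced on the diagonal of the kernel: in the usual variables it reads \<open>-c / (lam + mu)\<close> there.\<close>

definition gdiag where "gdiag s = - K1 s / (1 / lam s + 1 / mu s)"

lemma cont_gdiag: "continuous_on UNIV gdiag"
  unfolding gdiag_def[abs_def] using lam_pos mu_pos
  by (auto intro!: continuous_intros cont_of continuous_on_add continuous_on_divide cont_inv_speed
      simp: add_pos_pos less_imp_neq[symmetric])

text \<open>With \<open>th = m w\<close>, the functions \<open>M / lam\<close> and \<open>N / mu\<close> are the kernels \<open>L\<^sup>2\<^sup>1(z,w)\<close> and \<open>L\<^sup>2\<^sup>2(z,w)\<close>
  of a one-sided Volterra transformation over \<open>[-1,w]\<close>. They are merely continuous, so their equations are stated along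
  characteristics. Both integrands sit at smaller \<open>th\<close>, hence the weight \<open>exp (L * th)\<close>.\<close>

lemma kernel_exists:
  "\<exists>M N. cont2 M \<and> cont2 N \<and>
     (\<forall>th z. -1 \<le> z \<longrightarrow> z \<le> 1 \<longrightarrow> m z \<le> th \<longrightarrow> th \<le> tau \<longrightarrow>
        M th z = gdiag (inv n (th + a z)) + oint (\<lambda>s. K1 s * N (th + a z - a s) s) z (inv n (th + a z)) \<and>
        N th z = oint (\<lambda>s. K2 s * M (th - m z + m s) s) (-1) z)"
proof -
  \<comment> \<open>\<open>thb\<close> retracts \<open>th\<close> onto \<open>{m z..tau}\<close> for
    the clamped \<open>z\<close>, and \<open>Q\<close> is the corresponding characteristic label.
    The equations become a fixed point problem on the whole plane that agrees with the stated one on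
    the triangle.\<close>
  define thb where "thb th z = max (m (clamp1 z)) (min th tau)" for th z
  define Q where "Q th z = thb th z + a (clamp1 z)" for th z
  \<comment> \<open>Travel times grow at rate at least \<open>1 / L0\<close>, so the effective decay
    rate is \<open>L / L0 = 4 * KB\<close>; against coefficients bounded by \<open>KB\<close> this
    leaves the factor 1/4 for each of two components.\<close>
  define L where "L = 4 * KB * L0"
  define om :: "2 \<Rightarrow> real \<Rightarrow> real \<Rightarrow> real" where "om i th z = exp (L * thb th z)" for i th z
  define G :: "(2 \<Rightarrow> real \<Rightarrow> real \<Rightarrow> real) \<Rightarrow> 2 \<Rightarrow> real \<Rightarrow> real \<Rightarrow> real"
    where "G f i th z = (if i = 1
       then gdiag (inv n (Q th z)) + oint (\<lambda>s. K1 s * f 2 (Q th z - a s) s) (clamp1 z) (inv n (Q th z))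
       else oint (\<lambda>s. K2 s * f 1 (thb th z - m (clamp1 z) + m s) s) (-1) (clamp1 z))" for f i th z
  have Lp: "0 < L" using KB L0 by (simp add: L_def)
  have cthb: "cont2 thb" unfolding cont2_def thb_def by (intro continuous_intros cont_of)
  have cQ: "cont2 Q" unfolding cont2_def Q_def by (intro continuous_intros cont_of cont2_comp[OF cthb])
  have thb_b: "m (clamp1 z) \<le> thb th z" "thb th z \<le> tau" for th z
    using am_range[of "clamp1 z"] by (auto simp: thb_def)
  \<comment> \<open>The characteristic of \<open>M\<close> meets the diagonal to the right of
    \<open>z\<close> and inside the interval, so the first integral is correctly oriented.\<close>
  have Qb: "clamp1 z \<le> inv n (Q th z)" "inv n (Q th z) \<le> 1" for th z
  proof -
    have "n (clamp1 z) \<le> Q th z" using thb_b(1)[of z th] thb_b(2)[of th z] by (simp add: n_def Q_def)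
    then show "clamp1 z \<le> inv n (Q th z)" using n_homeo(4)[of "clamp1 z" "inv n (Q th z)"] n_homeo(1) by simp
    have "Q th z \<le> n 1" using thb_b(2)[of th z] am_range[of "clamp1 z"]
      by (simp add: n_def Q_def sigma_def tau_def)
    then show "inv n (Q th z) \<le> 1" using n_homeo(4)[of "inv n (Q th z)" 1] n_homeo(1) by simp
  qed
  have gb: "\<exists>C. \<forall>s. -1 \<le> s \<and> s \<le> 1 \<longrightarrow> \<bar>gdiag s\<bar> \<le> C"
  proof -
    have "compact (gdiag ` {-1..1})"
      by (intro compact_continuous_image continuous_on_subset[OF cont_gdiag]) auto
    then have "bounded (gdiag ` {-1..1})" by (rule compact_imp_bounded)
    then obtain C where "\<forall>s\<in>{-1..1}. \<bar>gdiag s\<bar> \<le> C" unfolding bounded_iff by auto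
    then show ?thesis by (intro exI[of _ C]) auto
  qed
  then obtain C where C: "\<And>s. -1 \<le> s \<Longrightarrow> s \<le> 1 \<Longrightarrow> \<bar>gdiag s\<bar> \<le> C" by blast
  have "\<exists>f C. (\<forall>i. cont2 (f i)) \<and> (\<forall>i x y. \<bar>f i x y\<bar> \<le> C * om i x y) \<and> (\<forall>i x y. f i x y = G f i x y)"
  proof (rule weighted_fixed_point[where q = "1/4" and Cz = C])
    show "cont2 (om i)" for i unfolding om_def cont2_def by (intro continuous_intros cont2_comp[OF cthb])
    show "om i x y > 0" for i x y by (simp add: om_def)
    show "cont2 (G f i)" if f: "\<And>i. cont2 (f i)" for f i
    proof (cases "i = 1")
      case True
      have "cont2 (\<lambda>th z. gdiag (inv n (Q th z)) + oint (\<lambda>s. K1 s * f 2 (Q th z - a s) s) (clamp1 z) (inv n (Q th z)))"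
        unfolding cont2_def
        by (intro continuous_on_add cont1_comp[OF cont_gdiag] cont_of cont2_comp[OF cQ] continuous_intros
            cont2_oint[unfolded cont2_def] cont2_comp[OF f])
      then show ?thesis using True unfolding G_def by simp
    next
      case False
      have "cont2 (\<lambda>th z. oint (\<lambda>s. K2 s * f 1 (thb th z - m (clamp1 z) + m s) s) (-1) (clamp1 z))"
        unfolding cont2_def
        by (intro cont_of cont2_comp[OF cthb] continuous_intros
            cont2_oint[unfolded cont2_def] cont2_comp[OF f])
      then show ?thesis using False unfolding G_def by simp
    qed
    have om1: "1 \<le> om i th z" for i th z
      unfolding om_def using Lp thb_b(1)[of z th] thb_b(2)[of th z] am_range[of "clamp1 z"] by simp
    show "\<bar>G (\<lambda>_ _ _. 0) i x y\<bar> \<le> C * om i x y" for i x y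
    proof -
      have "\<bar>gdiag (inv n (Q x y))\<bar> \<le> C"
        using C Qb(1)[of y x] Qb(2)[of x y] clamp1_bounds(1)[of y] by (meson order_trans)
      moreover have "0 \<le> C" using calculation by linarith
      moreover have "C * 1 \<le> C * om i x y" using om1 \<open>0 \<le> C\<close> by (intro mult_left_mono) auto
      ultimately show ?thesis by (auto simp: G_def oint_def)
    qed
    show "\<bar>G f i x y - G g i x y\<bar> \<le> 1/4 * D * om i x y"
      if f: "\<And>i. cont2 (f i)" and g: "\<And>i. cont2 (g i)" and D: "0 \<le> D"
        and d: "\<And>i x y. \<bar>f i x y - g i x y\<bar> \<le> D * om i x y" for f g D i x y
    proof -
      define E where "E = KB * D * exp (L * thb x y)"
      have E: "0 \<le> E" "E / (L * (1 / L0)) = 1/4 * D * om i x y"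
        using KB D L0 by (simp_all add: E_def L_def om_def field_simps)
      have kL: "0 < L * (1 / L0)" using Lp L0 by simp
      \<comment> \<open>At distance \<open>\<bar>s - clamp1 y\<bar>\<close> along either
        characteristic, \<open>th\<close> has dropped by at least that distance over
        \<open>L0\<close>; the weight converts the drop into exponential decay.\<close>
      have bd: "\<bar>Kk * f j th s - Kk * g j th s\<bar> \<le> E * exp (- (L * (1 / L0)) * \<bar>s - clamp1 y\<bar>)"
        if "\<bar>Kk\<bar> \<le> KB" "thb th s \<le> thb x y - 1 / L0 * \<bar>s - clamp1 y\<bar>" for Kk j th s
      proof -
        have "\<bar>Kk * f j th s - Kk * g j th s\<bar> = \<bar>Kk\<bar> * \<bar>f j th s - g j th s\<bar>"
          by (simp add: abs_mult flip: right_diff_distrib)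
        also have "\<dots> \<le> KB * (D * om j th s)"
          using that d KB(1) by (intro mult_mono) auto
        also have "\<dots> \<le> KB * (D * exp (L * (thb x y - 1 / L0 * \<bar>s - clamp1 y\<bar>)))"
          unfolding om_def using that Lp KB D by (intro mult_left_mono) auto
        also have "\<dots> = E * exp (- (L * (1 / L0)) * \<bar>s - clamp1 y\<bar>)"
          by (simp add: E_def right_diff_distrib exp_diff exp_minus field_simps)
        finally show ?thesis .
      qed
      show ?thesis
      proof (cases "i = 1")
        case True
        have ci: "continuous_on S (\<lambda>s. K1 s * h 2 (Q x y - a s) s)" if "\<And>i. cont2 (h i)" for h :: "2 \<Rightarrow> real \<Rightarrow> real \<Rightarrow> real" and S
          by (intro continuous_intros cont_of cont2_comp[OF that])
        have "\<bar>integral {clamp1 y..inv n (Q x y)} (\<lambda>s. K1 s * f 2 (Q x y - a s) s - K1 s * g 2 (Q x y - a s) s)\<bar> \<le> E / (L * (1 / L0))"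
        proof (rule exp_abs_integral_bound[where z = "clamp1 y"])
          fix s assume s: "s \<in> {clamp1 y..inv n (Q x y)}"
          then have s1: "-1 \<le> s" "s \<le> 1" using Qb(1)[of y x] Qb(2)[of x y] clamp1_bounds[of y]
            unfolding atLeastAtMost_iff by linarith+
          have "n s \<le> Q x y" using s n_homeo(4)[of s "inv n (Q x y)"] n_homeo(1) by simp
          then have "m s \<le> Q x y - a s" by (simp add: n_def)
          moreover have "1 / L0 * (s - clamp1 y) \<le> a s - a (clamp1 y)" using s a_expand by simp
          moreover have "0 \<le> 1 / L0 * (s - clamp1 y)" using s L0 by simp
          ultimately have "thb (Q x y - a s) s \<le> thb x y - 1 / L0 * \<bar>s - clamp1 y\<bar>"
            using s s1 thb_b(1)[of y x] thb_b(2)[of x y] unfolding thb_def[of "Q x y - a s"] by (simp add: Q_def)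
          then show "\<bar>K1 s * f 2 (Q x y - a s) s - K1 s * g 2 (Q x y - a s) s\<bar> \<le> E * exp (- (L * (1 / L0)) * \<bar>s - clamp1 y\<bar>)"
            by (intro bd KB)
        qed (use Qb kL E in \<open>auto intro!: continuous_on_diff ci f g\<close>)
        then show ?thesis
          unfolding E(2) using True Qb(1)[of y x] Qb(2)[of x y]
          by (simp add: G_def oint_le Henstock_Kurzweil_Integration.integral_diff integrable_continuous_interval ci f g)
      next
        case False
        have ci: "continuous_on S (\<lambda>s. K2 s * h 1 (thb x y - m (clamp1 y) + m s) s)" if "\<And>i. cont2 (h i)" for h :: "2 \<Rightarrow> real \<Rightarrow> real \<Rightarrow> real" and S
          by (intro continuous_intros cont_of cont2_comp[OF that])
        have "\<bar>integral {-1..clamp1 y} (\<lambda>s. K2 s * f 1 (thb x y - m (clamp1 y) + m s) s - K2 s * g 1 (thb x y - m (clamp1 y) + m s) s)\<bar> \<le> E / (L * (1 / L0))"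
        proof (rule exp_abs_integral_bound[where z = "clamp1 y"])
          fix s assume s: "s \<in> {-1..clamp1 y}"
          then have s1: "-1 \<le> s" "s \<le> 1" using clamp1_bounds(2)[of y]
            unfolding atLeastAtMost_iff by linarith+
          have "1 / L0 * (clamp1 y - s) \<le> m (clamp1 y) - m s" using s m_expand by simp
          moreover have "0 \<le> 1 / L0 * (clamp1 y - s)" using s L0 by simp
          ultimately have "thb (thb x y - m (clamp1 y) + m s) s \<le> thb x y - 1 / L0 * \<bar>s - clamp1 y\<bar>"
            using s s1 thb_b(1)[of y x] thb_b(2)[of x y] unfolding thb_def[of "thb x y - m (clamp1 y) + m s"] by (simp add: abs_if)
          then show "\<bar>K2 s * f 1 (thb x y - m (clamp1 y) + m s) s - K2 s * g 1 (thb x y - m (clamp1 y) + m s) s\<bar> \<le> E * exp (- (L * (1 / L0)) * \<bar>s - clamp1 y\<bar>)"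
            by (intro bd KB)
        qed (use kL E in \<open>auto intro!: continuous_on_diff ci f g\<close>)
        then show ?thesis
          unfolding E(2) using False
          by (simp add: G_def oint_le Henstock_Kurzweil_Integration.integral_diff integrable_continuous_interval ci f g)
      qed
    qed
  qed auto
  then obtain f where fc: "\<And>i. cont2 (f i)" and fe: "\<And>i x y. f i x y = G f i x y" by blast
  show ?thesis
  proof (intro exI conjI allI impI)
    show "cont2 (f 1)" "cont2 (f 2)" by (rule fc)+
    fix th z assume h: "-1 \<le> z" "z \<le> 1" "m z \<le> th" "th \<le> tau"
    then have "thb th z = th" "Q th z = th + a z" by (auto simp: thb_def Q_def)
    with h show "f 1 th z = gdiag (inv n (th + a z)) + oint (\<lambda>s. K1 s * f 2 (th + a z - a s) s) z (inv n (th + a z))"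
      "f 2 th z = oint (\<lambda>s. K2 s * f 1 (th - m z + m s) s) (-1) z"
      using fe[of 1 th z] fe[of 2 th z] by (simp_all add: G_def)
  qed
qed

end

section \<open>Response of the adjoint system\<close>

lemma oint_shift:
  assumes "continuous_on UNIV f"
  shows "oint f (x + d) (y + d) = oint (\<lambda>r. f (r + d)) x y"
proof -
  have c: "continuous_on UNIV (\<lambda>r. f (r + d))"
    by (intro cont1_comp[OF assms] continuous_intros)
  show ?thesis by (simp add: oint_affine[OF assms] oint_affine[OF c] algebra_simps)
qed

lemma oint_cmult: "oint (\<lambda>x. k * f x) x y = k * oint f x y"
  by (simp add: oint_def)

definition C1_2 :: "(real \<Rightarrow> real \<Rightarrow> real) \<Rightarrow> (real \<Rightarrow> real \<Rightarrow> real) \<Rightarrow> (real \<Rightarrow> real \<Rightarrow> real) \<Rightarrow> bool" where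
  "C1_2 F Fz Ft \<longleftrightarrow> cont2 Fz \<and> cont2 Ft \<and> cont2 F \<and>
     (\<forall>z t. ((\<lambda>z. F z t) has_real_derivative Fz z t) (at z)) \<and>
     (\<forall>z t. ((\<lambda>t. F z t) has_real_derivative Ft z t) (at t))"

lemma C1_2I:
  assumes "cont2 Fz" "cont2 Ft" "cont2 F"
    and "\<And>z t. ((\<lambda>z. F z t) has_real_derivative Fz z t) (at z)"
    and "\<And>z t. ((\<lambda>t. F z t) has_real_derivative Ft z t) (at t)"
  shows "C1_2 F Fz Ft"
  using assms by (simp add: C1_2_def)

lemma C1_2D:
  assumes "C1_2 F Fz Ft"
  shows "cont2 Fz" "cont2 Ft" "cont2 F"
    and "((\<lambda>z. F z t) has_real_derivative Fz z t) (at z)"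
    and "((\<lambda>t. F z t) has_real_derivative Ft z t) (at t)"
  using assms by (simp_all add: C1_2_def)

text \<open>Return from characteristic coordinates to space and time. For
  \<open>e' = - 1 / lam\<close> or \<open>e' = 1 / mu\<close>, the derivative of the sheared
  function along the corresponding characteristic is \<open>Fz\<close> alone.\<close>

lemma C1_2_shear:
  assumes F: "C1_2 F Fz Ft" and e: "\<And>z. (e has_real_derivative e' z) (at z)" and e': "continuous_on UNIV e'"
  shows "C1_2 (\<lambda>z t. F z (t + e z)) (\<lambda>z t. Fz z (t + e z) + Ft z (t + e z) * e' z) (\<lambda>z t. Ft z (t + e z))"
proof -
  have ce: "continuous_on UNIV e"
    using e by (auto simp: continuous_on_eq_continuous_at dest: DERIV_isCont)
  show ?thesis
  proof (rule C1_2I)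
    show "cont2 (\<lambda>z t. Fz z (t + e z) + Ft z (t + e z) * e' z)" "cont2 (\<lambda>z t. Ft z (t + e z))" "cont2 (\<lambda>z t. F z (t + e z))"
      unfolding cont2_def
      by (intro continuous_intros cont2_comp[OF C1_2D(1)[OF F]] cont2_comp[OF C1_2D(2)[OF F]]
          cont2_comp[OF C1_2D(3)[OF F]] cont1_comp[OF ce] cont1_comp[OF e'])+
    fix z t
    have "((\<lambda>z. (\<lambda>x y. F y x) (t + e z) z) has_real_derivative (\<lambda>x y. Ft y x) (t + e z) z * e' z + Fz z (t + e z)) (at z)"
    proof (rule chain_partials[where F = "\<lambda>x y. F y x" and Fx = "\<lambda>x y. Ft y x"])
      show "cont2 (\<lambda>x y. Ft y x)" unfolding cont2_def
        by (intro cont2_comp[OF C1_2D(2)[OF F]] continuous_intros)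
      show "((\<lambda>z. t + e z) has_real_derivative e' z) (at z)"
        using DERIV_add[OF DERIV_const e, of t z] by simp
    qed (rule C1_2D[OF F])+
    then show "((\<lambda>z. F z (t + e z)) has_real_derivative Fz z (t + e z) + Ft z (t + e z) * e' z) (at z)"
      by (simp add: add.commute)
    have "((\<lambda>t. F z (t + e z)) has_real_derivative Ft z (t + e z) * 1) (at t)"
      by (rule DERIV_chain2[OF C1_2D(5)[OF F]]) (auto intro!: derivative_eq_intros)
    then show "((\<lambda>t. F z (t + e z)) has_real_derivative Ft z (t + e z)) (at t)" by simp
  qed
qed

text \<open>The time variable \<open>p\<close> occurs only in the signal \<open>x\<close>, so time
  derivatives fall on \<open>x\<close>. Of the kernel only the derivative in \<open>z\<close> at
  fixed label \<open>q\<close> enters, and this exists although the kernels are merely continuous in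
  \<open>q\<close>.\<close>

lemma C1_2_oint:
  assumes f: "cont2 f" and f2: "cont2 f2" and df: "\<And>q z. ((\<lambda>z. f q z) has_real_derivative f2 q z) (at z)"
    and x: "\<And>t. (x has_real_derivative x' t) (at t)" and x': "continuous_on UNIV x'"
    and al: "\<And>z. (al has_real_derivative al' z) (at z)" and be: "\<And>z. (be has_real_derivative be' z) (at z)"
    and al': "continuous_on UNIV al'" and be': "continuous_on UNIV be'"
  shows "C1_2 (\<lambda>z p. oint (\<lambda>q. f q z * x (q + p)) (al z) (be z))
     (\<lambda>z p. f (be z) z * x (be z + p) * be' z - f (al z) z * x (al z + p) * al' z + oint (\<lambda>q. f2 q z * x (q + p)) (al z) (be z))
     (\<lambda>z p. oint (\<lambda>q. f q z * x' (q + p)) (al z) (be z))"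
proof -
  have cx: "continuous_on UNIV x" and cal: "continuous_on UNIV al" and cbe: "continuous_on UNIV be"
    using x al be by (auto simp: continuous_on_eq_continuous_at dest: DERIV_isCont)
  note ci = continuous_intros cont1_comp[OF cx] cont1_comp[OF x'] cont1_comp[OF cal] cont1_comp[OF cbe]
    cont1_comp[OF al'] cont1_comp[OF be'] cont2_comp[OF f] cont2_comp[OF f2]
  show ?thesis
  proof (rule C1_2I)
    have *: "cont2 (\<lambda>z p. oint (\<lambda>q. g q z * y (q + p)) (al z) (be z))"
      if g: "cont2 g" and y: "continuous_on UNIV y" for g y
      by (intro cont2_oint continuous_intros cont1_comp[OF y] cont2_comp[OF g])
         (simp_all add: cont2_def, (intro ci)+)
    show "cont2 (\<lambda>z p. oint (\<lambda>q. f q z * x' (q + p)) (al z) (be z))" "cont2 (\<lambda>z p. oint (\<lambda>q. f q z * x (q + p)) (al z) (be z))"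
      by (rule *[OF f x'], rule *[OF f cx])
    show "cont2 (\<lambda>z p. f (be z) z * x (be z + p) * be' z - f (al z) z * x (al z + p) * al' z + oint (\<lambda>q. f2 q z * x (q + p)) (al z) (be z))"
      using *[OF f2 cx] unfolding cont2_def by (intro ci) assumption
    fix z p
    have "cont2 (\<lambda>q z. f q z * x (q + p))" "cont2 (\<lambda>q z. f2 q z * x (q + p))"
      unfolding cont2_def by (intro ci)+
    from leibniz_variable[OF this _ al be]
    show "((\<lambda>z. oint (\<lambda>q. f q z * x (q + p)) (al z) (be z)) has_real_derivative
        f (be z) z * x (be z + p) * be' z - f (al z) z * x (al z + p) * al' z + oint (\<lambda>q. f2 q z * x (q + p)) (al z) (be z)) (at z)"
      by (simp add: DERIV_cmult_right df)
    have c: "cont2 (\<lambda>q p. f q z * x (q + p))" "cont2 (\<lambda>q p. f q z * x' (q + p))"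
      unfolding cont2_def by (intro ci)+
    have d: "((\<lambda>p. f q z * x (q + p)) has_real_derivative f q z * x' (q + p)) (at p)" for q p
    proof -
      have "((\<lambda>p. x (q + p)) has_real_derivative x' (q + p) * 1) (at p)"
        by (rule DERIV_chain2[OF x]) (auto intro!: derivative_eq_intros)
      then show ?thesis by (intro DERIV_cmult) simp
    qed
    show "((\<lambda>p. oint (\<lambda>q. f q z * x (q + p)) (al z) (be z)) has_real_derivative
        oint (\<lambda>q. f q z * x' (q + p)) (al z) (be z)) (at p)"
      using leibniz_variable[OF c d DERIV_const DERIV_const, of "al z" "be z" p] by simp
  qed
qed

locale hyp_kernel = hyp_system +
  fixes M N :: "real \<Rightarrow> real \<Rightarrow> real"
  assumes cont_M: "cont2 M" and cont_N: "cont2 N"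
    and M_eq: "\<And>th z. -1 \<le> z \<Longrightarrow> z \<le> 1 \<Longrightarrow> m z \<le> th \<Longrightarrow> th \<le> tau \<Longrightarrow>
        M th z = gdiag (inv n (th + a z)) + oint (\<lambda>s. K1 s * N (th + a z - a s) s) z (inv n (th + a z))"
    and N_eq: "\<And>th z. -1 \<le> z \<Longrightarrow> z \<le> 1 \<Longrightarrow> m z \<le> th \<Longrightarrow> th \<le> tau \<Longrightarrow>
        N th z = oint (\<lambda>s. K2 s * M (th - m z + m s) s) (-1) z"
begin

text \<open>\<open>M\<close> and \<open>N\<close> in characteristic coordinates, continued beyond the triangle \<open>m z \<le> th \<le> tau\<close>; unlike \<open>M\<close> and \<open>N\<close> they are differentiable in \<open>z\<close>.\<close>

definition "Mh q z = gdiag (inv n q) + oint (\<lambda>s. K1 s * N (q - a s) s) z (inv n q)"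
definition "Nh p z = oint (\<lambda>s. K2 s * M (p + m s) s) (-1) z"

text \<open>The kernels on the line \<open>w = 1\<close>, which is \<open>th = tau\<close>: these
  are the gains of the feedback at the right end.\<close>

definition "k1 z = Mh (tau + a z) z / lam z"
definition "k2 z = Nh (tau - m z) z / mu z"

lemma cont_Mh: "cont2 Mh" and cont_Nh: "cont2 Nh"
proof -
  show "cont2 Mh" unfolding Mh_def[abs_def] cont2_def
    by (intro continuous_on_add cont1_comp[OF cont_gdiag] cont_of cont2_oint[unfolded cont2_def] continuous_intros cont2_comp[OF cont_N])
  show "cont2 Nh" unfolding Nh_def[abs_def] cont2_def
    by (intro cont_of cont2_oint[unfolded cont2_def] continuous_intros cont2_comp[OF cont_M])
qed

lemma cont_k: "continuous_on UNIV k1" "continuous_on UNIV k2"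
  unfolding k1_def[abs_def] k2_def[abs_def] using lam_pos mu_pos
  by (auto intro!: continuous_on_divide cont_lam cont_mu cont2_comp[OF cont_Mh] cont2_comp[OF cont_Nh] cont_of continuous_on_add
      continuous_on_diff continuous_on_const continuous_on_id simp: less_imp_neq[symmetric])

lemma Mh_deriv: "((\<lambda>z. Mh q z) has_real_derivative - (K1 z * N (q - a z) z)) (at z)"
proof -
  have "continuous_on UNIV (\<lambda>s. K1 s * N (q - a s) s)"
    by (intro continuous_intros cont_of cont2_comp[OF cont_N])
  from DERIV_add[OF DERIV_const oint_deriv_lower[OF this]] show ?thesis
    unfolding Mh_def by simp
qed

lemma Nh_deriv: "((\<lambda>z. Nh p z) has_real_derivative K2 z * M (p + m z) z) (at z)"
proof -
  have "continuous_on UNIV (\<lambda>s. K2 s * M (p + m s) s)"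
    by (intro continuous_intros cont_of cont2_comp[OF cont_M])
  from oint_deriv[OF this] show ?thesis
    unfolding Nh_def by simp
qed

lemma Mh_diag: "Mh (n z) z = gdiag z"
  by (simp add: Mh_def n_homeo)

lemma Mh_M: "-1 \<le> z \<Longrightarrow> z \<le> 1 \<Longrightarrow> m z \<le> th \<Longrightarrow> th \<le> tau \<Longrightarrow> Mh (th + a z) z = M th z"
  by (simp add: Mh_def M_eq)

lemma Nh_N: "-1 \<le> z \<Longrightarrow> z \<le> 1 \<Longrightarrow> m z \<le> th \<Longrightarrow> th \<le> tau \<Longrightarrow> Nh (th - m z) z = N th z"
  by (simp add: Nh_def N_eq)

text \<open>On \<open>[-1,1]\<close> these are \<open>\<integral> M(th,z) x(th+t) dth\<close> and \<open>\<integral> N(th,z) x(th+t) dth\<close> over \<open>m z \<le> th \<le> tau\<close>.\<close>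

definition "RA x z t = oint (\<lambda>q. Mh q z * x (q + (t - a z))) (n z) (tau + a z)"
definition "RB x z t = oint (\<lambda>q. Nh q z * x (q + (t + m z))) 0 (tau - m z)"

context
  fixes x x' :: "real \<Rightarrow> real"
  assumes x: "\<And>t. (x has_real_derivative x' t) (at t)" and x': "continuous_on UNIV x'"
begin

lemma cont_x: "continuous_on UNIV x"
  using x by (auto simp: continuous_on_eq_continuous_at dest: DERIV_isCont)

text \<open>At fixed label \<open>q = th + a z\<close> the derivative along the
  \<open>u\<close>-characteristic acts only on \<open>Mh\<close> and on the limits. The upper limit
  \<open>th = tau\<close> yields the gain term, the interior derivative of \<open>Mh\<close> turns
  the response into \<open>RB\<close>, and the lower limit on the diagonal yields
  \<open>K1 z * x (m z + t)\<close>, for which \<open>gdiag\<close> was chosen.\<close>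

lemma RA_C1: "\<exists>Az At. C1_2 (RA x) Az At \<and>
   (\<forall>z t. -1 \<le> z \<longrightarrow> z \<le> 1 \<longrightarrow> Az z t + At z t / lam z = k1 z * x (tau + t) + K1 z * (x (m z + t) - RB x z t))"
proof -
  have cf2: "cont2 (\<lambda>q z. - (K1 z * N (q - a z) z))"
    unfolding cont2_def by (intro continuous_intros cont_of cont2_comp[OF cont_N])
  have be: "((\<lambda>z. tau + a z) has_real_derivative 1 / lam z) (at z)" for z
    using DERIV_add[OF DERIV_const a_deriv, of tau z] by simp
  have cn: "continuous_on UNIV (\<lambda>w. 1 / lam w + 1 / mu w)"
    by (intro continuous_on_add cont_inv_speed)
  note C = C1_2_oint[OF cont_Mh cf2 Mh_deriv x x' n_deriv be cn cont_inv_speed(1)]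
  define e where "e z = - a z" for z
  have e: "(e has_real_derivative - (1 / lam z)) (at z)" for z
    unfolding e_def[abs_def] by (intro DERIV_minus a_deriv)
  have ce: "continuous_on UNIV (\<lambda>z. - (1 / lam z))" by (intro continuous_on_minus cont_inv_speed)
  define Az At where "Az = (\<lambda>z t. Mh (tau + a z) z * x (tau + a z + (t + e z)) * (1 / lam z) - Mh (n z) z * x (n z + (t + e z)) * (1 / lam z + 1 / mu z) + oint (\<lambda>q. - (K1 z * N (q - a z) z) * x (q + (t + e z))) (n z) (tau + a z)
     + oint (\<lambda>q. Mh q z * x' (q + (t + e z))) (n z) (tau + a z) * - (1 / lam z))"
    and "At = (\<lambda>z t. oint (\<lambda>q. Mh q z * x' (q + (t + e z))) (n z) (tau + a z))"
  have "C1_2 (RA x) Az At"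
    using C1_2_shear[OF C e ce] unfolding Az_def At_def RA_def[abs_def] e_def by simp
  moreover have "Az z t + At z t / lam z = k1 z * x (tau + t) + K1 z * (x (m z + t) - RB x z t)"
    if z: "-1 \<le> z" "z \<le> 1" for z t
  proof -
    have mz: "m z \<le> tau" using am_range[OF z] by simp
    have c1: "continuous_on UNIV (\<lambda>q. N (q - a z) z * x (q + (t - a z)))"
      by (intro continuous_intros cont2_comp[OF cont_N] cont1_comp[OF cont_x])
    have "oint (\<lambda>q. N (q - a z) z * x (q + (t - a z))) (n z) (tau + a z)
        = oint (\<lambda>r. N (r + m z) z * x (r + (t + m z))) 0 (tau - m z)"
      using oint_shift[OF c1, of 0 "n z" "tau - m z"] by (simp add: n_def algebra_simps)
    also have "\<dots> = oint (\<lambda>r. Nh r z * x (r + (t + m z))) 0 (tau - m z)"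
      using mz Nh_N[OF z, of "r + m z" for r] by (intro oint_cong) (simp add: min_def max_def)
    also have "\<dots> = RB x z t" by (simp add: RB_def)
    finally have RB: "oint (\<lambda>q. N (q - a z) z * x (q + (t - a z))) (n z) (tau + a z) = RB x z t" .
    have "oint (\<lambda>q. - (K1 z * N (q - a z) z) * x (q + (t + e z))) (n z) (tau + a z) = - K1 z * RB x z t"
      unfolding RB[symmetric] oint_cmult[symmetric] e_def by (simp add: mult.assoc)
    moreover have "Mh (n z) z * x (n z + (t + e z)) * (1 / lam z + 1 / mu z) = - K1 z * x (m z + t)"
    proof -
      have "1 / lam z + 1 / mu z \<noteq> 0" using lam_pos[of z] mu_pos[of z] by (simp add: add_pos_pos less_imp_neq[symmetric])
      then show ?thesis unfolding Mh_diag gdiag_def e_def by (simp add: n_def)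
    qed
    ultimately show ?thesis
      unfolding Az_def At_def k1_def by (simp add: e_def algebra_simps)
  qed
  ultimately show ?thesis by blast
qed

text \<open>Same computation at fixed label \<open>q = th - m z\<close>. Here the diagonal is the
  constant limit \<open>q = 0\<close> and contributes nothing, which is why \<open>N\<close> carries
  no diagonal condition.\<close>

lemma RB_C1: "\<exists>Bz Bt. C1_2 (RB x) Bz Bt \<and>
   (\<forall>z t. -1 \<le> z \<longrightarrow> z \<le> 1 \<longrightarrow> Bz z t - Bt z t / mu z = K2 z * RA x z t - k2 z * x (tau + t))"
proof -
  have cf2: "cont2 (\<lambda>q z. K2 z * M (q + m z) z)"
    unfolding cont2_def by (intro continuous_intros cont_of cont2_comp[OF cont_M])
  have be: "((\<lambda>z. tau - m z) has_real_derivative - (1 / mu z)) (at z)" for z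
    using DERIV_diff[OF DERIV_const m_deriv, of tau z] by simp
  have al: "((\<lambda>z. 0) has_real_derivative 0) (at z)" for z :: real
    by simp
  have cm: "continuous_on UNIV (\<lambda>z. - (1 / mu z))" by (intro continuous_on_minus cont_inv_speed)
  note C = C1_2_oint[OF cont_Nh cf2 Nh_deriv x x' al be continuous_on_const cm]
  define Bz Bt where "Bz = (\<lambda>z t. Nh (tau - m z) z * x (tau - m z + (t + m z)) * - (1 / mu z) - Nh 0 z * x (0 + (t + m z)) * 0 + oint (\<lambda>q. K2 z * M (q + m z) z * x (q + (t + m z))) 0 (tau - m z)
     + oint (\<lambda>q. Nh q z * x' (q + (t + m z))) 0 (tau - m z) * (1 / mu z))"
    and "Bt = (\<lambda>z t. oint (\<lambda>q. Nh q z * x' (q + (t + m z))) 0 (tau - m z))"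
  have "C1_2 (RB x) Bz Bt"
    using C1_2_shear[OF C m_deriv cont_inv_speed(2)] unfolding Bz_def Bt_def RB_def[abs_def] .
  moreover have "Bz z t - Bt z t / mu z = K2 z * RA x z t - k2 z * x (tau + t)"
    if z: "-1 \<le> z" "z \<le> 1" for z t
  proof -
    have mz: "m z \<le> tau" using am_range[OF z] by simp
    have c1: "continuous_on UNIV (\<lambda>q. Mh q z * x (q + (t - a z)))"
      by (intro continuous_intros cont2_comp[OF cont_Mh] cont1_comp[OF cont_x])
    have "RA x z t = oint (\<lambda>r. Mh (r + m z + a z) z * x (r + (t + m z))) 0 (tau - m z)"
      using oint_shift[OF c1, of 0 "n z" "tau - m z"] by (simp add: RA_def n_def algebra_simps)
    also have "\<dots> = oint (\<lambda>r. M (r + m z) z * x (r + (t + m z))) 0 (tau - m z)"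
      using mz Mh_M[OF z, of "r + m z" for r] by (intro oint_cong) (simp add: min_def max_def)
    finally have RA: "RA x z t = oint (\<lambda>r. M (r + m z) z * x (r + (t + m z))) 0 (tau - m z)" .
    have "oint (\<lambda>q. K2 z * M (q + m z) z * x (q + (t + m z))) 0 (tau - m z) = K2 z * RA x z t"
      unfolding RA oint_cmult[symmetric] by (simp add: mult.assoc)
    then show ?thesis
      unfolding Bz_def Bt_def k2_def by (simp add: algebra_simps)
  qed
  ultimately show ?thesis by blast
qed

end

text \<open>Boundary values that make the corrected test pair admissible. At \<open>z = 1\<close>
  the range \<open>m z \<le> th \<le> tau\<close> is a single point; at \<open>z = -1\<close> the
  integral defining \<open>Nh\<close> is empty. \<open>RA\<close> stays free at
  \<open>z = -1\<close>, where its trace multiplies \<open>U1 = 0\<close>.\<close>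

lemma RA_one [simp]: "RA x 1 t = 0" and RB_one [simp]: "RB x 1 t = 0" and RB_m1 [simp]: "RB x (-1) t = 0"
proof -
  have "n 1 = tau + a 1" by (simp add: n_def tau_def)
  then show "RA x 1 t = 0" by (simp add: RA_def)
  show "RB x 1 t = 0" "RB x (-1) t = 0"
    by (simp_all add: RB_def tau_def Nh_def oint_def)
qed

lemma RAB_late:
  assumes "-1 \<le> z" "z \<le> 1" "\<And>s. t \<le> s \<Longrightarrow> x s = 0"
  shows "RA x z t = 0" "RB x z t = 0"
proof -
  have "RA x z t = oint (\<lambda>q. 0) (n z) (tau + a z)" unfolding RA_def
    using am_range[OF assms(1,2)] assms(3) by (intro oint_cong) (simp add: n_def min_def max_def split: if_splits)
  moreover have "RB x z t = oint (\<lambda>q. 0) 0 (tau - m z)" unfolding RB_def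
    using am_range[OF assms(1,2)] assms(3) by (intro oint_cong) (simp add: min_def max_def split: if_splits)
  ultimately show "RA x z t = 0" "RB x z t = 0" by (simp_all add: oint_def)
qed

text \<open>The response at time \<open>t\<close> reads the signal on
  \<open>{m z + t..tau + t}\<close> only. This look-ahead is how the travel time of \<open>v\<close>
  enters the extinction time.\<close>

lemma RAB_early:
  assumes "-1 \<le> z" "z \<le> 1" "\<And>s. s \<le> tau + t \<Longrightarrow> x s = 0"
  shows "RA x z t = 0" "RB x z t = 0"
proof -
  have "RA x z t = oint (\<lambda>q. 0) (n z) (tau + a z)" unfolding RA_def
    using am_range[OF assms(1,2)] assms(3) by (intro oint_cong) (simp add: n_def min_def max_def split: if_splits)
  moreover have "RB x z t = oint (\<lambda>q. 0) 0 (tau - m z)" unfolding RB_def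
    using am_range[OF assms(1,2)] assms(3) by (intro oint_cong) (simp add: min_def max_def split: if_splits)
  ultimately show "RA x z t = 0" "RB x z t = 0" by (simp_all add: oint_def)
qed

end

section \<open>The adjoint Cauchy problem in space\<close>

lemma oint_swap_order:
  assumes g: "cont2 g" and xy: "x \<le> y" and uv: "u \<le> v"
  shows "oint (\<lambda>r. oint (\<lambda>s. g r s) u v) x y = oint (\<lambda>s. oint (\<lambda>r. g r s) x y) u v"
proof -
  have "continuous_on (cbox (x, u) (y, v)) (\<lambda>(r, s). g r s)"
    using g unfolding cont2_def case_prod_unfold by (rule continuous_on_subset) simp
  from integral_swap_continuous[OF this] xy uv show ?thesis
    by (simp add: oint_le)
qed

lemma C1_2_lower:
  assumes h: "cont2 h" and hp: "cont2 hp" and dh: "\<And>s p. ((\<lambda>p. h s p) has_real_derivative hp s p) (at p)"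
  shows "C1_2 (\<lambda>z p. oint (\<lambda>s. h s p) z y) (\<lambda>z p. - h z p) (\<lambda>z p. oint (\<lambda>s. hp s p) z y)"
proof (rule C1_2I)
  have *: "cont2 (\<lambda>z p. oint (\<lambda>s. g s p) z y)" if g: "cont2 g" for g
    by (intro cont2_oint cont2_comp[OF g] continuous_intros) (simp_all add: cont2_def continuous_on_fst)
  show "cont2 (\<lambda>z p. oint (\<lambda>s. hp s p) z y)" "cont2 (\<lambda>z p. oint (\<lambda>s. h s p) z y)"
    by (rule *[OF hp], rule *[OF h])
  show "cont2 (\<lambda>z p. - h z p)" unfolding cont2_def by (intro continuous_intros cont2_comp[OF h])
  fix z t
  have "continuous_on UNIV (\<lambda>s. h s t)" by (intro cont2_comp[OF h] continuous_intros)
  then show "((\<lambda>z. oint (\<lambda>s. h s t) z y) has_real_derivative - h z t) (at z)"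
    by (rule oint_deriv_lower)
  show "((\<lambda>t. oint (\<lambda>s. h s t) z y) has_real_derivative oint (\<lambda>s. hp s t) z y) (at t)"
    using leibniz_variable[OF h hp dh DERIV_const DERIV_const, of z y t] by simp
qed

text \<open>Window integral of length \<open>e\<close>, without the factor \<open>1 / e\<close>. It
  turns a continuous function into a differentiable one and commutes with integral equations whose
  coefficients do not depend on time.\<close>

definition avg :: "real \<Rightarrow> (real \<Rightarrow> real) \<Rightarrow> real \<Rightarrow> real" where
  "avg e f t = oint f (t - e) t"

lemma avg_deriv:
  assumes f: "continuous_on UNIV f"
  shows "(avg e f has_real_derivative f t - f (t - e)) (at t)"
proof -
  have "((\<lambda>t. oint f 0 t - oint f 0 (t - e)) has_real_derivative f t - f (t - e) * 1) (at t)"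
    by (intro derivative_intros oint_deriv f DERIV_chain2[where f = "oint f 0"])
       (auto intro!: derivative_eq_intros)
  moreover have "avg e f = (\<lambda>t. oint f 0 t - oint f 0 (t - e))"
    using oint_combine[OF f, of 0 "t - e" t for t] by (auto simp: avg_def fun_eq_iff algebra_simps)
  ultimately show ?thesis by simp
qed

lemma cont_avg:
  assumes "continuous_on UNIV f" shows "continuous_on UNIV (avg e f)"
  using avg_deriv[OF assms] by (auto simp: continuous_on_eq_continuous_at dest: DERIV_isCont)

lemma cont2_avg:
  assumes f: "cont2 f" shows "cont2 (\<lambda>z t. avg e (f z) t)"
  unfolding avg_def
  by (intro cont2_oint cont2_comp[OF f] continuous_intros) (simp_all add: cont2_def continuous_on_snd continuous_on_diff)

lemma avg_zero:
  assumes "0 \<le> e" "\<And>s. t - e \<le> s \<Longrightarrow> s \<le> t \<Longrightarrow> f s = 0" shows "avg e f t = 0"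
proof -
  have "avg e f t = oint (\<lambda>_. 0) (t - e) t" unfolding avg_def
    using assms by (intro oint_cong) auto
  then show ?thesis by (simp add: oint_def)
qed

context hyp_system begin

text \<open>With zero data at \<open>z = 1\<close> both equations are of Volterra type in
  \<open>z\<close>: every integral runs over \<open>s \<ge> z\<close>. The weight
  \<open>exp (- L * z)\<close> ignores time, so the time shifts along the characteristics cost
  nothing.\<close>

lemma adjoint_fixed_point:
  assumes F0: "continuous_on UNIV F0" "\<And>s. \<bar>F0 s\<bar> \<le> FB" and G0: "continuous_on UNIV G0" "\<And>s. \<bar>G0 s\<bar> \<le> FB"
    and rho: "continuous_on UNIV rho" "\<And>t. \<bar>rho t\<bar> \<le> RB"
  shows "\<exists>f1 f2 C. cont2 f1 \<and> cont2 f2 \<and> (\<forall>z t. \<bar>f1 z t\<bar> \<le> C \<and> \<bar>f2 z t\<bar> \<le> C) \<and>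
     (\<forall>z t. -1 \<le> z \<longrightarrow> z \<le> 1 \<longrightarrow>
        f1 z t = oint (\<lambda>s. K1 s * f2 s (t + a s - a z) + F0 s * rho (t + a s - a z)) z 1 \<and>
        f2 z t = - oint (\<lambda>s. K2 s * f1 s (t + m z - m s) + G0 s * rho (t + m z - m s)) z 1)"
proof -
  \<comment> \<open>Rate giving the contraction factor 1/4 for each of the two components.\<close>
  define L where "L = 4 * KB"
  have Lp: "0 < L" using KB by (simp add: L_def)
  define om :: "2 \<Rightarrow> real \<Rightarrow> real \<Rightarrow> real" where "om i z t = exp (- L * clamp1 z)" for i z t
  \<comment> \<open>Both equations are handled as one family: \<open>oth\<close> selects the other
    unknown, \<open>sh\<close> is the time shift along the characteristic and \<open>sg\<close> the
    sign.\<close>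
  define Kk :: "2 \<Rightarrow> real \<Rightarrow> real" where "Kk i = (if i = 1 then K1 else K2)" for i
  define H0 :: "2 \<Rightarrow> real \<Rightarrow> real" where "H0 i = (if i = 1 then F0 else G0)" for i
  define oth :: "2 \<Rightarrow> 2" where "oth i = (if i = 1 then 2 else 1)" for i
  define sh :: "2 \<Rightarrow> real \<Rightarrow> real \<Rightarrow> real" where "sh i z s = (if i = 1 then a s - a z else m z - m s)" for i z s
  define sg :: "2 \<Rightarrow> real" where "sg i = (if i = 1 then 1 else -1)" for i
  define h where "h f i z t s = Kk i s * f (oth i) s (t + sh i (clamp1 z) s) + H0 i s * rho (t + sh i (clamp1 z) s)"
    for f :: "2 \<Rightarrow> real \<Rightarrow> real \<Rightarrow> real" and i z t s
  define G where "G f i z t = sg i * oint (h f i z t) (clamp1 z) 1" for f i z t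
  have cKk: "continuous_on UNIV (Kk i)" for i by (simp add: Kk_def cont_K0)
  have cH0: "continuous_on UNIV (H0 i)" for i by (simp add: H0_def F0 G0)
  have csh: "cont2 (sh i)" for i
  proof (cases "i = 1")
    case True then show ?thesis unfolding cont2_def sh_def by (simp, intro continuous_intros cont_of)
  next
    case False then show ?thesis unfolding cont2_def sh_def by (simp, intro continuous_intros cont_of)
  qed
  have KkB: "\<bar>Kk i s\<bar> \<le> KB" for i s by (simp add: Kk_def KB)
  have H0B: "\<bar>H0 i s\<bar> \<le> FB" for i s by (simp add: H0_def F0 G0)
  have sgB: "\<bar>sg i\<bar> = 1" for i by (simp add: sg_def)
  have ch: "continuous_on UNIV (\<lambda>x. h f i (fst (fst x)) (snd (fst x)) (snd x))" if f: "\<And>i. cont2 (f i)" for f i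
    unfolding h_def
    by (intro continuous_intros cont1_comp[OF cKk] cont1_comp[OF cH0] cont2_comp[OF f] cont1_comp[OF rho(1)] cont2_comp[OF csh] cont_of)
  have ch1: "continuous_on S (h f i z t)" if f: "\<And>i. cont2 (f i)" for f i z t S
    unfolding h_def[abs_def]
    by (intro continuous_intros cont1_comp[OF cKk] cont1_comp[OF cH0] cont2_comp[OF f] cont1_comp[OF rho(1)] cont2_comp[OF csh] cont_of)
  have cG: "cont2 (G f i)" if f: "\<And>i. cont2 (f i)" for f i
  proof -
    have "cont2 (\<lambda>z t. oint (h f i z t) (clamp1 z) 1)"
      by (rule cont2_oint[OF ch[OF f]]) (auto simp: cont2_def intro!: continuous_intros cont_of)
    then show ?thesis unfolding G_def[abs_def] cont2_def by (intro continuous_intros)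
  qed
  have om_b: "exp (- L) \<le> om i z t" "om i z t \<le> exp L" for i z t
    using clamp1_bounds[of z] Lp mult_left_mono[of "clamp1 z" 1 L] mult_left_mono[of "-1" "clamp1 z" L]
    unfolding om_def exp_le_cancel_iff by linarith+
  have FRB: "0 \<le> FB" "0 \<le> RB" using F0(2)[of 0] rho(2)[of 0] by auto
  have bd0: "\<bar>G (\<lambda>_ _ _. 0) i z t\<bar> \<le> (FB * RB * 2) * exp L * om i z t" for i z t
  proof -
    have "norm (integral {clamp1 z..1} (h (\<lambda>_ _ _. 0) i z t)) \<le> FB * RB * (1 - clamp1 z)"
    proof (rule integral_bound)
      show "continuous_on {clamp1 z..1} (h (\<lambda>_ _ _. 0) i z t)"
        by (intro ch1) (simp add: cont2_def)
      fix s show "norm (h (\<lambda>_ _ _. 0) i z t s) \<le> FB * RB"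
        unfolding h_def using H0B rho(2) FRB by (simp add: abs_mult mult_mono)
    qed simp
    also have "\<dots> \<le> FB * RB * 2"
      using FRB clamp1_bounds[of z] mult_left_mono[of "1 - clamp1 z" 2 "FB * RB"] by simp
    finally have "\<bar>G (\<lambda>_ _ _. 0) i z t\<bar> \<le> FB * RB * 2"
      by (simp add: G_def oint_le abs_mult sgB)
    also have "\<dots> \<le> (FB * RB * 2) * (exp L * om i z t)"
    proof -
      have "exp L * exp (-L) \<le> exp L * om i z t" using om_b by (intro mult_left_mono) auto
      then have "1 \<le> exp L * om i z t" by (simp add: exp_minus)
      then show ?thesis using FRB mult_left_mono[of 1 "exp L * om i z t" "FB * RB * 2"] by simp
    qed
    finally show ?thesis by (simp add: mult.assoc)
  qed
  have contr: "\<bar>G f i z t - G g i z t\<bar> \<le> 1/4 * D * om i z t"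
    if f: "\<And>i. cont2 (f i)" and g: "\<And>i. cont2 (g i)" and D: "0 \<le> D"
      and d: "\<And>i z t. \<bar>f i z t - g i z t\<bar> \<le> D * om i z t" for f g D i z t
  proof -
    define E where "E = KB * D * om i z t"
    have E: "0 \<le> E" "E / L = 1/4 * D * om i z t" using KB(1) D by (auto simp: E_def om_def L_def)
    have "\<bar>integral {clamp1 z..1} (\<lambda>s. h f i z t s - h g i z t s)\<bar> \<le> E / L"
    proof (rule exp_abs_integral_bound[where z = "clamp1 z"])
      fix s assume s: "s \<in> {clamp1 z..1}"
      then have s1: "-1 \<le> s" "s \<le> 1" using clamp1_bounds(1)[of z] unfolding atLeastAtMost_iff by linarith+
      have "\<bar>h f i z t s - h g i z t s\<bar> = \<bar>Kk i s\<bar> * \<bar>f (oth i) s (t + sh i (clamp1 z) s) - g (oth i) s (t + sh i (clamp1 z) s)\<bar>"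
        unfolding h_def by (simp add: abs_mult flip: right_diff_distrib)
      also have "\<dots> \<le> KB * (D * om (oth i) s (t + sh i (clamp1 z) s))"
        using KkB d KB(1) by (intro mult_mono) auto
      also have "\<dots> = E * exp (- L * \<bar>s - clamp1 z\<bar>)"
        using s s1 by (simp add: E_def om_def right_diff_distrib exp_diff exp_minus field_simps exp_add)
      finally show "\<bar>h f i z t s - h g i z t s\<bar> \<le> E * exp (- L * \<bar>s - clamp1 z\<bar>)" .
    qed (use E Lp clamp1_bounds in \<open>auto intro!: continuous_on_diff ch1 f g\<close>)
    then show ?thesis unfolding E(2)
      by (simp add: G_def oint_le Henstock_Kurzweil_Integration.integral_diff integrable_continuous_interval ch1 f g abs_mult sgB
          flip: right_diff_distrib)
  qed
  have "\<exists>f C. (\<forall>i. cont2 (f i)) \<and> (\<forall>i x y. \<bar>f i x y\<bar> \<le> C * om i x y) \<and> (\<forall>i x y. f i x y = G f i x y)"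
  proof (rule weighted_fixed_point[where q = "1/4" and Cz = "(FB * RB * 2) * exp L"])
    show "cont2 (om i)" for i unfolding om_def cont2_def by (intro continuous_intros cont_of)
    show "om i x y > 0" for i x y by (simp add: om_def)
  qed (use cG bd0 contr in auto)
  then obtain f C where fc: "\<And>i. cont2 (f i)" and fb: "\<And>i z t. \<bar>f i z t\<bar> \<le> C * om i z t"
    and fe: "\<And>i z t. f i z t = G f i z t" by blast
  have "0 \<le> C * om 1 0 0" using fb[of 1 0 0] by (smt (verit))
  then have C: "0 \<le> C" by (simp add: om_def zero_le_mult_iff)
  have fb': "\<bar>f i z t\<bar> \<le> C * exp L" for i z t
    using fb[of i z t] om_b(2)[of i z t] C mult_left_mono[of "om i z t" "exp L" C] by linarith
  show ?thesis
  proof (rule exI[of _ "f 1"], rule exI[of _ "f 2"], rule exI[of _ "C * exp L"], intro conjI allI impI)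
    show "cont2 (f 1)" "cont2 (f 2)" by (rule fc)+
    show "\<bar>f 1 z t\<bar> \<le> C * exp L" "\<bar>f 2 z t\<bar> \<le> C * exp L" for z t by (rule fb')+
    fix z t :: real assume z: "-1 \<le> z" "z \<le> 1"
    show "f 1 z t = oint (\<lambda>s. K1 s * f 2 s (t + a s - a z) + F0 s * rho (t + a s - a z)) z 1"
      using fe[of 1 z t] z by (simp add: G_def h_def[abs_def] sg_def Kk_def oth_def sh_def H0_def add_diff_eq)
    show "f 2 z t = - oint (\<lambda>s. K2 s * f 1 s (t + m z - m s) + G0 s * rho (t + m z - m s)) z 1"
      using fe[of 2 z t] z by (simp add: G_def h_def[abs_def] sg_def Kk_def oth_def sh_def H0_def add_diff_eq)
  qed
qed

end

context hyp_system begin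

text \<open>Domain of dependence. Moving to larger \<open>s\<close> along either characteristic, the
  label \<open>t - a z\<close> never increases and \<open>t + m z\<close> never decreases, so the
  region outside the influence of \<open>rho\<close> is never left, and \<open>rho\<close> vanishes
  on all segments met.\<close>

lemma adjoint_support:
  assumes f: "cont2 f1" "cont2 f2" and bd: "\<And>z t. \<bar>f1 z t\<bar> \<le> C \<and> \<bar>f2 z t\<bar> \<le> C"
    and f1: "\<And>z t. -1 \<le> z \<Longrightarrow> z \<le> 1 \<Longrightarrow>
        f1 z t = oint (\<lambda>s. K1 s * f2 s (t + a s - a z) + F0 s * rho (t + a s - a z)) z 1"
    and f2: "\<And>z t. -1 \<le> z \<Longrightarrow> z \<le> 1 \<Longrightarrow>
        f2 z t = - oint (\<lambda>s. K2 s * f1 s (t + m z - m s) + G0 s * rho (t + m z - m s)) z 1"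
    and rho: "\<And>t. t < T1 \<or> T2 < t \<Longrightarrow> rho t = 0"
    and z: "-1 \<le> z" "z \<le> 1" and t: "t - a z < T1 - sigma \<or> t + m z > T2 + tau"
  shows "f1 z t = 0" "f2 z t = 0"
proof -
  define Z where "Z = {(z, t). -1 \<le> z \<and> z \<le> 1 \<and> (t - a z < T1 - sigma \<or> t + m z > T2 + tau)}"
  \<comment> \<open>Rate for which one pass through the equations halves the bound.\<close>
  define L where "L = 2 * KB"
  have Lp: "0 < L" using KB by (simp add: L_def)
  define g :: "2 \<Rightarrow> real \<Rightarrow> real \<Rightarrow> real" where "g i = (if i = 1 then f1 else f2)" for i
  define om :: "2 \<Rightarrow> real \<Rightarrow> real \<Rightarrow> real" where "om i z t = exp (- L * z)" for i z t
  have C: "0 \<le> C" using bd[of 0 0] by linarith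
  have fin: "\<bar>oint (\<lambda>s. k s * y s + r s) z 1\<bar> \<le> D / 2 * exp (- L * z)"
    if D: "0 \<le> D" and z: "-1 \<le> z" "z \<le> 1" and k: "\<And>s. \<bar>k s\<bar> \<le> KB" "continuous_on UNIV k"
      and r: "\<And>s. z \<le> s \<Longrightarrow> s \<le> 1 \<Longrightarrow> r s = 0"
      and y: "\<And>s. z \<le> s \<Longrightarrow> s \<le> 1 \<Longrightarrow> \<bar>y s\<bar> \<le> D * exp (- L * s)" "continuous_on UNIV y"
    for k y r D z
  proof -
    have "oint (\<lambda>s. k s * y s + r s) z 1 = integral {z..1} (\<lambda>s. k s * y s)"
      using z r by (subst oint_cong[where g = "\<lambda>s. k s * y s"]) (auto simp: oint_le)
    moreover have "\<bar>integral {z..1} (\<lambda>s. k s * y s)\<bar> \<le> (KB * D * exp (- L * z)) / L"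
    proof (rule exp_abs_integral_bound[where z = z])
      fix s assume s: "s \<in> {z..1}"
      have "\<bar>k s * y s\<bar> \<le> KB * (D * exp (- L * s))"
        unfolding abs_mult using k y(1) s KB(1) by (intro mult_mono) auto
      also have "\<dots> = KB * D * exp (- L * z) * exp (- L * \<bar>s - z\<bar>)"
        using s by (simp add: algebra_simps flip: exp_add)
      finally show "\<bar>k s * y s\<bar> \<le> KB * D * exp (- L * z) * exp (- L * \<bar>s - z\<bar>)" .
    qed (use z Lp D KB(1) k y in \<open>auto intro!: continuous_on_mult intro: continuous_on_subset\<close>)
    moreover have "(KB * D * exp (- L * z)) / L = D / 2 * exp (- L * z)"
      using KB(1) by (simp add: L_def)
    ultimately show ?thesis by (simp only:)
  qed
  have gz: "g i z t = 0" for i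
  proof (rule weighted_vanish[where f = g and x = z and y = t and Z = Z and om = om and C = "C * exp L"])
    show "(z, t) \<in> Z" using z t by (simp add: Z_def)
    show "0 \<le> C * exp L" using C by simp
    show "\<bar>g i x y\<bar> \<le> C * exp L * om i x y" if "(x, y) \<in> Z" for i x y
    proof -
      have "L * x \<le> L * 1" using that Lp by (intro mult_left_mono) (auto simp: Z_def)
      then have "1 \<le> exp L * om i x y" by (simp add: om_def flip: exp_add)
      then have "C * 1 \<le> C * (exp L * om i x y)" using C by (intro mult_left_mono)
      then show ?thesis using bd[of x y] by (auto simp: g_def mult.assoc)
    qed
    show "\<bar>g i x y\<bar> \<le> D / 2 * om i x y"
      if D: "0 \<le> D" and h: "\<And>i x y. (x, y) \<in> Z \<Longrightarrow> \<bar>g i x y\<bar> \<le> D * om i x y" and xy: "(x, y) \<in> Z" for D i x y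
    proof -
      have x: "-1 \<le> x" "x \<le> 1" using xy by (auto simp: Z_def)
      have m1: "\<bar>f1 s r\<bar> \<le> D * exp (- L * s)" "\<bar>f2 s r\<bar> \<le> D * exp (- L * s)" if "(s, r) \<in> Z" for s r
        using h[OF that, of 1] h[OF that, of 2] by (auto simp: g_def om_def)
      have mono: "a x \<le> a s" "m x \<le> m s" "0 \<le> a s" "a s \<le> sigma" "0 \<le> m s" "m s \<le> tau"
        if "x \<le> s" "s \<le> 1" for s
        using am_range[of s] a_homeo(4)[of x s] m_homeo(4)[of x s] that x by auto
      have e1: "\<bar>f1 x y\<bar> \<le> D / 2 * exp (- L * x)"
        unfolding f1[OF x]
      proof (rule fin[OF D x KB(2) cont_K0(1)])
        fix s assume s: "x \<le> s" "s \<le> 1"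
        have "(s, y + a s - a x) \<in> Z" using xy mono[OF s] s x by (auto simp: Z_def)
        then show "\<bar>f2 s (y + a s - a x)\<bar> \<le> D * exp (- L * s)" by (rule m1)
        have "y + a s - a x < T1 \<or> T2 < y + a s - a x" using xy mono[OF s] by (auto simp: Z_def)
        then show "F0 s * rho (y + a s - a x) = 0" using rho by auto
      qed (intro cont2_comp[OF f(2)] continuous_intros cont_of)
      have "\<bar>oint (\<lambda>s. K2 s * f1 s (y + m x - m s) + G0 s * rho (y + m x - m s)) x 1\<bar> \<le> D / 2 * exp (- L * x)"
      proof (rule fin[OF D x KB(3) cont_K0(2)])
        fix s assume s: "x \<le> s" "s \<le> 1"
        have "(s, y + m x - m s) \<in> Z" using xy mono[OF s] s x by (auto simp: Z_def)
        then show "\<bar>f1 s (y + m x - m s)\<bar> \<le> D * exp (- L * s)" by (rule m1)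
        have "y + m x - m s < T1 \<or> T2 < y + m x - m s" using xy mono[OF s] by (auto simp: Z_def)
        then show "G0 s * rho (y + m x - m s) = 0" using rho by auto
      qed (intro cont2_comp[OF f(1)] continuous_intros cont_of)
      then have "\<bar>f2 x y\<bar> \<le> D / 2 * exp (- L * x)" unfolding f2[OF x] by simp
      with e1 show ?thesis by (auto simp: g_def om_def)
    qed
  qed
  from gz[of 1] gz[of 2] show "f1 z t = 0" "f2 z t = 0" by (simp_all add: g_def)
qed

text \<open>Averaging over a time window makes the continuous solution of the integral equations continuously differentiable.\<close>

lemma adjoint_solution:
  assumes F0: "continuous_on UNIV F0" "\<And>s. \<bar>F0 s\<bar> \<le> FB" and G0: "continuous_on UNIV G0" "\<And>s. \<bar>G0 s\<bar> \<le> FB"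
    and rho: "continuous_on UNIV rho" "\<And>t. \<bar>rho t\<bar> \<le> RB" and supp: "\<forall>t. t < T1 \<or> T2 < t \<longrightarrow> rho t = 0"
    and e: "0 \<le> e"
  shows "\<exists>P Pz Pt Q Qz Qt. C1_2 P Pz Pt \<and> C1_2 Q Qz Qt \<and> (\<forall>t. P 1 t = 0 \<and> Q 1 t = 0) \<and>
     (\<forall>z t. -1 \<le> z \<longrightarrow> z \<le> 1 \<longrightarrow>
        Pz z t + Pt z t / lam z = - (K1 z * Q z t + F0 z * avg e rho t) \<and>
        Qz z t - Qt z t / mu z = K2 z * P z t + G0 z * avg e rho t \<and>
        (t < T1 - sigma \<or> t > T2 + tau + e \<longrightarrow> P z t = 0 \<and> Q z t = 0))"
proof -
  have supp0: "rho t = 0" if "t < T1 \<or> T2 < t" for t using supp that by blast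
  obtain f1 f2 C where f: "cont2 f1" "cont2 f2" and bd: "\<And>z t. \<bar>f1 z t\<bar> \<le> C \<and> \<bar>f2 z t\<bar> \<le> C"
    and f1: "\<And>z t. -1 \<le> z \<Longrightarrow> z \<le> 1 \<Longrightarrow>
        f1 z t = oint (\<lambda>s. K1 s * f2 s (t + a s - a z) + F0 s * rho (t + a s - a z)) z 1"
    and f2: "\<And>z t. -1 \<le> z \<Longrightarrow> z \<le> 1 \<Longrightarrow>
        f2 z t = - oint (\<lambda>s. K2 s * f1 s (t + m z - m s) + G0 s * rho (t + m z - m s)) z 1"
    using adjoint_fixed_point[OF F0 G0 rho] by blast
  have supp': "f1 z t = 0" "f2 z t = 0"
    if "-1 \<le> z" "z \<le> 1" "t - a z < T1 - sigma \<or> t + m z > T2 + tau" for z t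
    by (rule adjoint_support[where ?f1.0 = f1 and ?f2.0 = f2 and ?F0.0 = F0 and ?G0.0 = G0 and rho = rho
          and ?T1.0 = T1 and ?T2.0 = T2 and C = C], fact+)+
  define A1 where "A1 z t = avg e (f1 z) t" for z t
  define A2 where "A2 z t = avg e (f2 z) t" for z t
  define r where "r = avg e rho"
  have cA: "cont2 A1" "cont2 A2" unfolding A1_def[abs_def] A2_def[abs_def] by (intro cont2_avg f)+
  have cr: "continuous_on UNIV r" unfolding r_def by (rule cont_avg[OF rho(1)])
  define r' where "r' t = rho t - rho (t - e)" for t
  have cr': "continuous_on UNIV r'" unfolding r'_def[abs_def]
    by (intro continuous_intros cont1_comp[OF rho(1)])
  have dr: "(r has_real_derivative r' t) (at t)" for t
    unfolding r_def r'_def by (rule avg_deriv[OF rho(1)])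
  have dA: "(A1 z has_real_derivative f1 z t - f1 z (t - e)) (at t)"
    "(A2 z has_real_derivative f2 z t - f2 z (t - e)) (at t)" for z t
  proof -
    have "continuous_on UNIV (f1 z)" "continuous_on UNIV (f2 z)"
      by (intro cont2_comp[OF f(1), of _ "\<lambda>_. z"] cont2_comp[OF f(2), of _ "\<lambda>_. z"] continuous_intros)+
    then show "(A1 z has_real_derivative f1 z t - f1 z (t - e)) (at t)"
      "(A2 z has_real_derivative f2 z t - f2 z (t - e)) (at t)"
      unfolding A1_def[abs_def] A2_def[abs_def] by (auto intro: avg_deriv)
  qed
  \<comment> \<open>At fixed label \<open>p\<close> the time derivative falls on the averaged
    functions, whose derivatives are differences of continuous functions.\<close>
  have hat: "C1_2 (\<lambda>z p. oint (\<lambda>s. k s * A s (p + d s) + H s * r (p + d s)) z 1)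
      (\<lambda>z p. - (k z * A z (p + d z) + H z * r (p + d z)))
      (\<lambda>z p. oint (\<lambda>s. k s * (ff s (p + d s) - ff s (p + d s - e)) + H s * r' (p + d s)) z 1)"
    if k: "continuous_on UNIV k" and A: "cont2 A" and dA: "\<And>z t. (A z has_real_derivative ff z t - ff z (t - e)) (at t)"
      and ff: "cont2 ff" and H: "continuous_on UNIV H" and d: "continuous_on UNIV d" for k A ff H d
  proof (rule C1_2_lower)
    show "cont2 (\<lambda>s p. k s * A s (p + d s) + H s * r (p + d s))"
      "cont2 (\<lambda>s p. k s * (ff s (p + d s) - ff s (p + d s - e)) + H s * r' (p + d s))"
      unfolding cont2_def
      by (intro continuous_intros cont1_comp[OF k] cont2_comp[OF A] cont2_comp[OF ff] cont1_comp[OF H] cont1_comp[OF d] cont1_comp[OF cr] cont1_comp[OF cr'])+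
    fix s p
    have "((\<lambda>p. A s (p + d s)) has_real_derivative (ff s (p + d s) - ff s (p + d s - e)) * 1) (at p)"
      by (rule DERIV_chain2[OF dA]) (auto intro!: derivative_eq_intros)
    moreover have "((\<lambda>p. r (p + d s)) has_real_derivative r' (p + d s) * 1) (at p)"
      by (rule DERIV_chain2[OF dr]) (auto intro!: derivative_eq_intros)
    ultimately show "((\<lambda>p. k s * A s (p + d s) + H s * r (p + d s)) has_real_derivative
        k s * (ff s (p + d s) - ff s (p + d s - e)) + H s * r' (p + d s)) (at p)"
      by (intro DERIV_add DERIV_cmult) simp_all
  qed
  \<comment> \<open>Averaging in time commutes with the integration in \<open>s\<close>, so the
    averaged functions solve the same equations with \<open>rho\<close> replaced by its
    average.\<close>
  have swap: "avg e (\<lambda>t. oint (\<lambda>s. k s * ff s (t + d s - y) + H s * rho (t + d s - y)) z 1) t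
      = oint (\<lambda>s. k s * avg e (ff s) (t - y + d s) + H s * r (t - y + d s)) z 1"
    if k: "continuous_on UNIV k" and ff: "cont2 ff" and H: "continuous_on UNIV H" and d: "continuous_on UNIV d"
      and z: "z \<le> 1" for k ff H d y z t
  proof -
    have c: "cont2 (\<lambda>t s. k s * ff s (t + d s - y) + H s * rho (t + d s - y))"
      unfolding cont2_def
      by (intro continuous_intros cont1_comp[OF k] cont2_comp[OF ff] cont1_comp[OF H] cont1_comp[OF d] cont1_comp[OF rho(1)])
    have "avg e (\<lambda>t. oint (\<lambda>s. k s * ff s (t + d s - y) + H s * rho (t + d s - y)) z 1) t
      = oint (\<lambda>s. oint (\<lambda>t. k s * ff s (t + d s - y) + H s * rho (t + d s - y)) (t - e) t) z 1"
      unfolding avg_def using e z by (intro oint_swap_order[OF c]) auto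
    also have "\<dots> = oint (\<lambda>s. k s * avg e (ff s) (t - y + d s) + H s * r (t - y + d s)) z 1"
    proof (rule oint_cong)
      fix s
      define q where "q = d s - y"
      have cf: "continuous_on UNIV (ff s)"
        using cont2_comp[OF ff continuous_on_const continuous_on_id, of UNIV s] by simp
      have cf': "continuous_on S (\<lambda>t. ff s (t + q))" "continuous_on S (\<lambda>t. rho (t + q))" for S
        by (intro cont1_comp[OF cf] cont1_comp[OF rho(1)] continuous_intros)+
      have "oint (\<lambda>t. k s * ff s (t + q) + H s * rho (t + q)) (t - e) t
        = k s * oint (\<lambda>t. ff s (t + q)) (t - e) t + H s * oint (\<lambda>t. rho (t + q)) (t - e) t"
        using e by (simp add: oint_le Henstock_Kurzweil_Integration.integral_add integrable_continuous_interval cf' continuous_on_mult)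
      also have "\<dots> = k s * avg e (ff s) (t + q) + H s * r (t + q)"
        using oint_shift[OF cf, of "t - e" q t] oint_shift[OF rho(1), of "t - e" q t]
        by (simp add: avg_def r_def algebra_simps)
      finally show "oint (\<lambda>t. k s * ff s (t + d s - y) + H s * rho (t + d s - y)) (t - e) t
          = k s * avg e (ff s) (t - y + d s) + H s * r (t - y + d s)"
        by (simp add: q_def algebra_simps)
    qed
    finally show ?thesis .
  qed
  have cm: "continuous_on UNIV (\<lambda>z. - m z)" by (intro continuous_intros cont_of)
  note hP = hat[OF cont_K0(1) cA(2) dA(2) f(2) F0(1) cont_a0]
  note hQ = hat[OF cont_K0(2) cA(1) dA(1) f(1) G0(1) cm]
  define P where "P z t = oint (\<lambda>s. K1 s * A2 s (t + - a z + a s) + F0 s * r (t + - a z + a s)) z 1" for z t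
  define R where "R z t = oint (\<lambda>s. K2 s * A1 s (t + m z + - m s) + G0 s * r (t + m z + - m s)) z 1" for z t
  have da: "((\<lambda>z. - a z) has_real_derivative - (1 / lam z)) (at z)" for z
    by (intro DERIV_minus a_deriv)
  have cl: "continuous_on UNIV (\<lambda>z. - (1 / lam z))" by (intro continuous_on_minus cont_inv_speed)
  obtain Pz Pt where P: "C1_2 P Pz Pt"
    and Peq: "\<And>z t. Pz z t + Pt z t / lam z = - (K1 z * A2 z t + F0 z * r t)"
    using C1_2_shear[OF hP da cl] unfolding P_def[abs_def] by (fastforce simp: algebra_simps)
  obtain Rz Rt where R: "C1_2 R Rz Rt"
    and Req: "\<And>z t. Rz z t - Rt z t / mu z = - (K2 z * A1 z t + G0 z * r t)"
    using C1_2_shear[OF hQ m_deriv cont_inv_speed(2)] unfolding R_def[abs_def] by (fastforce simp: algebra_simps)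
  \<comment> \<open>On \<open>{-1..1}\<close> the averages \<open>A1\<close> and \<open>A2\<close>
    coincide with \<open>P\<close> and \<open>- R\<close>. The latter are used from here on because
    their formulas are differentiable at every real \<open>z\<close>, whereas the averages are tied
    to the equations only on this interval.\<close>
  have PA: "A1 z t = P z t" if z: "-1 \<le> z" "z \<le> 1" for z t
  proof -
    have "A1 z t = avg e (\<lambda>t. oint (\<lambda>s. K1 s * f2 s (t + a s - a z) + F0 s * rho (t + a s - a z)) z 1) t"
      unfolding A1_def using f1[OF z] by presburger
    also have "\<dots> = P z t" unfolding P_def
      by (subst swap[OF cont_K0(1) f(2) F0(1) cont_a0 z(2)]) (simp add: A2_def)
    finally show ?thesis .
  qed
  have RA: "A2 z t = - R z t" if z: "-1 \<le> z" "z \<le> 1" for z t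
  proof -
    have "f2 z = (\<lambda>t. - oint (\<lambda>s. K2 s * f1 s (t + - m s - - m z) + G0 s * rho (t + - m s - - m z)) z 1)"
      using f2[OF z] by (simp add: fun_eq_iff algebra_simps)
    then have "A2 z t = - avg e (\<lambda>t. oint (\<lambda>s. K2 s * f1 s (t + - m s - - m z) + G0 s * rho (t + - m s - - m z)) z 1) t"
      unfolding A2_def by (simp add: avg_def oint_def)
    also have "\<dots> = - R z t" unfolding R_def
      by (subst swap[OF cont_K0(2) f(1) G0(1) cm z(2)]) (simp add: A1_def)
    finally show ?thesis .
  qed
  have Q: "C1_2 (\<lambda>z t. - R z t) (\<lambda>z t. - Rz z t) (\<lambda>z t. - Rt z t)"
    using C1_2D[OF R] by (intro C1_2I DERIV_minus) (auto simp: cont2_def intro!: continuous_on_minus)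
  have zero: "P z t = 0" "R z t = 0" if z: "-1 \<le> z" "z \<le> 1" and t: "t < T1 - sigma \<or> t > T2 + tau + e" for z t
  proof -
    \<comment> \<open>The window reaches back by \<open>e\<close>, hence the extra \<open>e\<close>
      in the upper time limit.\<close>
    have *: "f1 z s = 0 \<and> f2 z s = 0" if "t - e \<le> s" "s \<le> t" for s
      using supp'[OF z, of s] t that am_range[OF z] by auto
    have "A1 z t = 0" "A2 z t = 0"
      unfolding A1_def A2_def using * by (auto intro!: avg_zero e)
    then show "P z t = 0" "R z t = 0" using PA[OF z] RA[OF z] by auto
  qed
  have one: "P 1 t = 0" "R 1 t = 0" for t by (simp_all add: P_def R_def)
  show ?thesis
  proof (intro exI conjI allI impI)
    show "C1_2 P Pz Pt" "C1_2 (\<lambda>z t. - R z t) (\<lambda>z t. - Rz z t) (\<lambda>z t. - Rt z t)" by fact+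
    show "P 1 t = 0" "- R 1 t = 0" for t by (simp_all add: one)
    fix z t :: real assume z: "-1 \<le> z" "z \<le> 1"
    show "Pz z t + Pt z t / lam z = - (K1 z * - R z t + F0 z * avg e rho t)"
      unfolding Peq using RA[OF z] by (simp add: r_def)
    show "- Rz z t - - Rt z t / mu z = K2 z * P z t + G0 z * avg e rho t"
      using Req[of z t] PA[OF z, of t] by (simp add: r_def)
    show "P z t = 0" "- R z t = 0" if "t < T1 - sigma \<or> t > T2 + tau + e" using zero[OF z that] by auto
  qed
qed

end

section \<open>Square-integrable paths\<close>

abbreviation (input) Iv :: "real set" where "Iv \<equiv> {-1..1}"
abbreviation (input) Strip :: "(real \<times> real) set" where "Strip \<equiv> {-1..1} \<times> {0..}"

definition L2_path :: "(real \<Rightarrow> real \<Rightarrow> real) \<Rightarrow> bool" where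
  "L2_path u \<longleftrightarrow> (\<lambda>p::real\<times>real. u (fst p) (snd p)) \<in> borel_measurable lborel \<and>
     (\<forall>t\<ge>0. L2_on (\<lambda>w. u w t)) \<and>
     (\<forall>t0\<ge>0. ((\<lambda>t. LINT w:Iv|lborel. (u w t - u w t0)^2) \<longlongrightarrow> 0) (at t0 within {0..}))"

section \<open>Integrability on time slices and on the space-time strip\<close>

lemma set_integrable_bound_mult:
  fixes f g :: "'a \<Rightarrow> real"
  assumes f: "set_integrable Q A f" and g: "g \<in> borel_measurable Q"
    and b: "\<And>x. x \<in> A \<Longrightarrow> \<bar>g x\<bar> \<le> B"
  shows "set_integrable Q A (\<lambda>x. f x * g x)"
proof -
  have i: "integrable Q (\<lambda>x. \<bar>B\<bar> * (indicator A x *\<^sub>R f x))"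
    using f unfolding set_integrable_def by (rule integrable_mult_right)
  have m: "(\<lambda>x. (indicator A x *\<^sub>R f x) * g x) \<in> borel_measurable Q"
    using f g unfolding set_integrable_def by (intro borel_measurable_times) auto
  have "integrable Q (\<lambda>x. (indicator A x *\<^sub>R f x) * g x)"
  proof (rule Bochner_Integration.integrable_bound[OF i m], rule AE_I2)
    fix x
    show "norm (indicator A x *\<^sub>R f x * g x) \<le> norm (\<bar>B\<bar> * (indicator A x *\<^sub>R f x))"
    proof (cases "x \<in> A")
      case True
      have "\<bar>g x\<bar> * \<bar>f x\<bar> \<le> \<bar>B\<bar> * \<bar>f x\<bar>" using b[OF True] by (intro mult_right_mono) auto
      then show ?thesis using True by (simp add: abs_mult mult.commute)
    qed simp
  qed
  then show ?thesis unfolding set_integrable_def by (simp add: mult.assoc)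
qed

lemma L2_on_diff:
  assumes f: "L2_on f" and g: "L2_on g" shows "L2_on (\<lambda>w. f w - g w)"
  unfolding L2_on_def
proof
  show m: "(\<lambda>w. f w - g w) \<in> borel_measurable lborel" using f g by (auto simp: L2_on_def intro: borel_measurable_diff)
  have i: "integrable lborel (\<lambda>w. 2 * (indicator Iv w *\<^sub>R (f w)^2) + 2 * (indicator Iv w *\<^sub>R (g w)^2))"
    using f g unfolding L2_on_def set_integrable_def
    by (intro Bochner_Integration.integrable_add integrable_mult_right) auto
  show "set_integrable lborel Iv (\<lambda>w. (f w - g w)^2)" unfolding set_integrable_def
  proof (rule Bochner_Integration.integrable_bound[OF i])
    show "(\<lambda>x. indicator Iv x *\<^sub>R (f x - g x)\<^sup>2) \<in> borel_measurable lborel"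
      using m by (intro borel_measurable_scaleR borel_measurable_power) auto
    have "(x - y)^2 \<le> 2 * x^2 + 2 * y^2" for x y :: real
      using sum_squares_ge_zero[of "x + y" 0] by (simp add: power2_eq_square algebra_simps)
    then show "AE x in lborel. norm (indicator Iv x *\<^sub>R (f x - g x)\<^sup>2) \<le> norm (2 * (indicator Iv x *\<^sub>R (f x)\<^sup>2) + 2 * (indicator Iv x *\<^sub>R (g x)\<^sup>2))"
      by (intro AE_I2) (auto simp: indicator_def)
  qed
qed

lemma L2_on_const: "L2_on (\<lambda>_. k)"
  by (simp add: L2_on_def set_integrable_def)

lemma L2_on_integrable:
  assumes "L2_on f" shows "set_integrable lborel Iv f"
  unfolding set_integrable_def
proof (rule Bochner_Integration.integrable_bound)
  show "integrable lborel (\<lambda>w. indicator Iv w *\<^sub>R 1 + indicator Iv w *\<^sub>R (f w)^2)"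
    using assms by (intro Bochner_Integration.integrable_add) (simp_all add: L2_on_def set_integrable_def)
  show "(\<lambda>x. indicat_real Iv x *\<^sub>R f x) \<in> borel_measurable lborel"
    using assms by (intro borel_measurable_scaleR) (auto simp: L2_on_def)
  have *: "\<bar>x\<bar> \<le> 1 + x^2" for x :: real
    using sum_squares_ge_zero[of "\<bar>x\<bar> - 1" 0] by (auto simp: power2_eq_square algebra_simps abs_if)
  show "AE x in lborel. norm (indicat_real Iv x *\<^sub>R f x) \<le> norm (indicat_real Iv x *\<^sub>R 1 + indicat_real Iv x *\<^sub>R (f x)\<^sup>2)"
    using * by (intro AE_I2) (auto simp: indicator_def)
qed

lemma L2_sq_le:
  assumes f: "L2_on f" and g: "L2_on g"
  shows "(LINT w:Iv|lborel. (f w)^2) \<le> 2 * (LINT w:Iv|lborel. (f w - g w)^2) + 2 * (LINT w:Iv|lborel. (g w)^2)"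
proof -
  have "(LINT w:Iv|lborel. (f w)^2) \<le> (LINT w:Iv|lborel. 2 * (f w - g w)^2 + 2 * (g w)^2)"
  proof (rule set_integral_mono)
    show "set_integrable lborel Iv (\<lambda>w. (f w)^2)" using f by (simp add: L2_on_def)
    show "set_integrable lborel Iv (\<lambda>w. 2 * (f w - g w)^2 + 2 * (g w)^2)"
      using g L2_on_diff[OF f g] by (intro set_integral_add set_integrable_mult_right) (simp_all add: L2_on_def)
    have "x^2 \<le> 2 * (x - y)^2 + 2 * y^2" for x y :: real
      using sum_squares_ge_zero[of "x - 2 * y" 0] by (simp add: power2_eq_square algebra_simps)
    then show "(f w)^2 \<le> 2 * (f w - g w)^2 + 2 * (g w)^2" for w by simp
  qed
  also have "\<dots> = 2 * (LINT w:Iv|lborel. (f w - g w)^2) + 2 * (LINT w:Iv|lborel. (g w)^2)"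
    using g L2_on_diff[OF f g]
    by (subst set_integral_add) (simp_all add: L2_on_def)
  finally show ?thesis .
qed

text \<open>Continuity in time bounds the norm near each instant; compactness of
  \<open>{0..S}\<close> leaves finitely many such neighbourhoods.\<close>

lemma L2_path_bound:
  assumes u: "L2_path u"
  shows "\<exists>K. \<forall>t. 0 \<le> t \<longrightarrow> t \<le> S \<longrightarrow> (LINT w:Iv|lborel. (u w t)^2) \<le> K"
proof -
  have L: "L2_on (\<lambda>w. u w t)" if "0 \<le> t" for t using u that by (simp add: L2_path_def)
  have "\<exists>d>0. \<exists>K. \<forall>t. 0 \<le> t \<longrightarrow> dist t t0 < d \<longrightarrow> (LINT w:Iv|lborel. (u w t)^2) \<le> K" if t0: "0 \<le> t0" for t0
  proof -
    have "\<forall>\<^sub>F t in at t0 within {0..}. (LINT w:Iv|lborel. (u w t - u w t0)^2) < 1"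
      using u t0 by (intro order_tendstoD(2)[where y = 0]) (auto simp: L2_path_def)
    then obtain d where d: "0 < d" "\<And>t. 0 \<le> t \<Longrightarrow> t \<noteq> t0 \<Longrightarrow> dist t t0 < d \<Longrightarrow> (LINT w:Iv|lborel. (u w t - u w t0)^2) < 1"
      unfolding eventually_at by auto
    have "(LINT w:Iv|lborel. (u w t)^2) \<le> 2 * 1 + 2 * (LINT w:Iv|lborel. (u w t0)^2)" if "0 \<le> t" "dist t t0 < d" for t
    proof -
      have "(LINT w:Iv|lborel. (u w t - u w t0)^2) \<le> 1"
        using d(2)[OF that(1) _ that(2)] by (cases "t = t0") auto
      then show ?thesis using L2_sq_le[OF L[OF that(1)] L[OF t0]] by linarith
    qed
    then show ?thesis using d(1) by blast
  qed
  then obtain d K where d: "\<And>t0. 0 \<le> t0 \<Longrightarrow> 0 < d t0"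
    and K: "\<And>t0 t. 0 \<le> t0 \<Longrightarrow> 0 \<le> t \<Longrightarrow> dist t t0 < d t0 \<Longrightarrow> (LINT w:Iv|lborel. (u w t)^2) \<le> K t0"
    by metis
  have "\<exists>D. D \<subseteq> {0..S} \<and> finite D \<and> {0..S} \<subseteq> (\<Union>t0\<in>D. ball t0 (d t0))"
  proof (rule compactE_image[of "{0..S}" "{0..S}" "\<lambda>t0. ball t0 (d t0)"])
    show "{0..S} \<subseteq> (\<Union>t0\<in>{0..S}. ball t0 (d t0))" using d by force
  qed auto
  then obtain D where D: "D \<subseteq> {0..S}" "finite D" "{0..S} \<subseteq> (\<Union>t0\<in>D. ball t0 (d t0))" by blast
  have "(LINT w:Iv|lborel. (u w t)^2) \<le> (\<Sum>t0\<in>D. \<bar>K t0\<bar>)" if t: "0 \<le> t" "t \<le> S" for t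
  proof -
    obtain t0 where t0: "t0 \<in> D" "dist t t0 < d t0" using D(3) t by (force simp: dist_commute)
    have "(LINT w:Iv|lborel. (u w t)^2) \<le> \<bar>K t0\<bar>"
      using K[of t0 t] t0 D(1) t by force
    also have "\<dots> \<le> (\<Sum>t0\<in>D. \<bar>K t0\<bar>)" using D(2) t0 by (intro member_le_sum) auto
    finally show ?thesis .
  qed
  then show ?thesis by blast
qed

lemma cont2_measurable:
  assumes "cont2 F" shows "(\<lambda>p. F (fst p) (snd p)) \<in> borel_measurable (lborel :: (real \<times> real) measure)"
  using borel_measurable_continuous_onI[OF assms[unfolded cont2_def]] by simp

text \<open>On bounded times \<open>\<bar>u * F\<bar>\<close> is at most a multiple of
  \<open>1 + u^2\<close>, whose slice integrals are uniformly bounded, so Tonelli applies. Splitting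
  the weak identities into separate integrals rests on this.\<close>

lemma L2_path_integrable:
  assumes u: "L2_path u" and F: "cont2 F" and S: "\<And>w t. w \<in> Iv \<Longrightarrow> S < t \<Longrightarrow> F w t = 0"
  shows "set_integrable lborel Strip (\<lambda>p. u (fst p) (snd p) * F (fst p) (snd p))"
proof -
  obtain K where K: "\<And>t. 0 \<le> t \<Longrightarrow> t \<le> S \<Longrightarrow> (LINT w:Iv|lborel. (u w t)^2) \<le> K"
    using L2_path_bound[OF u] by blast
  have "compact ((\<lambda>p. F (fst p) (snd p)) ` (Iv \<times> {0..S}))"
    by (intro compact_continuous_image continuous_on_subset[OF F[unfolded cont2_def]] compact_Times) auto
  then have "bounded ((\<lambda>p. F (fst p) (snd p)) ` (Iv \<times> {0..S}))" by (rule compact_imp_bounded)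
  then obtain C where "\<forall>p\<in>Iv \<times> {0..S}. \<bar>F (fst p) (snd p)\<bar> \<le> C"
    unfolding bounded_iff by auto
  then have C: "\<bar>F w t\<bar> \<le> C" if "w \<in> Iv" "0 \<le> t" "t \<le> S" for w t
    using that by auto
  have um: "(\<lambda>p. u (fst p) (snd p)) \<in> borel_measurable lborel" using u by (simp add: L2_path_def)
  have mm: "(\<lambda>p. u (fst p) (snd p) * F (fst p) (snd p)) \<in> borel_measurable lborel"
    using um cont2_measurable[OF F] by simp
  define R where "R p = indicator (Iv \<times> {0..S}) p * (\<bar>C\<bar> * (1 + (u (fst p) (snd p))^2))" for p
  have Rm: "R \<in> borel_measurable lborel" unfolding R_def[abs_def]
    using um by (intro borel_measurable_times borel_measurable_add borel_measurable_power borel_measurable_indicator borel_measurable_const)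
      (simp_all add: borel_closed closed_Times)
  have Rb: "(\<integral>\<^sup>+p. ennreal (R p) \<partial>lborel) < \<infinity>"
  proof -
    have "(\<integral>\<^sup>+p. ennreal (R p) \<partial>lborel) = (\<integral>\<^sup>+t. \<integral>\<^sup>+w. ennreal (R (w, t)) \<partial>lborel \<partial>lborel)"
      unfolding lborel_prod[symmetric]
      by (rule lborel_pair.nn_integral_snd[symmetric]) (use Rm in \<open>simp add: lborel_prod\<close>)
    also have "\<dots> \<le> (\<integral>\<^sup>+t. ennreal (\<bar>C\<bar> * (2 + \<bar>K\<bar>)) * indicator {0..S} t \<partial>lborel)"
    proof (rule nn_integral_mono)
      fix t :: real
      show "(\<integral>\<^sup>+w. ennreal (R (w, t)) \<partial>lborel) \<le> ennreal (\<bar>C\<bar> * (2 + \<bar>K\<bar>)) * indicator {0..S} t"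
      proof (cases "t \<in> {0..S}")
        case True
        then have Lt: "set_integrable lborel Iv (\<lambda>w. (u w t)^2)" using u by (auto simp: L2_path_def L2_on_def)
        have i1: "set_integrable lborel Iv (\<lambda>w. 1::real)" by (simp add: set_integrable_def)
        have i: "set_integrable lborel Iv (\<lambda>w. \<bar>C\<bar> * (1 + (u w t)^2))"
          by (intro set_integrable_mult_right set_integral_add i1 Lt)
        have "(\<integral>\<^sup>+w. ennreal (R (w, t)) \<partial>lborel) = (\<integral>\<^sup>+w. ennreal (indicator Iv w *\<^sub>R (\<bar>C\<bar> * (1 + (u w t)^2))) \<partial>lborel)"
          using True by (intro nn_integral_cong) (auto simp: R_def indicator_def)
        also have "\<dots> = ennreal (LINT w:Iv|lborel. \<bar>C\<bar> * (1 + (u w t)^2))"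
          unfolding set_lebesgue_integral_def using i unfolding set_integrable_def
          by (intro nn_integral_eq_integral) (auto simp: indicator_def)
        also have "(LINT w:Iv|lborel. \<bar>C\<bar> * (1 + (u w t)^2)) = \<bar>C\<bar> * (2 + (LINT w:Iv|lborel. (u w t)^2))"
          using set_integral_add(2)[OF i1 Lt] by (simp add: set_lebesgue_integral_def)
        also have "\<dots> \<le> \<bar>C\<bar> * (2 + \<bar>K\<bar>)" using K[of t] True by (intro mult_left_mono) auto
        finally show ?thesis using True by (simp add: ennreal_leI)
      next
        case False
        then have "R (w, t) = 0" for w by (auto simp: R_def)
        then show ?thesis by simp
      qed
    qed
    also have "\<dots> < \<infinity>"
      by (subst nn_integral_cmult_indicator) (auto simp: ennreal_mult_less_top emeasure_lborel_Icc_eq)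
    finally show ?thesis .
  qed
  have Ri: "integrable lborel R"
    using Rb Rm by (intro integrableI_bounded) (auto simp: R_def indicator_def intro!: le_less_trans[OF nn_integral_mono])
  show ?thesis unfolding set_integrable_def
  proof (rule Bochner_Integration.integrable_bound[OF Ri])
    show "(\<lambda>x. indicat_real Strip x *\<^sub>R (u (fst x) (snd x) * F (fst x) (snd x))) \<in> borel_measurable lborel"
      using mm by (intro borel_measurable_scaleR borel_measurable_indicator) (simp_all add: borel_closed closed_Times)
    have *: "\<bar>x * y\<bar> \<le> \<bar>C\<bar> * (1 + x^2)" if "\<bar>y\<bar> \<le> C" for x y :: real
    proof -
      have "\<bar>x\<bar> \<le> 1 + x^2" using sum_squares_ge_zero[of "\<bar>x\<bar> - 1" 0] by (auto simp: power2_eq_square algebra_simps abs_if)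
      then have "\<bar>y\<bar> * \<bar>x\<bar> \<le> \<bar>C\<bar> * (1 + x^2)" using that by (intro mult_mono) auto
      then show ?thesis by (simp add: abs_mult mult.commute)
    qed
    show "AE x in lborel. norm (indicat_real Strip x *\<^sub>R (u (fst x) (snd x) * F (fst x) (snd x))) \<le> norm (R x)"
    proof (rule AE_I2)
      fix p :: "real \<times> real"
      show "norm (indicat_real Strip p *\<^sub>R (u (fst p) (snd p) * F (fst p) (snd p))) \<le> norm (R p)"
      proof (cases "p \<in> Iv \<times> {0..S}")
        case True
        then show ?thesis using *[OF C, of "fst p" "snd p" "u (fst p) (snd p)"]
          by (auto simp: R_def indicator_def abs_mult)
      next
        case False
        then show ?thesis using S by (auto simp: indicator_def mem_Times_iff)
      qed
    qed
  qed
qed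

lemma Strip_Fubini:
  fixes h :: "real \<Rightarrow> real \<Rightarrow> real"
  assumes h: "set_integrable lborel Strip (\<lambda>p. h (fst p) (snd p))"
  shows "(LINT p:Strip|lborel. h (fst p) (snd p)) = (LINT t:{0..}|lborel. LINT w:Iv|lborel. h w t)"
    and "set_integrable lborel {0..} (\<lambda>t. LINT w:Iv|lborel. h w t)"
proof -
  have i: "integrable (lborel \<Otimes>\<^sub>M lborel) (\<lambda>(w, t). indicator Strip (w, t) *\<^sub>R h w t)"
    using h unfolding set_integrable_def lborel_prod by (simp add: case_prod_unfold)
  have e: "(LINT w|lborel. indicator Strip (w, t) *\<^sub>R h w t) = indicator {0..} t *\<^sub>R (LINT w:Iv|lborel. h w t)" for t :: real
    by (cases "0 \<le> t") (auto simp: set_lebesgue_integral_def indicator_def intro!: Bochner_Integration.integral_cong)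
  show "(LINT p:Strip|lborel. h (fst p) (snd p)) = (LINT t:{0..}|lborel. LINT w:Iv|lborel. h w t)"
    using lborel_pair.integral_snd[OF i] unfolding lborel_prod set_lebesgue_integral_def[of _ _ "\<lambda>p. h (fst p) (snd p)"]
      set_lebesgue_integral_def[of _ "{0..}"] e[symmetric] by (simp add: case_prod_unfold)
  show "set_integrable lborel {0..} (\<lambda>t. LINT w:Iv|lborel. h w t)"
    using lborel_pair.integrable_snd[OF i] unfolding set_integrable_def e[symmetric] .
qed

text \<open>A measurable function is an a.e. limit of continuous ones; truncating those at
  \<open>B\<close> keeps the limit, since \<open>f\<close> itself stays within
  \<open>{-B..B}\<close>.\<close>

lemma approx_by_continuous:
  fixes f :: "real \<Rightarrow> real"
  assumes f: "f \<in> borel_measurable lborel" and B: "\<And>x. \<bar>f x\<bar> \<le> B"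
  shows "\<exists>g. (\<forall>n. continuous_on UNIV (g n)) \<and> (\<forall>n x. \<bar>g n x\<bar> \<le> B) \<and> (AE x in lborel. (\<lambda>n. g n x) \<longlonglongrightarrow> f x)"
proof -
  have "f \<in> borel_measurable lebesgue" using f by (simp add: measurable_completion)
  then have "f measurable_on UNIV" by (rule lebesgue_measurable_imp_measurable_on_real) simp
  then obtain N h where N: "negligible N" and h: "\<And>n. continuous_on UNIV (h n :: real \<Rightarrow> real)"
    and lim: "\<And>x. x \<notin> N \<Longrightarrow> (\<lambda>n. h n x) \<longlonglongrightarrow> f x"
    unfolding measurable_on_def by auto
  define g where "g n x = max (-B) (min B (h n x))" for n x
  have B0: "0 \<le> B" using B[of 0] by linarith
  show ?thesis
  proof (intro exI conjI allI)
    show "continuous_on UNIV (g n)" for n unfolding g_def[abs_def]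
      by (intro continuous_on_max continuous_on_min continuous_on_const h)
    show "\<bar>g n x\<bar> \<le> B" for n x using B0 by (auto simp: g_def)
    have "(\<lambda>n. g n x) \<longlonglongrightarrow> f x" if "x \<notin> N" for x
    proof -
      have "(\<lambda>n. g n x) \<longlonglongrightarrow> max (-B) (min B (f x))"
        unfolding g_def by (intro tendsto_max tendsto_min tendsto_const lim that)
      moreover have "max (-B) (min B (f x)) = f x" using B[of x] by (auto simp: abs_le_iff)
      ultimately show ?thesis by simp
    qed
    moreover have "N \<in> null_sets lebesgue" using N by (simp add: negligible_iff_null_sets)
    ultimately have "AE x in lebesgue. (\<lambda>n. g n x) \<longlonglongrightarrow> f x"
      by (intro AE_I[where N = N]) auto
    then show "AE x in lborel. (\<lambda>n. g n x) \<longlonglongrightarrow> f x"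
      by (simp add: AE_completion_iff)
  qed
qed

text \<open>Testing with continuous approximations of \<open>sgn (f x)\<close>, all bounded by 1,
  yields the integral of \<open>\<bar>f\<bar>\<close> in the limit by dominated convergence.\<close>

lemma orthogonal_to_continuous:
  assumes f: "L2_on f" and orth: "\<And>g. continuous_on UNIV g \<Longrightarrow> (\<And>x. \<bar>g x\<bar> \<le> 1) \<Longrightarrow> (LINT w:Iv|lborel. f w * g w) = 0"
  shows "AE w in lborel. w \<in> Iv \<longrightarrow> f w = 0"
proof -
  have fi: "integrable lborel (\<lambda>w. indicator Iv w *\<^sub>R f w)" using L2_on_integrable[OF f] by (simp add: set_integrable_def)
  have fm: "f \<in> borel_measurable lborel" using f by (simp add: L2_on_def)
  have "(\<lambda>x. sgn (f x)) \<in> borel_measurable lborel" using fm by measurable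
  moreover have "\<bar>sgn (f x)\<bar> \<le> 1" for x by (auto simp: sgn_if)
  ultimately obtain g where g: "\<And>n. continuous_on UNIV (g n)" "\<And>n x. \<bar>g n x\<bar> \<le> 1"
    and lim: "AE x in lborel. (\<lambda>n. g n x) \<longlonglongrightarrow> sgn (f x)"
    using approx_by_continuous[of "\<lambda>x. sgn (f x)" 1] by blast
  have gm: "g n \<in> borel_measurable lborel" for n using borel_measurable_continuous_onI[OF g(1)[of n]] by simp
  have "(\<lambda>n. LINT w|lborel. indicator Iv w *\<^sub>R (f w * g n w)) \<longlonglongrightarrow> (LINT w|lborel. indicator Iv w *\<^sub>R (f w * sgn (f w)))"
  proof (rule integral_dominated_convergence[where w = "\<lambda>w. \<bar>indicator Iv w *\<^sub>R f w\<bar>"])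
    show "integrable lborel (\<lambda>w. \<bar>indicator Iv w *\<^sub>R f w\<bar>)" using fi by (rule integrable_abs)
    show "AE x in lborel. (\<lambda>i. indicator Iv x *\<^sub>R (f x * g i x)) \<longlonglongrightarrow> indicator Iv x *\<^sub>R (f x * sgn (f x))"
      using lim by eventually_elim (intro tendsto_intros)
    show "AE x in lborel. norm (indicator Iv x *\<^sub>R (f x * g i x)) \<le> \<bar>indicator Iv x *\<^sub>R f x\<bar>" for i
    proof (rule AE_I2)
      fix x show "norm (indicator Iv x *\<^sub>R (f x * g i x)) \<le> \<bar>indicator Iv x *\<^sub>R f x\<bar>"
        using mult_left_mono[OF g(2)[of i x], of "\<bar>f x\<bar>"] by (auto simp: indicator_def abs_mult)
    qed
  qed (use fm gm in measurable)
  moreover have "(LINT w|lborel. indicator Iv w *\<^sub>R (f w * g n w)) = 0" for n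
    using orth[OF g(1)[of n]] g(2) by (simp add: set_lebesgue_integral_def)
  ultimately have "(LINT w|lborel. indicator Iv w *\<^sub>R (f w * sgn (f w))) = 0"
    by (simp add: LIMSEQ_const_iff)
  moreover have "\<bar>indicator Iv w *\<^sub>R f w\<bar> = indicator Iv w *\<^sub>R (f w * sgn (f w))" for w
    by (auto simp: indicator_def abs_sgn)
  ultimately have "(LINT w|lborel. \<bar>indicator Iv w *\<^sub>R f w\<bar>) = 0" by presburger
  then have "AE w in lborel. \<bar>indicator Iv w *\<^sub>R f w\<bar> = 0"
    using integrable_abs[OF fi] by (subst (asm) integral_nonneg_eq_0_iff_AE) auto
  then show ?thesis by eventually_elim (auto simp: indicator_def)
qed

lemma L2_path_pairing_continuous:
  assumes u: "L2_path u" and g: "continuous_on UNIV g" "\<And>x. \<bar>g x\<bar> \<le> B"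
  shows "continuous_on {0..} (\<lambda>t. LINT w:Iv|lborel. u w t * g w)"
  unfolding continuous_on_def
proof
  fix t0 :: real assume t0: "t0 \<in> {0..}"
  have gm: "g \<in> borel_measurable lborel" using borel_measurable_continuous_onI[OF g(1)] by simp
  have L: "L2_on (\<lambda>w. u w t)" if "0 \<le> t" for t using u that by (simp add: L2_path_def)
  have int: "set_integrable lborel Iv (\<lambda>w. u w t * g w)" if "0 \<le> t" for t
    by (rule set_integrable_bound_mult[OF L2_on_integrable[OF L[OF that]] gm g(2)])
  have B: "0 \<le> B" using g(2)[of 0] by linarith
  show "((\<lambda>t. LINT w:Iv|lborel. u w t * g w) \<longlongrightarrow> (LINT w:Iv|lborel. u w t0 * g w)) (at t0 within {0..})"
  proof (rule tendstoI)
    fix e :: real assume e: "0 < e"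
    \<comment> \<open>Young's inequality \<open>\<bar>x\<bar> \<le> k / 2 + x^2 / (2 * k)\<close>
      takes the role of Cauchy-Schwarz; this \<open>k\<close> makes the final bound
      \<open>B * (2 * k)\<close> smaller than \<open>e\<close>.\<close>
    define k where "k = e / (2 * (B + 1))"
    have k: "0 < k" using e B by (simp add: k_def)
    have "((\<lambda>t. LINT w:Iv|lborel. (u w t - u w t0)^2) \<longlongrightarrow> 0) (at t0 within {0..})"
      using u t0 by (simp add: L2_path_def)
    then have "\<forall>\<^sub>F t in at t0 within {0..}. (LINT w:Iv|lborel. (u w t - u w t0)^2) < k * k / 2"
      using k by (intro order_tendstoD(2)) auto
    moreover have "\<forall>\<^sub>F t in at t0 within {0..}. t \<in> {0..}" by (simp add: eventually_at_filter)
    ultimately show "\<forall>\<^sub>F t in at t0 within {0..}. dist (LINT w:Iv|lborel. u w t * g w) (LINT w:Iv|lborel. u w t0 * g w) < e"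
    proof eventually_elim
      case (elim t)
      then have t: "0 \<le> t" by simp
      have t0': "0 \<le> t0" using t0 by simp
      note D = L2_on_diff[OF L[OF t] L[OF t0']]
      have i1: "set_integrable lborel Iv (\<lambda>w. k / 2 :: real)" by (simp add: set_integrable_def)
      have i2: "set_integrable lborel Iv (\<lambda>w. (1 / (2 * k)) * (u w t - u w t0)^2)"
        using D by (intro set_integrable_mult_right) (simp add: L2_on_def)
      have i3: "set_integrable lborel Iv (\<lambda>w. B * (k / 2 + (1 / (2 * k)) * (u w t - u w t0)^2))"
        by (intro set_integrable_mult_right set_integral_add i1 i2)
      have am: "\<bar>x\<bar> \<le> k / 2 + (1 / (2 * k)) * x^2" for x :: real
      proof -
        have "2 * (k * \<bar>x\<bar>) \<le> k * k + x^2" using sum_squares_ge_zero[of "\<bar>x\<bar> - k" 0] by (simp add: power2_eq_square algebra_simps)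
        then show ?thesis using k by (simp add: field_simps power2_eq_square)
      qed
      have "dist (LINT w:Iv|lborel. u w t * g w) (LINT w:Iv|lborel. u w t0 * g w)
        = \<bar>LINT w:Iv|lborel. u w t * g w - u w t0 * g w\<bar>"
        using set_integral_diff(2)[OF int[OF t] int[OF t0']] by (simp add: dist_real_def)
      also have "\<dots> \<le> (LINT w:Iv|lborel. \<bar>u w t * g w - u w t0 * g w\<bar>)"
        using set_integral_norm_bound[OF set_integral_diff(1)[OF int[OF t] int[OF t0']]] by simp
      also have "\<dots> \<le> (LINT w:Iv|lborel. B * (k / 2 + (1 / (2 * k)) * (u w t - u w t0)^2))"
      proof (rule set_integral_mono)
        show "set_integrable lborel Iv (\<lambda>w. \<bar>u w t * g w - u w t0 * g w\<bar>)"
          by (rule set_integrable_abs[OF set_integral_diff(1)[OF int[OF t] int[OF t0']]])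
        show "\<bar>u w t * g w - u w t0 * g w\<bar> \<le> B * (k / 2 + (1 / (2 * k)) * (u w t - u w t0)^2)" for w
        proof -
          have "\<bar>u w t * g w - u w t0 * g w\<bar> = \<bar>g w\<bar> * \<bar>u w t - u w t0\<bar>"
            by (simp add: abs_mult mult.commute flip: right_diff_distrib)
          also have "\<dots> \<le> B * (k / 2 + (1 / (2 * k)) * (u w t - u w t0)^2)"
            using g(2) am B by (intro mult_mono) auto
          finally show ?thesis .
        qed
      qed (rule i3)
      also have "\<dots> = B * (k + (1 / (2 * k)) * (LINT w:Iv|lborel. (u w t - u w t0)^2))"
        using set_integral_add(2)[OF i1 i2] by (simp add: set_lebesgue_integral_def)
      also have "\<dots> \<le> B * (k + (1 / (2 * k)) * (k * k / 2))"
        using elim(1) k B by (intro mult_left_mono add_left_mono) auto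
      also have "\<dots> \<le> B * (2 * k)" using k B by (intro mult_left_mono) auto
      also have "\<dots> < e" using e B by (simp add: k_def field_simps)
      finally show ?case .
    qed
  qed
qed

section \<open>Finite-time extinction\<close>

lemma closed_loop_solution_L2_path:
  assumes "closed_loop_solution lam lam' mu mu' b c U1 U2 u0 v0 u v"
  shows "L2_path u" "L2_path v"
  using assms unfolding closed_loop_solution_def L2_path_def by blast+

lemma closed_loop_solution_weak:
  assumes "closed_loop_solution lam lam' mu mu' b c U1 U2 u0 v0 u v"
  shows "test_fun phi phiw phit \<Longrightarrow> (\<And>t. phi 1 t = 0) \<Longrightarrow>
        - (LINT w:{-1..1}|lborel. u0 w * phi w 0)
        - (LINT p:({-1..1} \<times> {0..})|lborel.
              u (fst p) (snd p) * (phit (fst p) (snd p) + lam' (fst p) * phi (fst p) (snd p)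
                                   + lam (fst p) * phiw (fst p) (snd p)))
        - (LINT t:{0..}|lborel. lam (-1) * U1 (\<lambda>z. u z t) (\<lambda>z. v z t) * phi (-1) t)
        = (LINT p:({-1..1} \<times> {0..})|lborel.
              b (fst p) * v (fst p) (snd p) * phi (fst p) (snd p))"
    and "test_fun psi psiw psit \<Longrightarrow> (\<And>t. psi (-1) t = 0) \<Longrightarrow>
        - (LINT w:{-1..1}|lborel. v0 w * psi w 0)
        - (LINT p:({-1..1} \<times> {0..})|lborel. v (fst p) (snd p) * psit (fst p) (snd p))
        + (LINT p:({-1..1} \<times> {0..})|lborel.
              v (fst p) (snd p) * (mu' (fst p) * psi (fst p) (snd p) + mu (fst p) * psiw (fst p) (snd p)))
        - (LINT t:{0..}|lborel. mu 1 * U2 (\<lambda>z. u z t) (\<lambda>z. v z t) * psi 1 t)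
        = (LINT p:({-1..1} \<times> {0..})|lborel.
              c (fst p) * u (fst p) (snd p) * psi (fst p) (snd p))"
  using assms unfolding closed_loop_solution_def by blast+

lemma Strip_sets [measurable, simp]: "Strip \<in> sets borel"
  by (intro borel_closed closed_Times) auto

lemma Strip_cong:
  fixes f g :: "real \<times> real \<Rightarrow> real"
  assumes "\<And>w t. w \<in> Iv \<Longrightarrow> 0 \<le> t \<Longrightarrow> f (w, t) = g (w, t)"
  shows "(LINT p:Strip|lborel. f p) = (LINT p:Strip|lborel. g p)"
  using assms by (intro set_lebesgue_integral_cong) auto

text \<open>Division by \<open>k\<close> fits the conservative form:
  \<open>k' * phi + k * phiw\<close> becomes \<open>Fw\<close>. The time cutoff is there because a
  test function must vanish at late times for every real \<open>w\<close>, whereas the adjoint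
  functions are known to vanish only for \<open>w\<close> in \<open>{-1..1}\<close>; where
  \<open>F\<close> and its derivatives vanish after \<open>S\<close>, the cutoff leaves no
  trace.\<close>

lemma test_fun_cutoff:
  assumes F: "C1_2 F Fw Ft" and k: "\<And>w. (k has_real_derivative k' w) (at w)" and k': "continuous_on UNIV k'" and kp: "\<And>w. 0 < k w"
  shows "\<exists>phi phiw phit. test_fun phi phiw phit \<and>
    (\<forall>w t. t \<le> S \<longrightarrow> phi w t = F w t / k w) \<and> (\<forall>w t. F w t = 0 \<longrightarrow> phi w t = 0) \<and>
    (\<forall>w t. (S < t \<longrightarrow> F w t = 0 \<and> Ft w t = 0 \<and> Fw w t = 0) \<longrightarrow>
        phit w t = Ft w t / k w \<and> k' w * phi w t + k w * phiw w t = Fw w t)"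
proof -
  \<comment> \<open>A ramp from 1 to 0 on \<open>{S + 1..S + 2}\<close>; its unit window average is
    a differentiable cutoff equal to 1 up to \<open>S\<close> and 0 from \<open>S + 3\<close>
    on.\<close>
  define h :: "real \<Rightarrow> real" where "h t = max 0 (min 1 (S + 2 - t))" for t
  have ch: "continuous_on UNIV h" unfolding h_def[abs_def] by (intro continuous_intros)
  define z where "z = avg 1 h"
  define z' where "z' t = h t - h (t - 1)" for t
  have dz: "(z has_real_derivative z' t) (at t)" for t unfolding z_def z'_def by (rule avg_deriv[OF ch])
  have cz': "continuous_on UNIV z'" unfolding z'_def[abs_def] by (intro continuous_intros cont1_comp[OF ch])
  have cz: "continuous_on UNIV z" unfolding z_def by (rule cont_avg[OF ch])
  have z1: "z t = 1" if "t \<le> S" for t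
  proof -
    have "z t = oint (\<lambda>_. 1) (t - 1) t" unfolding z_def avg_def
      using that by (intro oint_cong) (auto simp: h_def)
    then show ?thesis by (simp add: oint_def)
  qed
  have z0: "z t = 0" if "S + 3 \<le> t" for t unfolding z_def
    using that by (intro avg_zero) (auto simp: h_def)
  have z'0: "z' t = 0" if "t \<le> S" for t using that by (auto simp: z'_def h_def)
  have ck: "continuous_on UNIV k" using k by (auto simp: continuous_on_eq_continuous_at dest: DERIV_isCont)
  have kn: "k w \<noteq> 0" for w using kp[of w] by simp
  note FD = C1_2D[OF F]
  define phi where "phi w t = z t * (F w t / k w)" for w t
  define phiw where "phiw w t = z t * (Fw w t / k w - F w t * k' w / (k w * k w))" for w t
  define phit where "phit w t = z' t * (F w t / k w) + z t * (Ft w t / k w)" for w t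
  have kk: "continuous_on UNIV (\<lambda>x::real\<times>real. inverse (k (fst x)))"
    by (intro continuous_on_inverse cont1_comp[OF ck] continuous_intros) (simp add: kn)
  note ci = continuous_intros cont2_comp[OF FD(1)] cont2_comp[OF FD(2)] cont2_comp[OF FD(3)] cont1_comp[OF cz]
    cont1_comp[OF cz'] cont1_comp[OF k'] kk
  have "test_fun phi phiw phit" unfolding test_fun_def
  proof (intro conjI allI)
    fix w t
    have "((\<lambda>x. F x t / k x) has_real_derivative (Fw w t * k w - F w t * k' w) / (k w * k w)) (at w)"
      by (rule DERIV_divide[OF FD(4) k kn])
    then show "((\<lambda>x. phi x t) has_real_derivative phiw w t) (at w)"
      unfolding phi_def phiw_def using kn[of w]
      by (intro DERIV_cmult) (simp add: diff_divide_distrib)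
    show "((\<lambda>s. phi w s) has_real_derivative phit w t) (at t)"
      unfolding phi_def phit_def
      by (rule DERIV_cong[OF DERIV_mult[OF dz DERIV_cdivide[OF FD(5)]]]) simp
  next
    show "continuous_on UNIV (\<lambda>(w, t). phi w t)" "continuous_on UNIV (\<lambda>(w, t). phiw w t)" "continuous_on UNIV (\<lambda>(w, t). phit w t)"
      unfolding phi_def phiw_def phit_def case_prod_unfold divide_inverse inverse_mult_distrib by (intro ci)+
    show "\<exists>S. \<forall>w t. t \<ge> S \<longrightarrow> phi w t = 0" by (rule exI[of _ "S + 3"]) (simp add: phi_def z0)
  qed
  moreover have "phit w t = Ft w t / k w \<and> k' w * phi w t + k w * phiw w t = Fw w t"
    if "S < t \<longrightarrow> F w t = 0 \<and> Ft w t = 0 \<and> Fw w t = 0" for w t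
  proof (cases "S < t")
    case True
    then show ?thesis using that by (simp add: phi_def phiw_def phit_def)
  next
    case False
    then show ?thesis using kn[of w] by (simp add: phi_def phiw_def phit_def z1 z'0 field_simps)
  qed
  moreover have "\<forall>w t. t \<le> S \<longrightarrow> phi w t = F w t / k w" "\<forall>w t. F w t = 0 \<longrightarrow> phi w t = 0"
    by (auto simp: phi_def z1)
  ultimately show ?thesis by blast
qed

lemma C1_2_zero_after:
  assumes F: "C1_2 F Fz Ft" and 0: "\<And>t. S < t \<Longrightarrow> F z t = 0" and t: "S < t"
  shows "Ft z t = 0"
proof -
  have "((\<lambda>t. F z t) has_real_derivative Ft z t) (at t)" by (rule C1_2D[OF F])
  moreover have "\<forall>\<^sub>F s in nhds t. F z s = (\<lambda>_. 0) s"
    using eventually_nhds_in_open[of "{S<..}" t] t by (auto elim!: eventually_mono simp: 0)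
  ultimately have "((\<lambda>_. 0) has_real_derivative Ft z t) (at t)"
    using DERIV_cong_ev[OF refl, of "F z" "\<lambda>_. 0" t] by blast
  then show ?thesis by (rule DERIV_unique) simp
qed

context hyp_kernel begin

text \<open>The test pair is the adjoint Cauchy solution with zero data at \<open>w = 1\<close>, corrected by the kernel response to its trace
  \<open>x = Q(-1,.)\<close>. The correction restores \<open>psi(-1,.) = 0\<close>, and its defect \<open>k1 x(tau+t)\<close>, \<open>k2 x(tau+t)\<close> cancels against the feedback term.\<close>

lemma vanish_pairing:
  assumes sol: "closed_loop_solution lam lam' mu mu' b c (fb1 (\<lambda>_ _. 0) (\<lambda>_ _. 0)) (fb2 (\<lambda>z _. k1 z) (\<lambda>z _. k2 z)) u0 v0 u v"
    and F0: "continuous_on UNIV F0" "\<And>s. \<bar>F0 s\<bar> \<le> FB" and G0: "continuous_on UNIV G0" "\<And>s. \<bar>G0 s\<bar> \<le> FB"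
    and rho: "continuous_on UNIV rho" "\<And>t. \<bar>rho t\<bar> \<le> RM" and supp: "\<forall>t. t < T1 \<or> T2 < t \<longrightarrow> rho t = 0"
    and e: "0 \<le> e" and T1: "tau + sigma < T1"
  shows "(LINT p:Strip|lborel. u (fst p) (snd p) * (F0 (fst p) * avg e rho (snd p)))
     + (LINT p:Strip|lborel. v (fst p) (snd p) * (G0 (fst p) * avg e rho (snd p))) = 0"
proof -
  obtain P Pz Pt Q Qz Qt where PQ: "C1_2 P Pz Pt \<and> C1_2 Q Qz Qt \<and> (\<forall>t. P 1 t = 0 \<and> Q 1 t = 0) \<and>
     (\<forall>z t. -1 \<le> z \<longrightarrow> z \<le> 1 \<longrightarrow>
        Pz z t + Pt z t / lam z = - (K1 z * Q z t + F0 z * avg e rho t) \<and>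
        Qz z t - Qt z t / mu z = K2 z * P z t + G0 z * avg e rho t \<and>
        (t < T1 - sigma \<or> t > T2 + tau + e \<longrightarrow> P z t = 0 \<and> Q z t = 0))"
    using adjoint_solution[OF F0 G0 rho supp e] by (elim exE) (rule that)
  have P: "C1_2 P Pz Pt" and Q: "C1_2 Q Qz Qt" and PQ1: "\<And>t. P 1 t = 0" "\<And>t. Q 1 t = 0"
    using PQ by simp_all
  have Peq: "Pz z t + Pt z t / lam z = - (K1 z * Q z t + F0 z * avg e rho t)"
    and Qeq: "Qz z t - Qt z t / mu z = K2 z * P z t + G0 z * avg e rho t"
    and PQ0: "t < T1 - sigma \<or> t > T2 + tau + e \<Longrightarrow> P z t = 0 \<and> Q z t = 0"
    if "-1 \<le> z" "z \<le> 1" for z t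
    using PQ[THEN conjunct2, THEN conjunct2, THEN conjunct2, rule_format, OF that, of t] by auto
  define r where "r = avg e rho"
  define S where "S = \<bar>T2\<bar> + tau + e"
  have S: "0 \<le> S" "T2 + tau + e \<le> S" using e sigma_tau_nonneg by (auto simp: S_def)
  have cr: "continuous_on UNIV r" unfolding r_def by (rule cont_avg[OF rho(1)])
  have r0: "r t = 0" if "S < t" for t
    unfolding r_def using that e sigma_tau_nonneg by (intro avg_zero supp[rule_format]) (auto simp: S_def)
  define x where "x t = Q (-1) t" for t
  define x' where "x' t = Qt (-1) t" for t
  have x: "(x has_real_derivative x' t) (at t)" for t
    unfolding x_def[abs_def] x'_def by (rule C1_2D[OF Q])
  have x': "continuous_on UNIV x'"
    unfolding x'_def[abs_def] by (intro cont2_comp[OF C1_2D(2)[OF Q]] continuous_intros)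
  have cx: "continuous_on UNIV x" using x by (auto simp: continuous_on_eq_continuous_at dest: DERIV_isCont)
  have xS: "x t = 0" if "S < t" for t unfolding x_def using PQ0[of "-1" t] that S by auto
  \<comment> \<open>Here \<open>tau + sigma < T1\<close> enters: \<open>Q\<close> vanishes before
    \<open>T1 - sigma\<close>, which exceeds \<open>tau\<close>.\<close>
  have x0: "x t = 0" if "t \<le> tau" for t unfolding x_def using PQ0[of "-1" t] that T1 by auto
  obtain Az At where A: "C1_2 (RA x) Az At" and Aeq: "\<And>z t. -1 \<le> z \<Longrightarrow> z \<le> 1 \<Longrightarrow>
      Az z t + At z t / lam z = k1 z * x (tau + t) + K1 z * (x (m z + t) - RB x z t)"
    using RA_C1[OF x x'] by blast
  obtain Bz Bt where B: "C1_2 (RB x) Bz Bt" and Beq: "\<And>z t. -1 \<le> z \<Longrightarrow> z \<le> 1 \<Longrightarrow>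
      Bz z t - Bt z t / mu z = K2 z * RA x z t - k2 z * x (tau + t)"
    using RB_C1[OF x x'] by blast
  \<comment> \<open>\<open>Phi\<close> and \<open>Psi\<close> stand for \<open>lam * phi\<close> and
    \<open>mu * psi\<close>. Subtracting the transported trace \<open>x (m z + t)\<close> repairs
    \<open>Psi\<close> at \<open>z = -1\<close>; \<open>RA\<close> and \<open>RB\<close> compensate
    the coupling that this subtraction creates.\<close>
  define Phi where "Phi z t = P z t + RA x z t" for z t
  define Phiz where "Phiz z t = Pz z t + Az z t" for z t
  define Phit where "Phit z t = Pt z t + At z t" for z t
  define Psi where "Psi z t = Q z t - x (m z + t) + RB x z t" for z t
  define Psiz where "Psiz z t = Qz z t - x' (m z + t) * (1 / mu z) + Bz z t" for z t
  define Psit where "Psit z t = Qt z t - x' (m z + t) + Bt z t" for z t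
  have cmu: "continuous_on UNIV (\<lambda>x::real \<times> real. 1 / mu (fst x))"
    by (intro cont1_comp[OF cont_inv_speed(2)] continuous_intros)
  note ci = continuous_intros cont2_comp[OF C1_2D(1)[OF P]] cont2_comp[OF C1_2D(2)[OF P]] cont2_comp[OF C1_2D(3)[OF P]]
    cont2_comp[OF C1_2D(1)[OF Q]] cont2_comp[OF C1_2D(2)[OF Q]] cont2_comp[OF C1_2D(3)[OF Q]]
    cont2_comp[OF C1_2D(1)[OF A]] cont2_comp[OF C1_2D(2)[OF A]] cont2_comp[OF C1_2D(3)[OF A]]
    cont2_comp[OF C1_2D(1)[OF B]] cont2_comp[OF C1_2D(2)[OF B]] cont2_comp[OF C1_2D(3)[OF B]]
    cont1_comp[OF cx] cont1_comp[OF x'] cont1_comp[OF cr] cont1_comp[OF F0(1)] cont1_comp[OF G0(1)] cont1_comp[OF cont_k(1)] cont1_comp[OF cont_k(2)] cmu cont_of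
  have Phi: "C1_2 Phi Phiz Phit"
  proof (rule C1_2I)
    show "cont2 Phiz" "cont2 Phit" "cont2 Phi"
      unfolding cont2_def Phi_def Phiz_def Phit_def by (intro ci)+
  qed (unfold Phi_def Phiz_def Phit_def, (intro DERIV_add C1_2D[OF P] C1_2D[OF A])+)
  have Psi: "C1_2 Psi Psiz Psit"
  proof (rule C1_2I)
    show "cont2 Psiz" "cont2 Psit" "cont2 Psi"
      unfolding cont2_def Psi_def Psiz_def Psit_def by (intro ci)+
    fix z t
    have "((\<lambda>z. x (m z + t)) has_real_derivative x' (m z + t) * (1 / mu z)) (at z)"
      by (rule DERIV_chain2[OF x]) (use DERIV_add[OF m_deriv DERIV_const] in simp)
    then show "((\<lambda>z. Psi z t) has_real_derivative Psiz z t) (at z)"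
      unfolding Psi_def Psiz_def by (intro DERIV_add DERIV_diff C1_2D[OF Q] C1_2D[OF B])
    have "((\<lambda>t. x (m z + t)) has_real_derivative x' (m z + t) * 1) (at t)"
      by (rule DERIV_chain2[OF x]) (auto intro!: derivative_eq_intros)
    then show "((\<lambda>t. Psi z t) has_real_derivative Psit z t) (at t)"
      unfolding Psi_def Psit_def by (intro DERIV_add DERIV_diff C1_2D[OF Q] C1_2D[OF B]) simp
  qed
  have Phieq: "Phiz z t + Phit z t / lam z = - K1 z * Psi z t - F0 z * r t + k1 z * x (tau + t)"
    if "-1 \<le> z" "z \<le> 1" for z t
    using Peq[OF that, of t] Aeq[OF that, of t] by (simp add: Phiz_def Phit_def Psi_def r_def add_divide_distrib algebra_simps)
  have Psieq: "Psiz z t - Psit z t / mu z = K2 z * Phi z t + G0 z * r t - k2 z * x (tau + t)"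
    if "-1 \<le> z" "z \<le> 1" for z t
    using Qeq[OF that, of t] Beq[OF that, of t] by (simp add: Psiz_def Psit_def Phi_def r_def add_divide_distrib diff_divide_distrib algebra_simps)
  have late: "Phi z t = 0" "Psi z t = 0" if z: "-1 \<le> z" "z \<le> 1" and t: "S < t" for z t
    using PQ0[OF z, of t] t S RAB_late[OF z, of t x] xS am_range[OF z] by (auto simp: Phi_def Psi_def)
  have late': "Phit z t = 0" "Psit z t = 0" "Phiz z t = 0" "Psiz z t = 0" if z: "-1 \<le> z" "z \<le> 1" and t: "S < t" for z t
  proof -
    show 1: "Phit z t = 0" by (rule C1_2_zero_after[OF Phi late(1)[OF z] t])
    show 2: "Psit z t = 0" by (rule C1_2_zero_after[OF Psi late(2)[OF z] t])
    \<comment> \<open>The time derivatives vanish with the functions; the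
      \<open>z\<close>-derivatives then follow from the equations, end points included.\<close>
    show "Phiz z t = 0" using Phieq[OF z, of t] 1 late[OF z t] r0[OF t] xS[of "tau + t"] t sigma_tau_nonneg by simp
    show "Psiz z t = 0" using Psieq[OF z, of t] 2 late[OF z t] r0[OF t] xS[of "tau + t"] t sigma_tau_nonneg by simp
  qed
  \<comment> \<open>The initial data drop out of the weak identities: the Cauchy solution is zero at
    time 0, and the response at time 0 reads the trace only up to \<open>tau\<close>, where it still
    vanishes.\<close>
  have early: "Phi z 0 = 0" "Psi z 0 = 0" if z: "-1 \<le> z" "z \<le> 1" for z
    using PQ0[OF z, of 0] T1 sigma_tau_nonneg RAB_early[OF z, of 0 x] x0 am_range[OF z] by (auto simp: Phi_def Psi_def)
  obtain phi phiw phit where phi: "test_fun phi phiw phit" and phiS: "\<And>w t. t \<le> S \<Longrightarrow> phi w t = Phi w t / lam w"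
    and phi0: "\<And>w t. Phi w t = 0 \<Longrightarrow> phi w t = 0"
    and phie: "\<And>w t. (S < t \<longrightarrow> Phi w t = 0 \<and> Phit w t = 0 \<and> Phiz w t = 0) \<Longrightarrow>
        phit w t = Phit w t / lam w \<and> lam' w * phi w t + lam w * phiw w t = Phiz w t"
    using test_fun_cutoff[OF Phi lam_deriv cont_lam' lam_pos, of S] by blast
  obtain psi psiw psit where psi: "test_fun psi psiw psit" and psiS: "\<And>w t. t \<le> S \<Longrightarrow> psi w t = Psi w t / mu w"
    and psi0: "\<And>w t. Psi w t = 0 \<Longrightarrow> psi w t = 0"
    and psie: "\<And>w t. (S < t \<longrightarrow> Psi w t = 0 \<and> Psit w t = 0 \<and> Psiz w t = 0) \<Longrightarrow>
        psit w t = Psit w t / mu w \<and> mu' w * psi w t + mu w * psiw w t = Psiz w t"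
    using test_fun_cutoff[OF Psi mu_deriv cont_mu' mu_pos, of S] by blast
  have phi_eq: "phi w t = Phi w t / lam w" if "w \<in> Iv" for w t
    using phiS[of t w] phi0[of w t] late(1)[of w t] that by (cases "t \<le> S") auto
  have psi_eq: "psi w t = Psi w t / mu w" if "w \<in> Iv" for w t
    using psiS[of t w] psi0[of w t] late(2)[of w t] that by (cases "t \<le> S") auto
  note L2 = closed_loop_solution_L2_path[OF sol]
  define J where "J y F = (LINT p:Strip|lborel. y (fst p) (snd p) * F (fst p) (snd p))" for y F :: "real \<Rightarrow> real \<Rightarrow> real"
  have Ji: "set_integrable lborel Strip (\<lambda>p. y (fst p) (snd p) * F (fst p) (snd p))"
    if "L2_path y" "cont2 F" "\<And>w t. w \<in> Iv \<Longrightarrow> S < t \<Longrightarrow> F w t = 0" for y F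
    by (rule L2_path_integrable[OF that])
  have Jadd: "J y (\<lambda>w t. F w t + H w t) = J y F + J y H"
    if "set_integrable lborel Strip (\<lambda>p. y (fst p) (snd p) * F (fst p) (snd p))"
      "set_integrable lborel Strip (\<lambda>p. y (fst p) (snd p) * H (fst p) (snd p))" for y F H
    using set_integral_add(2)[OF that] by (simp add: J_def distrib_left)
  define fK2 where "fK2 w t = K2 w * Phi w t" for w t
  define fK1 where "fK1 w t = - (K1 w * Psi w t)" for w t
  define fF where "fF w t = - (F0 w * r t)" for w t
  define fG where "fG w t = G0 w * r t" for w t
  define fk1 where "fk1 w t = k1 w * x (tau + t)" for w t
  define fk2 where "fk2 w t = - (k2 w * x (tau + t))" for w t
  have cf: "cont2 fK2" "cont2 fK1" "cont2 fF" "cont2 fG" "cont2 fk1" "cont2 fk2"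
    unfolding cont2_def fK2_def fK1_def fF_def fG_def fk1_def fk2_def
    by (intro ci cont2_comp[OF C1_2D(3)[OF Phi]] cont2_comp[OF C1_2D(3)[OF Psi]])+
  have f0: "fK2 w t = 0" "fK1 w t = 0" "fF w t = 0" "fG w t = 0" "fk1 w t = 0" "fk2 w t = 0"
    if "w \<in> Iv" "S < t" for w t
    using that late[of w t] r0[of t] xS[of "tau + t"] sigma_tau_nonneg
    by (auto simp: fK2_def fK1_def fF_def fG_def fk1_def fk2_def)
  have i1: "set_integrable lborel Strip (\<lambda>p. u (fst p) (snd p) * f (fst p) (snd p))"
    "set_integrable lborel Strip (\<lambda>p. v (fst p) (snd p) * f (fst p) (snd p))"
    if "f \<in> {fK2, fK1, fF, fG, fk1, fk2}" for f
    using that cf f0 by (auto intro!: Ji L2)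
  have E1: "- J u fK1 - J u fF - J u fk1 = J v fK2"
  proof -
    have i12: "set_integrable lborel Strip (\<lambda>p. u (fst p) (snd p) * (fK1 (fst p) (snd p) + fF (fst p) (snd p)))"
      using set_integral_add(1)[OF i1(1)[of fK1] i1(1)[of fF]] by (simp add: distrib_left)
    have "(LINT w:Iv|lborel. u0 w * phi w 0) = (LINT w:Iv|lborel. 0)"
      using phi_eq early by (intro set_lebesgue_integral_cong) auto
    moreover have "(LINT p:Strip|lborel. u (fst p) (snd p) * (phit (fst p) (snd p) + lam' (fst p) * phi (fst p) (snd p)
                                   + lam (fst p) * phiw (fst p) (snd p))) = J u (\<lambda>w t. (fK1 w t + fF w t) + fk1 w t)"
      unfolding J_def
    proof (rule Strip_cong, unfold fst_conv snd_conv)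
      fix w t :: real assume w: "w \<in> Iv" and "0 \<le> t"
      then have w': "-1 \<le> w" "w \<le> 1" by auto
      have "phit w t = Phit w t / lam w \<and> lam' w * phi w t + lam w * phiw w t = Phiz w t"
        using late[OF w'] late'[OF w'] by (intro phie) auto
      then have "phit w t + lam' w * phi w t + lam w * phiw w t = Phiz w t + Phit w t / lam w" by simp
      also have "\<dots> = fK1 w t + fF w t + fk1 w t" unfolding Phieq[OF w'] by (simp add: fK1_def fF_def fk1_def)
      finally show "u w t * (phit w t + lam' w * phi w t + lam w * phiw w t) = u w t * (fK1 w t + fF w t + fk1 w t)" by simp
    qed
    moreover have "(LINT t:{0..}|lborel. lam (-1) * fb1 (\<lambda>_ _. 0) (\<lambda>_ _. 0) (\<lambda>z. u z t) (\<lambda>z. v z t) * phi (-1) t) = 0"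
      by (simp add: fb1_def)
    moreover have "(LINT p:Strip|lborel. b (fst p) * v (fst p) (snd p) * phi (fst p) (snd p)) = J v fK2"
      unfolding J_def by (rule Strip_cong) (simp add: phi_eq fK2_def K2_def)
    moreover have "J u (\<lambda>w t. (fK1 w t + fF w t) + fk1 w t) = J u fK1 + J u fF + J u fk1"
      using Jadd[OF i12 i1(1)[of fk1]] Jadd[OF i1(1)[of fK1] i1(1)[of fF]] by simp
    moreover have "phi 1 t = 0" for t using phi_eq[of 1 t] PQ1 by (simp add: Phi_def)
    ultimately show ?thesis using closed_loop_solution_weak(1)[OF sol phi] by simp
  qed
  have E2: "J v fK2 + J v fG + J v fk2 + (J u fk1 - J v fk2) = - J u fK1"
  proof -
    have i12: "set_integrable lborel Strip (\<lambda>p. v (fst p) (snd p) * (fK2 (fst p) (snd p) + fG (fst p) (snd p)))"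
      using set_integral_add(1)[OF i1(2)[of fK2] i1(2)[of fG]] by (simp add: distrib_left)
    have "(LINT w:Iv|lborel. v0 w * psi w 0) = (LINT w:Iv|lborel. 0)"
      using psi_eq early by (intro set_lebesgue_integral_cong) auto
    moreover have "- (LINT p:Strip|lborel. v (fst p) (snd p) * psit (fst p) (snd p))
        + (LINT p:Strip|lborel. v (fst p) (snd p) * (mu' (fst p) * psi (fst p) (snd p) + mu (fst p) * psiw (fst p) (snd p)))
        = J v (\<lambda>w t. (fK2 w t + fG w t) + fk2 w t)"
    proof -
      have cpm: "cont2 (\<lambda>w t. Psit w t * (1 / mu w))" unfolding cont2_def
        by (intro ci cont2_comp[OF C1_2D(2)[OF Psi]])
      have j1: "set_integrable lborel Strip (\<lambda>p. v (fst p) (snd p) * (Psit (fst p) (snd p) * (1 / mu (fst p))))"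
        by (rule Ji[OF L2(2) cpm]) (use late' in auto)
      have j2: "set_integrable lborel Strip (\<lambda>p. v (fst p) (snd p) * Psiz (fst p) (snd p))"
        by (rule Ji[OF L2(2) C1_2D(1)[OF Psi]]) (use late' in auto)
      have pe: "psit w t = Psit w t / mu w \<and> mu' w * psi w t + mu w * psiw w t = Psiz w t" if "w \<in> Iv" for w t
        using late[of w t] late'[of w t] that by (intro psie) auto
      have "(LINT p:Strip|lborel. v (fst p) (snd p) * psit (fst p) (snd p))
          = (LINT p:Strip|lborel. v (fst p) (snd p) * (Psit (fst p) (snd p) * (1 / mu (fst p))))"
        by (rule Strip_cong) (simp add: pe)
      moreover have "(LINT p:Strip|lborel. v (fst p) (snd p) * (mu' (fst p) * psi (fst p) (snd p) + mu (fst p) * psiw (fst p) (snd p)))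
          = (LINT p:Strip|lborel. v (fst p) (snd p) * Psiz (fst p) (snd p))"
        by (rule Strip_cong) (simp add: pe)
      moreover have "(LINT p:Strip|lborel. v (fst p) (snd p) * Psiz (fst p) (snd p)) -
          (LINT p:Strip|lborel. v (fst p) (snd p) * (Psit (fst p) (snd p) * (1 / mu (fst p))))
          = J v (\<lambda>w t. (fK2 w t + fG w t) + fk2 w t)"
        unfolding J_def set_integral_diff(2)[OF j2 j1, symmetric]
      proof (rule Strip_cong, unfold fst_conv snd_conv)
        fix w t :: real assume "w \<in> Iv"
        then have e: "Psiz w t - Psit w t * (1 / mu w) = fK2 w t + fG w t + fk2 w t"
          using Psieq[of w t] by (simp add: fK2_def fG_def fk2_def)
        then show "v w t * Psiz w t - v w t * (Psit w t * (1 / mu w)) = v w t * (fK2 w t + fG w t + fk2 w t)"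
          by (simp only: right_diff_distrib[symmetric] e)
      qed
      ultimately show ?thesis by simp
    qed
    \<comment> \<open>Since \<open>mu 1 * psi 1 t = - x (tau + t)\<close>, Fubini turns the feedback
      integral into the pairing of the state with the defect terms \<open>fk1\<close> and
      \<open>fk2\<close>.\<close>
    moreover have "(LINT t:{0..}|lborel. mu 1 * fb2 (\<lambda>z _. k1 z) (\<lambda>z _. k2 z) (\<lambda>z. u z t) (\<lambda>z. v z t) * psi 1 t) = - (J u fk1 - J v fk2)"
    proof -
      have psi1: "mu 1 * psi 1 t = - x (tau + t)" for t
        using psi_eq[of 1 t] PQ1 mu_pos[of 1] by (simp add: Psi_def tau_def)
      have i3: "set_integrable lborel Strip (\<lambda>p. u (fst p) (snd p) * fk1 (fst p) (snd p) - v (fst p) (snd p) * fk2 (fst p) (snd p))"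
        by (intro set_integral_diff i1) auto
      have "J u fk1 - J v fk2 = (LINT p:Strip|lborel. u (fst p) (snd p) * fk1 (fst p) (snd p) - v (fst p) (snd p) * fk2 (fst p) (snd p))"
        unfolding J_def using set_integral_diff(2)[OF i1(1)[of fk1] i1(2)[of fk2]] by simp
      also have "\<dots> = (LINT t:{0..}|lborel. LINT w:Iv|lborel. u w t * fk1 w t - v w t * fk2 w t)"
        by (rule Strip_Fubini(1)[of "\<lambda>w t. u w t * fk1 w t - v w t * fk2 w t", OF i3])
      also have "\<dots> = (LINT t:{0..}|lborel. - (mu 1 * fb2 (\<lambda>z _. k1 z) (\<lambda>z _. k2 z) (\<lambda>z. u z t) (\<lambda>z. v z t) * psi 1 t))"
      proof (rule set_lebesgue_integral_cong, simp, intro allI impI)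
        fix t :: real assume t: "t \<in> {0..}"
        then have Lu: "L2_on (\<lambda>w. u w t)" "L2_on (\<lambda>w. v w t)" using L2 by (auto simp: L2_path_def)
        have bk: "\<exists>B. \<forall>z\<in>Iv. \<bar>k z\<bar> \<le> B" if "continuous_on UNIV k" for k :: "real \<Rightarrow> real"
        proof -
          have "bounded (k ` Iv)"
            by (intro compact_imp_bounded compact_continuous_image continuous_on_subset[OF that]) auto
          then show ?thesis unfolding bounded_iff by auto
        qed
        have su: "set_integrable lborel Iv (\<lambda>w. y w * k w)" if y: "L2_on y" and k: "continuous_on UNIV k" for y k
        proof -
          obtain B where "\<forall>z\<in>Iv. \<bar>k z\<bar> \<le> B" using bk[OF k] by blast
          then show ?thesis
            using borel_measurable_continuous_onI[OF k] by (intro set_integrable_bound_mult[OF L2_on_integrable[OF y]]) auto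
        qed
        have "(LINT w:Iv|lborel. u w t * fk1 w t - v w t * fk2 w t)
          = (LINT w:Iv|lborel. x (tau + t) * (u w t * k1 w + v w t * k2 w))"
          by (intro set_lebesgue_integral_cong) (auto simp: fk1_def fk2_def algebra_simps)
        also have "\<dots> = x (tau + t) * fb2 (\<lambda>z _. k1 z) (\<lambda>z _. k2 z) (\<lambda>z. u z t) (\<lambda>z. v z t)"
          using set_integral_add(2)[OF su[OF Lu(1) cont_k(1)] su[OF Lu(2) cont_k(2)]] by (simp add: fb2_def)
        also have "\<dots> = - ((mu 1 * psi 1 t) * fb2 (\<lambda>z _. k1 z) (\<lambda>z _. k2 z) (\<lambda>z. u z t) (\<lambda>z. v z t))"
          unfolding psi1 by simp
        finally show "(LINT w:Iv|lborel. u w t * fk1 w t - v w t * fk2 w t)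
          = - (mu 1 * fb2 (\<lambda>z _. k1 z) (\<lambda>z _. k2 z) (\<lambda>z. u z t) (\<lambda>z. v z t) * psi 1 t)"
          by (simp only: mult_ac)
      qed
      finally show ?thesis by (simp add: set_lebesgue_integral_def)
    qed
    moreover have "(LINT p:Strip|lborel. c (fst p) * u (fst p) (snd p) * psi (fst p) (snd p)) = J u (\<lambda>w t. - fK1 w t)"
      unfolding J_def by (rule Strip_cong) (simp add: psi_eq fK1_def K1_def)
    moreover have "J u (\<lambda>w t. - fK1 w t) = - J u fK1" by (simp add: J_def set_lebesgue_integral_def)
    moreover have "J v (\<lambda>w t. (fK2 w t + fG w t) + fk2 w t) = J v fK2 + J v fG + J v fk2"
      using Jadd[OF i12 i1(2)[of fk2]] Jadd[OF i1(2)[of fK2] i1(2)[of fG]] by simp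
    moreover have "psi (-1) t = 0" for t using psi_eq[of "-1" t] by (simp add: Psi_def x_def)
    ultimately show ?thesis using closed_loop_solution_weak(2)[OF sol psi] by simp
  qed
  \<comment> \<open>The coupling terms \<open>fK1\<close> and \<open>fK2\<close> occur in both
    identities and the defects \<open>fk1\<close> and \<open>fk2\<close> are cancelled by the
    feedback; only the sources remain.\<close>
  have "J v fG = J u fF" using E1 E2 by simp
  moreover have "J u fF = - (LINT p:Strip|lborel. u (fst p) (snd p) * (F0 (fst p) * avg e rho (snd p)))"
    by (simp add: J_def fF_def r_def set_lebesgue_integral_def)
  moreover have "J v fG = (LINT p:Strip|lborel. v (fst p) (snd p) * (G0 (fst p) * avg e rho (snd p)))"
    by (simp add: J_def fG_def r_def)
  ultimately show ?thesis by simp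
qed

text \<open>The pairing is continuous in time. Were it nonzero at \<open>t0\<close>, it would keep
  its sign nearby, and a nonnegative time weight supported there and positive at \<open>t0\<close>
  would give a nonzero space-time integral, against \<open>vanish_pairing\<close>.\<close>

lemma pairing_zero:
  assumes sol: "closed_loop_solution lam lam' mu mu' b c (fb1 (\<lambda>_ _. 0) (\<lambda>_ _. 0)) (fb2 (\<lambda>z _. k1 z) (\<lambda>z _. k2 z)) u0 v0 u v"
    and F0: "continuous_on UNIV F0" "\<And>s. \<bar>F0 s\<bar> \<le> 1" and G0: "continuous_on UNIV G0" "\<And>s. \<bar>G0 s\<bar> \<le> 1"
    and t0: "tau + sigma < t0"
  shows "(LINT w:Iv|lborel. u w t0 * F0 w) + (LINT w:Iv|lborel. v w t0 * G0 w) = 0"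
proof (rule ccontr)
  note L2 = closed_loop_solution_L2_path[OF sol]
  define H where "H t = (LINT w:Iv|lborel. u w t * F0 w) + (LINT w:Iv|lborel. v w t * G0 w)" for t
  assume "\<not> ?thesis"
  then have H0: "0 < H t0 * H t0" by (simp add: H_def zero_less_mult_iff) linarith
  have cH: "continuous_on {0..} H" unfolding H_def[abs_def]
    by (intro continuous_on_add L2_path_pairing_continuous[OF L2(1) F0] L2_path_pairing_continuous[OF L2(2) G0])
  have t0p: "0 < t0" using t0 sigma_tau_nonneg by linarith
  have "\<forall>\<^sub>F t in at t0 within {0..}. 0 < H t * H t0"
    using cH t0p H0 unfolding continuous_on_def
    by (intro order_tendstoD(1)[where y = "H t0 * H t0"] tendsto_mult tendsto_const) auto
  then obtain d0 where d0: "0 < d0" "\<And>t. 0 \<le> t \<Longrightarrow> t \<noteq> t0 \<Longrightarrow> dist t t0 < d0 \<Longrightarrow> 0 < H t * H t0"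
    unfolding eventually_at by auto
  \<comment> \<open>The bump \<open>rho\<close> of radius \<open>d\<close>, averaged over length
    \<open>d\<close>, lives in \<open>{t0 - d..t0 + 2 * d}\<close>. This must stay within
    \<open>d0\<close> of \<open>t0\<close>, and \<open>rho\<close> must start after
    \<open>tau + sigma\<close>.\<close>
  define d where "d = min (d0 / 3) (t0 - (tau + sigma)) / 2"
  have d: "0 < d" "2 * d < d0" "d < t0 - (tau + sigma)"
    using d0(1) t0 by (auto simp: d_def min_def field_simps)
  define rho where "rho t = max 0 (d - \<bar>t - t0\<bar>)" for t
  have crho: "continuous_on UNIV rho" unfolding rho_def[abs_def] by (intro continuous_intros)
  have rb: "\<bar>rho t\<bar> \<le> d" for t using d by (auto simp: rho_def)
  have rs: "\<forall>t. t < t0 - d \<or> t0 + d < t \<longrightarrow> rho t = 0" by (auto simp: rho_def)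
  define r where "r = avg d rho"
  have cr: "continuous_on UNIV r" unfolding r_def by (rule cont_avg[OF crho])
  have rnn: "0 \<le> r t" for t
  proof -
    have "rho integrable_on {t - d..t}"
      by (intro integrable_continuous_interval continuous_on_subset[OF crho]) simp
    then have "0 \<le> integral {t - d..t} rho"
      by (rule Henstock_Kurzweil_Integration.integral_nonneg) (simp add: rho_def)
    then show ?thesis using d by (simp add: r_def avg_def oint_le)
  qed
  have r0: "r t = 0" if "t < t0 - d \<or> t0 + 2 * d < t" for t
    unfolding r_def using that d by (intro avg_zero) (auto simp: rho_def)
  have rpos: "r t0 \<noteq> 0"
  proof
    assume "r t0 = 0"
    then have "integral {t0 - d..t0} rho = 0" using d by (simp add: r_def avg_def oint_le)
    moreover have "continuous_on {t0 - d..t0} rho" by (rule continuous_on_subset[OF crho]) simp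
    moreover have "0 \<le> rho x" for x by (simp add: rho_def)
    ultimately have "\<forall>x\<in>{t0 - d..t0}. rho x = 0"
      using integral_eq_0_iff[of "t0 - d" t0 rho] d(1) by simp
    then have "rho t0 = 0" using d by auto
    then show False using d by (simp add: rho_def)
  qed
  have Fi: "set_integrable lborel Strip (\<lambda>p. u (fst p) (snd p) * (F0 (fst p) * r (snd p)))"
    "set_integrable lborel Strip (\<lambda>p. v (fst p) (snd p) * (G0 (fst p) * r (snd p)))"
  proof -
    have c: "cont2 (\<lambda>w t. F0 w * r t)" "cont2 (\<lambda>w t. G0 w * r t)" unfolding cont2_def
      by (intro continuous_on_mult cont1_comp[OF F0(1)] cont1_comp[OF G0(1)] cont1_comp[OF cr] continuous_on_fst continuous_on_snd continuous_on_id)+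
    show "set_integrable lborel Strip (\<lambda>p. u (fst p) (snd p) * (F0 (fst p) * r (snd p)))"
      by (rule L2_path_integrable[OF L2(1) c(1), of "t0 + 2 * d"]) (simp add: r0)
    show "set_integrable lborel Strip (\<lambda>p. v (fst p) (snd p) * (G0 (fst p) * r (snd p)))"
      by (rule L2_path_integrable[OF L2(2) c(2), of "t0 + 2 * d"]) (simp add: r0)
  qed
  have "(LINT p:Strip|lborel. u (fst p) (snd p) * (F0 (fst p) * avg d rho (snd p)))
     + (LINT p:Strip|lborel. v (fst p) (snd p) * (G0 (fst p) * avg d rho (snd p))) = 0"
    using vanish_pairing[OF sol F0 G0 crho rb rs, of d] d by auto
  then have "0 = (LINT t:{0..}|lborel. LINT w:Iv|lborel. u w t * (F0 w * r t)) + (LINT t:{0..}|lborel. LINT w:Iv|lborel. v w t * (G0 w * r t))"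
    using Strip_Fubini(1)[of "\<lambda>w t. u w t * (F0 w * r t)", OF Fi(1)] Strip_Fubini(1)[of "\<lambda>w t. v w t * (G0 w * r t)", OF Fi(2)]
    by (simp add: r_def)
  also have "\<dots> = (LINT t:{0..}|lborel. (LINT w:Iv|lborel. u w t * (F0 w * r t)) + (LINT w:Iv|lborel. v w t * (G0 w * r t)))"
    using Strip_Fubini(2)[of "\<lambda>w t. u w t * (F0 w * r t)", OF Fi(1)] Strip_Fubini(2)[of "\<lambda>w t. v w t * (G0 w * r t)", OF Fi(2)]
    by (rule set_integral_add(2)[symmetric])
  also have "\<dots> = (LINT t:{0..}|lborel. r t * H t)"
  proof (intro set_lebesgue_integral_cong allI impI)
    fix t
    have "(LINT w:Iv|lborel. y w * (F w * r t)) = r t * (LINT w:Iv|lborel. y w * F w)" for y F :: "real \<Rightarrow> real"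
      by (subst set_integral_mult_right[symmetric]) (simp add: mult_ac)
    then show "(LINT w:Iv|lborel. u w t * (F0 w * r t)) + (LINT w:Iv|lborel. v w t * (G0 w * r t)) = r t * H t"
      by (simp only: H_def distrib_left)
  qed simp
  also have "\<dots> = (LINT t:{t0 - d..t0 + 2 * d}|lborel. r t * H t)"
    unfolding set_lebesgue_integral_def
    using r0 d t0 sigma_tau_nonneg by (intro Bochner_Integration.integral_cong) (auto simp: indicator_def)
  also have "\<dots> = integral {t0 - d..t0 + 2 * d} (\<lambda>t. r t * H t)"
  proof -
    have c: "continuous_on {t0 - d..t0 + 2 * d} (\<lambda>t. r t * H t)"
      using d t0 sigma_tau_nonneg
      by (intro continuous_on_mult continuous_on_subset[OF cr] continuous_on_subset[OF cH]) auto
    show ?thesis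
      by (rule set_borel_integral_eq_integral(2)[OF borel_integrable_atLeastAtMost'[OF c]])
  qed
  finally have I0: "integral {t0 - d..t0 + 2 * d} (\<lambda>t. r t * (H t * H t0)) = 0"
    by (simp flip: mult.assoc)
  have c: "continuous_on {t0 - d..t0 + 2 * d} (\<lambda>t. r t * (H t * H t0))"
    using d t0 sigma_tau_nonneg
    by (intro continuous_on_mult continuous_on_const continuous_on_subset[OF cr] continuous_on_subset[OF cH]) auto
  have nn: "0 \<le> r t * (H t * H t0)" if "t \<in> {t0 - d..t0 + 2 * d}" for t
  proof -
    have "0 < H t * H t0"
      using that d d0 H0 t0 sigma_tau_nonneg by (cases "t = t0") (auto simp: dist_real_def)
    then show ?thesis using rnn by simp
  qed
  have "\<forall>t\<in>{t0 - d..t0 + 2 * d}. r t * (H t * H t0) = 0"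
    using integral_eq_0_iff[OF c _ nn] I0 d by auto
  then have "r t0 * (H t0 * H t0) = 0" using d by auto
  then show False using rpos H0 by auto
qed

lemma closed_loop_extinction:
  assumes sol: "closed_loop_solution lam lam' mu mu' b c (fb1 (\<lambda>_ _. 0) (\<lambda>_ _. 0)) (fb2 (\<lambda>z _. k1 z) (\<lambda>z _. k2 z)) u0 v0 u v"
    and t: "tau + sigma < t"
  shows "AE w in lborel. w \<in> Iv \<longrightarrow> u w t = 0 \<and> v w t = 0"
proof -
  have t0: "0 \<le> t" using t sigma_tau_nonneg by linarith
  note L2 = closed_loop_solution_L2_path[OF sol]
  have L: "L2_on (\<lambda>w. u w t)" "L2_on (\<lambda>w. v w t)" using L2 t0 by (auto simp: L2_path_def)
  have z: "continuous_on UNIV (\<lambda>_. 0 :: real)" "\<And>s::real. \<bar>0::real\<bar> \<le> 1" by auto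
  have "AE w in lborel. w \<in> Iv \<longrightarrow> u w t = 0"
  proof (rule orthogonal_to_continuous[OF L(1)])
    fix g :: "real \<Rightarrow> real" assume "continuous_on UNIV g" "\<And>x. \<bar>g x\<bar> \<le> 1"
    from pairing_zero[OF sol this z t] show "(LINT w:Iv|lborel. u w t * g w) = 0" by simp
  qed
  moreover have "AE w in lborel. w \<in> Iv \<longrightarrow> v w t = 0"
  proof (rule orthogonal_to_continuous[OF L(2)])
    fix g :: "real \<Rightarrow> real" assume "continuous_on UNIV g" "\<And>x. \<bar>g x\<bar> \<le> 1"
    from pairing_zero[OF sol z this t] show "(LINT w:Iv|lborel. v w t * g w) = 0" by simp
  qed
  ultimately show ?thesis by eventually_elim auto
qed

end

section \<open>Substitutions and translations\<close>

text \<open>Substitution with a derivative bounded below by \<open>k\<close>. The bound does not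
  depend on the shift \<open>Q\<close>, hence is uniform over a whole family of
  characteristics.\<close>

lemma compose_integral_bound:
  fixes f :: "real \<Rightarrow> real"
  assumes f: "integrable lborel f" "\<And>x. 0 \<le> f x"
    and g: "\<And>w. (g has_real_derivative g' w) (at w)" "continuous_on UNIV g'" "\<And>w. k \<le> g' w" and k: "0 < k"
  shows "set_integrable lborel Iv (\<lambda>w. f (g w + Q))" "(LINT w:Iv|lborel. f (g w + Q)) \<le> (LINT x|lborel. f x) / k"
proof -
  have d: "((\<lambda>w. g w + Q) has_real_derivative g' w) (at w)" for w
    using DERIV_add[OF g(1) DERIV_const] by simp
  have c: "continuous_on {-1..1} g'" by (rule continuous_on_subset[OF g(2)]) simp
  have nn: "0 \<le> g' w" for w using g(3)[of w] k by linarith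
  have s: "set_integrable lborel {g (-1) + Q..g 1 + Q} f"
    unfolding set_integrable_def using f(1) by (intro integrable_mult_indicator) simp_all
  note S = integral_substitution[where g = "\<lambda>w. g w + Q" and a = "-1" and b = 1, OF s d c nn]
  have fm: "f \<in> borel_measurable borel" using f(1) by simp
  have cg: "continuous_on UNIV g" using g(1) by (auto simp: continuous_on_eq_continuous_at dest: DERIV_isCont)
  have gm: "g \<in> borel_measurable borel" by (rule borel_measurable_continuous_onI[OF cg])
  have m: "(\<lambda>w. f (g w + Q)) \<in> borel_measurable borel" using fm gm by measurable
  have i0: "set_integrable lborel Iv (\<lambda>w. f (g w + Q) * g' w)" using S(1) by simp
  have le: "f (g w + Q) \<le> (1 / k) * (f (g w + Q) * g' w)" for w
  proof -
    have "f (g w + Q) * k \<le> f (g w + Q) * g' w" using f(2) g(3) by (intro mult_left_mono)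
    then show ?thesis using k by (simp add: field_simps)
  qed
  have i1: "set_integrable lborel Iv (\<lambda>w. (1 / k) * (f (g w + Q) * g' w))"
    using i0 by simp
  show i2: "set_integrable lborel Iv (\<lambda>w. f (g w + Q))"
    unfolding set_integrable_def
  proof (rule Bochner_Integration.integrable_bound[OF i1[unfolded set_integrable_def]])
    show "(\<lambda>x. indicat_real Iv x *\<^sub>R f (g x + Q)) \<in> borel_measurable lborel" using m by simp
    show "AE x in lborel. norm (indicat_real Iv x *\<^sub>R f (g x + Q)) \<le> norm (indicat_real Iv x *\<^sub>R (1 / k * (f (g x + Q) * g' x)))"
    proof (rule AE_I2)
      fix x
      have "\<bar>f (g x + Q)\<bar> \<le> \<bar>1 / k * (f (g x + Q) * g' x)\<bar>" using le[of x] f(2)[of "g x + Q"] by linarith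
      then show "norm (indicat_real Iv x *\<^sub>R f (g x + Q)) \<le> norm (indicat_real Iv x *\<^sub>R (1 / k * (f (g x + Q) * g' x)))"
        by (cases "x \<in> Iv") (simp_all del: times_divide_eq_left)
    qed
  qed
  have "(LINT w:Iv|lborel. f (g w + Q)) \<le> (LINT w:Iv|lborel. (1 / k) * (f (g w + Q) * g' w))"
    by (rule set_integral_mono[OF i2 i1 le])
  also have "\<dots> = (1 / k) * (LINT w:Iv|lborel. f (g w + Q) * g' w)" by (rule set_integral_mult_right)
  also have "(LINT w:Iv|lborel. f (g w + Q) * g' w) = (LINT x|lborel. f x * indicator {g (-1) + Q..g 1 + Q} x)"
    using S(2) by (simp add: set_lebesgue_integral_def mult_ac)
  also have "\<dots> \<le> (LINT x|lborel. f x)"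
  proof (rule integral_mono)
    show "integrable lborel (\<lambda>x. f x * indicator {g (-1) + Q..g 1 + Q} x)"
      using s unfolding set_integrable_def by (simp add: mult.commute)
  qed (use f in \<open>auto simp: indicator_def\<close>)
  finally show "(LINT w:Iv|lborel. f (g w + Q)) \<le> (LINT x|lborel. f x) / k"
    using k by (simp add: divide_right_mono)
qed

text \<open>Controls the L1 and the L2 distance at once.\<close>

definition l12 :: "real \<Rightarrow> real" where "l12 x = \<bar>x\<bar> + x^2"

lemma l12_nonneg [simp]: "0 \<le> l12 x" by (simp add: l12_def)
lemma l12_add: "l12 (x + y) \<le> 2 * l12 x + 2 * l12 y"
proof -
  have "(x + y)^2 \<le> 2 * x^2 + 2 * y^2" using zero_le_power2[of "x - y"] by (simp add: power2_eq_square algebra_simps)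
  then show ?thesis using abs_triangle_ineq[of x y] by (simp add: l12_def)
qed
lemma l12_mono: "\<bar>x\<bar> \<le> y \<Longrightarrow> l12 x \<le> l12 y"
proof -
  assume "\<bar>x\<bar> \<le> y"
  then have "\<bar>x\<bar>^2 \<le> y^2" by (intro power_mono) auto
  with \<open>\<bar>x\<bar> \<le> y\<close> show ?thesis by (simp add: l12_def)
qed
lemma l12_tendsto: "f \<longlonglongrightarrow> 0 \<Longrightarrow> (\<lambda>n. l12 (f n)) \<longlonglongrightarrow> 0"
  unfolding l12_def by (rule tendsto_eq_intros refl | assumption)+ simp
lemma l12_measurable [measurable]: "l12 \<in> borel_measurable borel"
  unfolding l12_def[abs_def] by measurable

definition compact_L2 :: "real \<Rightarrow> (real \<Rightarrow> real) \<Rightarrow> bool" where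
  "compact_L2 R f \<longleftrightarrow> f \<in> borel_measurable borel \<and> integrable lborel (\<lambda>x. l12 (f x)) \<and> (\<forall>x. R < \<bar>x\<bar> \<longrightarrow> f x = 0)"

text \<open>Truncate in size, approximate the truncation by continuous functions, and cut these off
  outside the support. \<open>l12_add\<close> costs a factor 2 on each of the two errors, whence
  \<open>eps / 4\<close>.\<close>

lemma compact_L2_approx:
  assumes f: "compact_L2 R f" and eps: "0 < eps"
  shows "\<exists>g. continuous_on UNIV g \<and> (\<exists>B. \<forall>x. \<bar>g x\<bar> \<le> B) \<and> integrable lborel (\<lambda>x. l12 (f x - g x)) \<and> (LINT x|lborel. l12 (f x - g x)) < eps"
proof -
  have fm [measurable]: "f \<in> borel_measurable borel" and fi: "integrable lborel (\<lambda>x. l12 (f x))"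
    and fz: "\<And>x. R < \<bar>x\<bar> \<Longrightarrow> f x = 0" using f by (auto simp: compact_L2_def)
  define F where "F n x = max (- real n) (min (real n) (f x))" for n :: nat and x
  have Fm [measurable]: "F n \<in> borel_measurable borel" for n unfolding F_def[abs_def] by measurable
  have Fle: "\<bar>f x - F n x\<bar> \<le> \<bar>f x\<bar>" "\<bar>F n x\<bar> \<le> real n" for n x by (auto simp: F_def)
  have Fl: "(\<lambda>n. f x - F n x) \<longlonglongrightarrow> 0" for x
  proof (rule tendsto_eventually)
    obtain N :: nat where "\<bar>f x\<bar> \<le> real N" using real_arch_simple by blast
    then show "\<forall>\<^sub>F n in sequentially. f x - F n x = 0"
      unfolding eventually_sequentially by (intro exI[of _ N]) (auto simp: F_def)
  qed
  have "(\<lambda>n. LINT x|lborel. l12 (f x - F n x)) \<longlonglongrightarrow> (LINT x::real|lborel. (0::real))"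
  proof (rule integral_dominated_convergence[where s = "\<lambda>n x. l12 (f x - F n x)" and f = "\<lambda>_. 0 :: real" and w = "\<lambda>x. l12 (f x)"])
    show "AE x in lborel. (\<lambda>i. l12 (f x - F i x)) \<longlonglongrightarrow> 0" by (intro AE_I2 l12_tendsto Fl)
    show "AE x in lborel. norm (l12 (f x - F i x)) \<le> l12 (f x)" for i
    proof (rule AE_I2)
      fix x show "norm (l12 (f x - F i x)) \<le> l12 (f x)"
        using l12_mono[OF Fle(1)[of x i]] by (simp add: l12_def)
    qed
  qed (use fi in simp_all)
  then have "\<forall>\<^sub>F n in sequentially. (LINT x|lborel. l12 (f x - F n x)) < eps / 4"
    using eps by (intro order_tendstoD(2)) auto
  then obtain n where n: "(LINT x|lborel. l12 (f x - F n x)) < eps / 4"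
    by (auto simp: eventually_sequentially)
  have i1: "integrable lborel (\<lambda>x. l12 (f x - F n x))"
  proof (rule Bochner_Integration.integrable_bound[OF fi])
    show "AE x in lborel. norm (l12 (f x - F n x)) \<le> norm (l12 (f x))"
    proof (rule AE_I2)
      fix x show "norm (l12 (f x - F n x)) \<le> norm (l12 (f x))"
        using l12_mono[OF Fle(1)[of x n]] by (simp add: l12_def)
    qed
  qed simp
  have "F n \<in> borel_measurable lborel" by simp
  from approx_by_continuous[OF this Fle(2)] obtain h where hc: "\<And>k. continuous_on UNIV (h k)"
    and hb: "\<And>k x. \<bar>h k x\<bar> \<le> real n" and hl: "AE x in lborel. (\<lambda>k. h k x) \<longlonglongrightarrow> F n x" by blast
  \<comment> \<open>Equal to 1 where \<open>f\<close> may be nonzero, so the limit is unchanged, and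
    0 outside a bounded interval, which supplies an integrable majorant.\<close>
  define chi :: "real \<Rightarrow> real" where "chi x = max 0 (min 1 (\<bar>R\<bar> + 1 - \<bar>x\<bar>))" for x
  have chic: "continuous_on UNIV chi" unfolding chi_def[abs_def] by (intro continuous_intros)
  have chi1: "F n x * chi x = F n x" for x
    using fz[of x] by (cases "\<bar>x\<bar> \<le> \<bar>R\<bar>") (auto simp: chi_def F_def)
  have chib: "\<bar>chi x\<bar> \<le> indicator {-(\<bar>R\<bar>+1)..\<bar>R\<bar>+1} x" for x by (auto simp: chi_def indicator_def)
  define g where "g k x = h k x * chi x" for k x
  have gc: "continuous_on UNIV (g k)" for k unfolding g_def[abs_def] by (intro continuous_on_mult hc chic)
  have gm [measurable]: "g k \<in> borel_measurable borel" for k by (rule borel_measurable_continuous_onI[OF gc])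
  have gb: "\<bar>g k x\<bar> \<le> real n" for k x
  proof -
    have "\<bar>h k x\<bar> * \<bar>chi x\<bar> \<le> real n * 1" using hb chib[of x] by (intro mult_mono) (auto simp: chi_def)
    then show ?thesis by (simp add: g_def abs_mult)
  qed
  have dom: "l12 (F n x - g k x) \<le> l12 (2 * real n) * indicator {-(\<bar>R\<bar>+1)..\<bar>R\<bar>+1} x" for k x
  proof (cases "x \<in> {-(\<bar>R\<bar>+1)..\<bar>R\<bar>+1}")
    case True
    have "\<bar>F n x - g k x\<bar> \<le> 2 * real n" using Fle(2)[of n x] gb[of k x] by linarith
    from l12_mono[OF this] True show ?thesis by simp
  next
    case False
    then have "\<bar>R\<bar> + 1 < \<bar>x\<bar>" by auto
    then have "chi x = 0" "F n x = 0" using fz[of x] by (auto simp: chi_def F_def)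
    then show ?thesis by (simp add: g_def l12_def)
  qed
  have domi: "integrable lborel (\<lambda>x. l12 (2 * real n) * indicator {-(\<bar>R\<bar>+1)..\<bar>R\<bar>+1} x)"
    by (intro integrable_mult_right integrable_real_indicator) (auto simp: emeasure_lborel_Icc_eq)
  have "(\<lambda>k. LINT x|lborel. l12 (F n x - g k x)) \<longlonglongrightarrow> (LINT x::real|lborel. (0::real))"
  proof (rule integral_dominated_convergence[where s = "\<lambda>k x. l12 (F n x - g k x)" and f = "\<lambda>_. 0 :: real", OF _ _ domi])
    show "AE x in lborel. (\<lambda>k. l12 (F n x - g k x)) \<longlonglongrightarrow> 0"
      using hl
    proof eventually_elim
      case (elim x)
      have "(\<lambda>k. F n x - h k x * chi x) \<longlonglongrightarrow> F n x - F n x * chi x" by (intro tendsto_intros elim)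
      then show ?case by (intro l12_tendsto) (simp add: g_def chi1)
    qed
    show "AE x in lborel. norm (l12 (F n x - g k x)) \<le> l12 (2 * real n) * indicator {-(\<bar>R\<bar>+1)..\<bar>R\<bar>+1} x" for k
      using dom by (intro AE_I2) simp
  qed simp_all
  then have "\<forall>\<^sub>F k in sequentially. (LINT x|lborel. l12 (F n x - g k x)) < eps / 4"
    using eps by (intro order_tendstoD(2)) auto
  then obtain k where k: "(LINT x|lborel. l12 (F n x - g k x)) < eps / 4"
    by (auto simp: eventually_sequentially)
  have i2: "integrable lborel (\<lambda>x. l12 (F n x - g k x))"
    by (rule Bochner_Integration.integrable_bound[OF domi]) (use dom in \<open>auto intro!: AE_I2 intro: order_trans\<close>)
  have i3: "integrable lborel (\<lambda>x. 2 * l12 (f x - F n x) + 2 * l12 (F n x - g k x))"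
    by (intro Bochner_Integration.integrable_add integrable_mult_right i1 i2)
  have le: "l12 (f x - g k x) \<le> 2 * l12 (f x - F n x) + 2 * l12 (F n x - g k x)" for x
    using l12_add[of "f x - F n x" "F n x - g k x"] by simp
  have i4: "integrable lborel (\<lambda>x. l12 (f x - g k x))"
    by (rule Bochner_Integration.integrable_bound[OF i3]) (use le in \<open>auto intro!: AE_I2\<close>)
  have "(LINT x|lborel. l12 (f x - g k x)) \<le> (LINT x|lborel. 2 * l12 (f x - F n x) + 2 * l12 (F n x - g k x))"
    by (rule integral_mono[OF i4 i3 le])
  also have "\<dots> = 2 * (LINT x|lborel. l12 (f x - F n x)) + 2 * (LINT x|lborel. l12 (F n x - g k x))"
    using i1 i2 by simp
  also have "\<dots> < eps" using n k by simp
  finally show ?thesis using gc gb i4 by blast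
qed

lemma LINT_le_LINT_Iv:
  fixes f :: "real \<Rightarrow> real"
  assumes f: "set_integrable lborel Iv f" and nn: "\<And>w. 0 \<le> f w" and A: "A \<in> sets lborel" "A \<subseteq> Iv"
  shows "(LINT w:A|lborel. f w) \<le> (LINT w:Iv|lborel. f w)" "set_integrable lborel A f"
proof -
  show i: "set_integrable lborel A f" by (rule set_integrable_subset[OF f A])
  show "(LINT w:A|lborel. f w) \<le> (LINT w:Iv|lborel. f w)"
    unfolding set_lebesgue_integral_def
    using i f A nn unfolding set_integrable_def by (intro integral_mono) (auto simp: indicator_def)
qed

locale speed =
  fixes g g' :: "real \<Rightarrow> real" and k :: real
  assumes g: "\<And>w. (g has_real_derivative g' w) (at w)" and g'_cont: "continuous_on UNIV g'"
    and g'_ge: "\<And>w. k \<le> g' w" and k: "0 < k"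
begin

lemma cont_g: "continuous_on UNIV g" using g by (auto simp: continuous_on_eq_continuous_at dest: DERIV_isCont)

lemma source_bound:
  assumes f: "compact_L2 R f" and q: "continuous_on UNIV q" "\<And>s. s \<in> Iv \<Longrightarrow> \<bar>q s\<bar> \<le> B" and lr: "-1 \<le> l" "r \<le> 1"
  shows "set_integrable lborel {l..r} (\<lambda>s. q s * f (g s + Q))"
    "\<bar>LINT s:{l..r}|lborel. q s * f (g s + Q)\<bar> \<le> B * ((LINT x|lborel. l12 (f x)) / k)"
proof -
  have fm [measurable]: "f \<in> borel_measurable borel" and fi: "integrable lborel (\<lambda>x. l12 (f x))"
    using f by (auto simp: compact_L2_def)
  have gm [measurable]: "g \<in> borel_measurable borel" "q \<in> borel_measurable borel"
    by (rule borel_measurable_continuous_onI[OF cont_g], rule borel_measurable_continuous_onI[OF q(1)])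
  have B: "0 \<le> B" using q(2)[of 0] by simp
  note cb = compose_integral_bound[OF fi l12_nonneg g g'_cont g'_ge k, of Q]
  note cb' = LINT_le_LINT_Iv[OF cb(1) l12_nonneg, of "{l..r}"]
  have sub: "{l..r} \<subseteq> Iv" "{l..r} \<in> sets lborel" using lr by auto
  have i0: "set_integrable lborel {l..r} (\<lambda>s. B * l12 (f (g s + Q)))"
    using cb'(2) sub by simp
  have le: "\<bar>q s * f (g s + Q)\<bar> \<le> B * l12 (f (g s + Q))" if "s \<in> {l..r}" for s
  proof -
    have "\<bar>q s\<bar> * \<bar>f (g s + Q)\<bar> \<le> B * l12 (f (g s + Q))"
      using q(2)[of s] that sub B by (intro mult_mono) (auto simp: l12_def)
    then show ?thesis by (simp add: abs_mult)
  qed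
  show i1: "set_integrable lborel {l..r} (\<lambda>s. q s * f (g s + Q))"
    unfolding set_integrable_def
  proof (rule Bochner_Integration.integrable_bound[OF i0[unfolded set_integrable_def]])
    show "(\<lambda>x. indicat_real {l..r} x *\<^sub>R (q x * f (g x + Q))) \<in> borel_measurable lborel" by simp
    show "AE x in lborel. norm (indicat_real {l..r} x *\<^sub>R (q x * f (g x + Q))) \<le> norm (indicat_real {l..r} x *\<^sub>R (B * l12 (f (g x + Q))))"
    proof (rule AE_I2)
      fix x show "norm (indicat_real {l..r} x *\<^sub>R (q x * f (g x + Q))) \<le> norm (indicat_real {l..r} x *\<^sub>R (B * l12 (f (g x + Q))))"
        using le[of x] by (cases "x \<in> {l..r}") auto
    qed
  qed
  have "\<bar>LINT s:{l..r}|lborel. q s * f (g s + Q)\<bar> \<le> (LINT s:{l..r}|lborel. \<bar>q s * f (g s + Q)\<bar>)"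
    using set_integral_norm_bound[OF i1] by simp
  also have "\<dots> \<le> (LINT s:{l..r}|lborel. B * l12 (f (g s + Q)))"
    using le set_integrable_abs[OF i1] i0 unfolding set_lebesgue_integral_def set_integrable_def
    by (intro integral_mono) (auto simp: indicator_def)
  also have "\<dots> = B * (LINT s:{l..r}|lborel. l12 (f (g s + Q)))" by (rule set_integral_mult_right)
  also have "\<dots> \<le> B * ((LINT x|lborel. l12 (f x)) / k)"
    using order_trans[OF cb'(1) cb(2)] sub B by (intro mult_left_mono) auto
  finally show "\<bar>LINT s:{l..r}|lborel. q s * f (g s + Q)\<bar> \<le> B * ((LINT x|lborel. l12 (f x)) / k)" .
qed

text \<open>Integrating rough data along a characteristic smooths it: approximating \<open>f\<close>
  by continuous functions makes the integral a limit of continuous functions, uniformly over all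
  limits and shifts. This allows the remainder of the state to be sought among continuous
  functions.\<close>

lemma source_continuous:
  assumes f: "compact_L2 R f" and q: "continuous_on UNIV q" and lr: "\<And>x y. -1 \<le> l x y" "\<And>x y. r x y \<le> 1" "\<And>x y. l x y \<le> r x y"
    and c: "cont2 l" "cont2 r" "cont2 Q"
  shows "cont2 (\<lambda>x y. LINT s:{l x y..r x y}|lborel. q s * f (g s + Q x y))"
proof -
  have "bounded (q ` Iv)"
    by (intro compact_imp_bounded compact_continuous_image continuous_on_subset[OF q]) auto
  then obtain B where "\<forall>s\<in>Iv. \<bar>q s\<bar> \<le> B" unfolding bounded_iff by auto
  then have B: "\<And>s. s \<in> Iv \<Longrightarrow> \<bar>q s\<bar> \<le> B" by blast
  have B0: "0 \<le> B" using B[of 0] by simp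
  have fm: "f \<in> borel_measurable borel" and fz: "\<And>x. R < \<bar>x\<bar> \<Longrightarrow> f x = 0" using f by (auto simp: compact_L2_def)
  have ap: "\<exists>h. cont2 h \<and> (\<forall>x y. \<bar>(LINT s:{l x y..r x y}|lborel. q s * f (g s + Q x y)) - h x y\<bar> < e)" if e: "0 < e" for e
  proof -
    \<comment> \<open>Makes the error \<open>B * (d / k)\<close> smaller than \<open>e\<close>; the
      summand 1 covers \<open>B = 0\<close>.\<close>
    define d where "d = e * k / (B + 1)"
    have d: "0 < d" using e k B0 by (simp add: d_def)
    obtain f1 where f1: "continuous_on UNIV f1" "integrable lborel (\<lambda>x. l12 (f x - f1 x))" "(LINT x|lborel. l12 (f x - f1 x)) < d"
      using compact_L2_approx[OF f d] by blast
    define h where "h x y = oint (\<lambda>s. q s * f1 (g s + Q x y)) (l x y) (r x y)" for x y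
    have ch: "cont2 h" unfolding h_def[abs_def]
      by (intro cont2_oint c continuous_on_mult cont1_comp[OF q] cont1_comp[OF f1(1)] continuous_on_add cont1_comp[OF cont_g] cont2_comp[OF c(3)]
          continuous_on_fst continuous_on_snd continuous_on_id)
    have "\<bar>(LINT s:{l x y..r x y}|lborel. q s * f (g s + Q x y)) - h x y\<bar> < e" for x y
    proof -
      have ci: "continuous_on {l x y..r x y} (\<lambda>s. q s * f1 (g s + Q x y))"
        by (intro continuous_on_mult cont1_comp[OF q] cont1_comp[OF f1(1)] continuous_on_add cont1_comp[OF cont_g] continuous_on_id continuous_on_const)
      have i1: "set_integrable lborel {l x y..r x y} (\<lambda>s. q s * f1 (g s + Q x y))"
        by (rule borel_integrable_atLeastAtMost'[OF ci])
      have h: "h x y = (LINT s:{l x y..r x y}|lborel. q s * f1 (g s + Q x y))"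
        using set_borel_integral_eq_integral(2)[OF i1] lr(3) by (simp add: h_def oint_le)
      have i2: "set_integrable lborel {l x y..r x y} (\<lambda>s. q s * f (g s + Q x y))"
        by (rule source_bound(1)[OF f q B lr(1,2)])
      have f1m: "f1 \<in> borel_measurable borel" by (rule borel_measurable_continuous_onI[OF f1(1)])
      define f2 where "f2 x = f x - f1 x" for x
      have "\<bar>(LINT s:{l x y..r x y}|lborel. q s * f (g s + Q x y)) - h x y\<bar>
          = \<bar>LINT s:{l x y..r x y}|lborel. q s * f2 (g s + Q x y)\<bar>"
        unfolding h set_integral_diff(2)[OF i2 i1, symmetric] f2_def by (simp add: right_diff_distrib)
      also have "\<dots> \<le> B * ((LINT x|lborel. l12 (f2 x)) / k)"
      proof -
        have i3: "set_integrable lborel {l x y..r x y} (\<lambda>s. q s * f2 (g s + Q x y))"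
          using set_integral_diff(1)[OF i2 i1] unfolding f2_def by (simp add: right_diff_distrib)
        note cb = compose_integral_bound[OF f1(2) l12_nonneg g g'_cont g'_ge k, of "Q x y", folded f2_def]
        note cb' = LINT_le_LINT_Iv[OF cb(1) l12_nonneg, of "{l x y..r x y}"]
        have sub: "{l x y..r x y} \<subseteq> Iv" "{l x y..r x y} \<in> sets lborel" using lr(1,2)[of x y] by auto
        have "\<bar>LINT s:{l x y..r x y}|lborel. q s * f2 (g s + Q x y)\<bar> \<le> (LINT s:{l x y..r x y}|lborel. \<bar>q s * f2 (g s + Q x y)\<bar>)"
          using set_integral_norm_bound[OF i3] by simp
        also have "\<dots> \<le> (LINT s:{l x y..r x y}|lborel. B * l12 (f2 (g s + Q x y)))"
        proof -
          have "\<bar>q s * f2 z\<bar> \<le> B * l12 (f2 z)" if "s \<in> {l x y..r x y}" for s z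
            unfolding abs_mult using B[of s] that sub B0 by (intro mult_mono) (auto simp: l12_def)
          moreover have "set_integrable lborel {l x y..r x y} (\<lambda>s. B * l12 (f2 (g s + Q x y)))"
            using cb'(2) sub by simp
          ultimately show ?thesis
            using set_integrable_abs[OF i3] unfolding set_lebesgue_integral_def set_integrable_def
            by (intro integral_mono) (auto simp: indicator_def)
        qed
        also have "\<dots> = B * (LINT s:{l x y..r x y}|lborel. l12 (f2 (g s + Q x y)))" by (rule set_integral_mult_right)
        also have "\<dots> \<le> B * ((LINT x|lborel. l12 (f2 x)) / k)"
          using order_trans[OF cb'(1) cb(2)] sub B0 by (intro mult_left_mono) auto
        finally show ?thesis .
      qed
      also have "\<dots> \<le> B * (d / k)"
        using f1(3) B0 k unfolding f2_def by (intro mult_left_mono divide_right_mono) auto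
      also have "d / k = e / (B + 1)" using k by (simp add: d_def)
      also have "B * (e / (B + 1)) = B / (B + 1) * e" by simp
      also have "\<dots> < 1 * e" using B0 e by (intro mult_strict_right_mono) auto
      finally show ?thesis by simp
    qed
    then show ?thesis using ch by blast
  qed
  define S where "S p = (LINT s:{l (fst p) (snd p)..r (fst p) (snd p)}|lborel. q s * f (g s + Q (fst p) (snd p)))" for p
  have "\<exists>h. \<forall>n. continuous_on UNIV (h n) \<and> (\<forall>p. \<bar>S p - h n p\<bar> < 1 / real (Suc n))"
  proof (rule choice, rule allI)
    fix n
    obtain h where "cont2 h" "\<forall>x y. \<bar>(LINT s:{l x y..r x y}|lborel. q s * f (g s + Q x y)) - h x y\<bar> < 1 / real (Suc n)"
      using ap[of "1 / real (Suc n)"] by auto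
    then show "\<exists>h. continuous_on UNIV h \<and> (\<forall>p. \<bar>S p - h p\<bar> < 1 / real (Suc n))"
      by (intro exI[of _ "\<lambda>p. h (fst p) (snd p)"]) (simp add: cont2_def S_def)
  qed
  then obtain h where h: "\<And>n. continuous_on UNIV (h n)" "\<And>n p. \<bar>S p - h n p\<bar> < 1 / real (Suc n)" by blast
  have "continuous_on UNIV S"
  proof (rule uniform_limit_theorem[where f = h and F = sequentially])
    show "\<forall>\<^sub>F n in sequentially. continuous_on UNIV (h n)" using h(1) by simp
    show "uniform_limit UNIV h S sequentially"
    proof (rule uniform_limitI)
      fix e :: real assume "0 < e"
      then obtain N where N: "1 / real (Suc N) < e" using reals_Archimedean by (auto simp: inverse_eq_divide)
      have "dist (h n p) (S p) < e" if "N \<le> n" for n p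
      proof -
        have "1 / real (Suc n) \<le> 1 / real (Suc N)" using that by (simp add: frac_le)
        then show ?thesis using h(2)[of p n] N by (simp add: dist_real_def abs_minus_commute)
      qed
      then show "\<forall>\<^sub>F n in sequentially. \<forall>p\<in>UNIV. dist (h n p) (S p) < e"
        unfolding eventually_sequentially by blast
    qed
  qed simp
  then show ?thesis unfolding cont2_def S_def .
qed

text \<open>Continuity of translation in L2, seen through the map \<open>g\<close>: the rough
  difference is compared with that of a continuous approximation, for which uniform continuity
  suffices.\<close>

lemma translation_continuous:
  fixes th :: "real \<Rightarrow> real"
  assumes f: "compact_L2 R f" and th: "continuous_on UNIV th"
  shows "((\<lambda>t. LINT w:Iv|lborel. (f (g w + th t) - f (g w + th t0))^2) \<longlongrightarrow> 0) (at t0 within T)"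
proof (rule tendstoI)
  fix e :: real assume e: "0 < e"
  \<comment> \<open>Three error terms, each with factor 4 from the square of a sum, may contribute
    \<open>e / 3\<close> each.\<close>
  define d where "d = e * k / 12"
  have d: "0 < d" using e k by (simp add: d_def)
  obtain f1 where f1: "continuous_on UNIV f1" "integrable lborel (\<lambda>x. l12 (f x - f1 x))" "(LINT x|lborel. l12 (f x - f1 x)) < d"
    using compact_L2_approx[OF f d] by blast
  define I1 where "I1 t = (LINT w:Iv|lborel. (f1 (g w + th t) - f1 (g w + th t0))^2)" for t
  have cc: "continuous_on S (\<lambda>w. (f1 (g w + th t) - f1 (g w + th t0))^2)" for S t
    by (intro continuous_intros cont1_comp[OF f1(1)] cont1_comp[OF cont_g])
  have ii: "set_integrable lborel Iv (\<lambda>w. (f1 (g w + th t) - f1 (g w + th t0))^2)" for t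
    by (rule borel_integrable_atLeastAtMost'[OF cc])
  have I1: "I1 t = integral (cbox (-1) 1) (\<lambda>w. (f1 (g w + th t) - f1 (g w + th t0))^2)" for t
    unfolding I1_def using set_borel_integral_eq_integral(2)[OF ii] by simp
  have "continuous_on UNIV I1" unfolding I1[abs_def]
    by (rule integral_continuous_on_param) (unfold case_prod_unfold, intro continuous_intros cont1_comp[OF f1(1)] cont1_comp[OF cont_g] cont1_comp[OF th])
  then have "(I1 \<longlongrightarrow> I1 t0) (at t0 within T)"
    by (metis UNIV_I continuous_on_def tendsto_within_subset top_greatest)
  moreover have "I1 t0 = 0" by (simp add: I1_def set_lebesgue_integral_def)
  ultimately have "\<forall>\<^sub>F t in at t0 within T. I1 t < e / 12"
    using e by (intro order_tendstoD(2)[where y = 0]) auto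
  then show "\<forall>\<^sub>F t in at t0 within T. dist (LINT w:Iv|lborel. (f (g w + th t) - f (g w + th t0))^2) 0 < e"
  proof eventually_elim
    case (elim t)
    note cb = compose_integral_bound[OF f1(2) l12_nonneg g g'_cont g'_ge k]
    have fm [measurable]: "f \<in> borel_measurable borel" using f by (simp add: compact_L2_def)
    have gm [measurable]: "g \<in> borel_measurable borel" by (rule borel_measurable_continuous_onI[OF cont_g])
    let ?D = "\<lambda>w. (f (g w + th t) - f (g w + th t0))^2"
    let ?E = "\<lambda>w. 4 * l12 (f (g w + th t) - f1 (g w + th t)) + 4 * l12 (f (g w + th t0) - f1 (g w + th t0))
        + 4 * (f1 (g w + th t) - f1 (g w + th t0))^2"
    have le: "?D w \<le> ?E w" for w
    proof -
      have "(x - y)^2 \<le> 4 * l12 (x - x1) + 4 * l12 (y - y1) + 4 * (x1 - y1)^2" for x y x1 y1 :: real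
      proof -
        have 1: "(p + q + r)^2 \<le> 4 * p^2 + 4 * q^2 + 4 * r^2" for p q r :: real
          using zero_le_power2[of "p - q"] zero_le_power2[of "q - r"] zero_le_power2[of "p - r"]
            zero_le_power2[of p] zero_le_power2[of q] zero_le_power2[of r]
          unfolding power2_eq_square by (simp only: algebra_simps)
        have "(x - y)^2 \<le> 4 * (x - x1)^2 + 4 * (y1 - y)^2 + 4 * (x1 - y1)^2"
          using 1[of "x - x1" "y1 - y" "x1 - y1"] by simp
        moreover have "X \<le> 4 * (p + A) + 4 * (q + B) + 4 * C"
          if "X \<le> 4 * A + 4 * B + 4 * C" "0 \<le> p" "0 \<le> q" for X A B C p q :: real
          using that by simp
        ultimately show ?thesis unfolding l12_def power2_commute[of y1 y] by (simp only: abs_ge_zero)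
      qed
      then show ?thesis .
    qed
    have iE: "set_integrable lborel Iv ?E"
      by (intro set_integral_add set_integrable_mult_right cb ii)
    have iD: "set_integrable lborel Iv ?D"
      unfolding set_integrable_def
    proof (rule Bochner_Integration.integrable_bound[OF iE[unfolded set_integrable_def]])
      show "(\<lambda>x. indicat_real Iv x *\<^sub>R ?D x) \<in> borel_measurable lborel" by simp
      show "AE x in lborel. norm (indicat_real Iv x *\<^sub>R ?D x) \<le> norm (indicat_real Iv x *\<^sub>R ?E x)"
      proof (rule AE_I2)
        fix x
        have "\<bar>?D x\<bar> \<le> \<bar>?E x\<bar>" using le[of x] zero_le_power2[of "f (g x + th t) - f (g x + th t0)"] by linarith
        then show "norm (indicat_real Iv x *\<^sub>R ?D x) \<le> norm (indicat_real Iv x *\<^sub>R ?E x)"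
          by (cases "x \<in> Iv") simp_all
      qed
    qed
    have "(LINT w:Iv|lborel. ?D w) \<le> (LINT w:Iv|lborel. ?E w)"
      by (rule set_integral_mono[OF iD iE le])
    also have "\<dots> = 4 * (LINT w:Iv|lborel. l12 (f (g w + th t) - f1 (g w + th t))) + 4 * (LINT w:Iv|lborel. l12 (f (g w + th t0) - f1 (g w + th t0)))
        + 4 * I1 t"
      unfolding I1_def
      by (subst set_integral_add(2), (intro set_integral_add set_integrable_mult_right cb ii)+)
         (subst set_integral_add(2), (intro set_integrable_mult_right cb)+, simp)
    also have "\<dots> \<le> 4 * ((LINT x|lborel. l12 (f x - f1 x)) / k) + 4 * ((LINT x|lborel. l12 (f x - f1 x)) / k) + 4 * I1 t"
      using cb(2)[of "th t"] cb(2)[of "th t0"] by linarith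
    also have "\<dots> < 4 * (d / k) + 4 * (d / k) + 4 * (e / 12)"
      using elim f1(3) k by (intro add_strict_mono mult_strict_left_mono divide_strict_right_mono) auto
    also have "\<dots> = e" using k by (simp add: d_def)
    finally have "(LINT w:Iv|lborel. ?D w) < e" .
    moreover have "0 \<le> (LINT w:Iv|lborel. ?D w)"
      unfolding set_lebesgue_integral_def by (intro Bochner_Integration.integral_nonneg) auto
    ultimately show ?case by (simp add: dist_real_def)
  qed
qed

end

section \<open>The closed loop along characteristics\<close>

context hyp_system begin

sublocale sa: speed a "\<lambda>w. 1 / lam w" "1 / L0"
  by unfold_locales (auto intro: a_deriv cont_inv_speed iL0 frac_le lam_pos lam_bds L0)
sublocale sm: speed m "\<lambda>w. 1 / mu w" "1 / L0"
  by unfold_locales (auto intro: m_deriv cont_inv_speed iL0 frac_le mu_pos mu_bds L0)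
text \<open>Data carried along one family and integrated along a characteristic of the other are
  sampled through \<open>a s + m s\<close>.\<close>

sublocale sn: speed n "\<lambda>w. 1 / lam w + 1 / mu w" "1 / L0"
proof unfold_locales
  show "1 / L0 \<le> 1 / lam w + 1 / mu w" for w
    using sa.g'_ge[of w] mu_pos[of w] by (simp add: add_increasing2)
qed (auto intro: n_deriv continuous_on_add cont_inv_speed iL0 L0)

lemma LINT_split_continuous:
  fixes F G :: "real \<Rightarrow> real"
  assumes F: "set_integrable lborel {l..r} F" and G: "continuous_on UNIV G" and lr: "l \<le> r"
  shows "(LINT s:{l..r}|lborel. F s + G s) = (LINT s:{l..r}|lborel. F s) + oint G l r"
proof -
  have i: "set_integrable lborel {l..r} G"
    by (rule borel_integrable_atLeastAtMost'[OF continuous_on_subset[OF G]]) simp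
  show ?thesis
    using set_integral_add(2)[OF F i] set_borel_integral_eq_integral(2)[OF i] lr by (simp add: oint_le)
qed

lemma compact_L2_reflect: "compact_L2 R f \<Longrightarrow> compact_L2 R (\<lambda>x. f (- x))"
  unfolding compact_L2_def
  using lborel_integrable_real_affine[of "\<lambda>x. l12 (f x)" "-1" 0] by (auto intro: measurable_compose[rotated])

text \<open>Where the \<open>u\<close>-characteristic through \<open>(w, t)\<close> starts: on the
  initial line if \<open>a w > t\<close>, otherwise at the boundary point \<open>-1\<close>; the
  maximum with 0 makes the distinction. \<open>exit_m\<close> is the analogue for \<open>v\<close>
  and the boundary point 1.\<close>

definition enter_a where "enter_a w t = inv a (max 0 (a w - t))"
definition exit_m where "exit_m w t = inv m (min tau (m w + t))"

lemma enter_a_props: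
  assumes "-1 \<le> w" "w \<le> 1" "0 \<le> t"
  shows "-1 \<le> enter_a w t" "enter_a w t \<le> w" "enter_a w t \<le> s \<longleftrightarrow> -1 \<le> s \<and> 0 \<le> t - a w + a s"
proof -
  have e: "enter_a w t \<le> s \<longleftrightarrow> max 0 (a w - t) \<le> a s" for s
    unfolding enter_a_def using a_homeo(4)[of "inv a (max 0 (a w - t))" s] by (simp add: a_homeo(1))
  have 0: "0 \<le> a s \<longleftrightarrow> -1 \<le> s" for s using a_homeo(4)[of "-1" s] by simp
  show "enter_a w t \<le> s \<longleftrightarrow> -1 \<le> s \<and> 0 \<le> t - a w + a s" unfolding e using 0[of s] by auto
  show "enter_a w t \<le> w" unfolding e using am_range[OF assms(1,2)] assms(3) by simp
  have "a (-1) \<le> a (enter_a w t)" by (simp add: enter_a_def a_homeo(1))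
  then show "-1 \<le> enter_a w t" using a_homeo(4) by blast
qed

lemma exit_m_props:
  assumes "-1 \<le> w" "w \<le> 1" "0 \<le> t"
  shows "w \<le> exit_m w t" "exit_m w t \<le> 1" "s \<le> exit_m w t \<longleftrightarrow> s \<le> 1 \<and> 0 \<le> t + m w - m s"
proof -
  have e: "s \<le> exit_m w t \<longleftrightarrow> m s \<le> min tau (m w + t)" for s
    unfolding exit_m_def using m_homeo(4)[of s "inv m (min tau (m w + t))"] by (simp add: m_homeo(1))
  have 0: "m s \<le> tau \<longleftrightarrow> s \<le> 1" for s using m_homeo(4)[of s 1] by (simp add: tau_def)
  show "s \<le> exit_m w t \<longleftrightarrow> s \<le> 1 \<and> 0 \<le> t + m w - m s" unfolding e using 0[of s] by auto
  show "w \<le> exit_m w t" unfolding e using am_range[OF assms(1,2)] assms(3) by simp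
  have "m (exit_m w t) \<le> m 1" by (simp add: exit_m_def m_homeo(1) tau_def)
  then show "exit_m w t \<le> 1" using m_homeo(4) by blast
qed

text \<open>\<open>h\<close> is the feedback. Its initial value \<open>h0\<close> is split off and moved into the initial data \<open>r\<close>, so that what remains is
  continuous across the characteristic through the corner \<open>(1,0)\<close>.\<close>

lemma closed_loop_fixed_point:
  fixes k1 k2 p r :: "real \<Rightarrow> real" and h0 :: real
  assumes kc: "continuous_on UNIV k1" "continuous_on UNIV k2" and p: "compact_L2 Rp p" and r: "compact_L2 Rr r"
  shows "\<exists>A B h. cont2 A \<and> cont2 B \<and> continuous_on UNIV h \<and>
    (\<forall>w t. -1 \<le> w \<longrightarrow> w \<le> 1 \<longrightarrow> 0 \<le> t \<longrightarrow>
      A w t = (LINT s:{enter_a w t..w}|lborel. K2 s * (r (tau - m s - (t - a w + a s)) +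
          (h0 + (h (max 0 (t - a w + a s - tau + m s)) - h 0) + B s (t - a w + a s)))) \<and>
      B w t = (LINT s:{w..exit_m w t}|lborel. K1 s * (p (a s - (t + m w - m s)) + A s (t + m w - m s))) \<and>
      h t = (LINT s:Iv|lborel. k1 s * (p (a s - t) + A s t)) +
            (LINT s:Iv|lborel. k2 s * (r (tau - m s - t) + (h0 + (h (max 0 (t - tau + m s)) - h 0) + B s t))))"
proof -
  \<comment> \<open>Reflection turns the argument \<open>tau - m s - t\<close>, decreasing in
    \<open>s\<close>, into an increasing one, as the estimates for increasing maps demand.\<close>
  define rr where "rr x = r (- x)" for x
  have rr: "compact_L2 Rr rr" unfolding rr_def[abs_def] by (rule compact_L2_reflect[OF r])
  have "bounded (k1 ` Iv)" "bounded (k2 ` Iv)"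
    by (intro compact_imp_bounded compact_continuous_image continuous_on_subset[OF kc(1)] continuous_on_subset[OF kc(2)]; simp)+
  then obtain B1 B2 where "\<forall>s\<in>Iv. \<bar>k1 s\<bar> \<le> B1" "\<forall>s\<in>Iv. \<bar>k2 s\<bar> \<le> B2" unfolding bounded_iff by auto
  define Kc where "Kc = KB + \<bar>B1\<bar> + \<bar>B2\<bar>"
  have Kc: "0 < Kc" "\<bar>K1 s\<bar> \<le> Kc" "\<bar>K2 s\<bar> \<le> Kc" for s
    using KB(1) KB(2)[of s] KB(3)[of s] by (auto simp: Kc_def)
  have kB: "\<bar>k1 s\<bar> \<le> Kc" "\<bar>k2 s\<bar> \<le> Kc" if "s \<in> Iv" for s
    using \<open>\<forall>s\<in>Iv. \<bar>k1 s\<bar> \<le> B1\<close> \<open>\<forall>s\<in>Iv. \<bar>k2 s\<bar> \<le> B2\<close> that KB(1) by (fastforce simp: Kc_def)+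
  \<comment> \<open>The feedback depends on \<open>A\<close> and \<open>B\<close> at the current
    instant, where an exponential weight in time gives no smallness; the weight \<open>MM\<close> on
    the third component does, as \<open>4 * Kc \<le> MM / 12\<close>. Then \<open>N\<close> is so
    large that every integral along a characteristic, and the delayed feedback, costs at most 1/24.
    The resulting factor 1/6 is below 1/3, as three components require.\<close>
  define MM where "MM = 48 * Kc + 1"
  define N where "N = 24 * Kc * (1 + 2 * MM) * L0"
  have MM: "1 \<le> MM" "48 * Kc \<le> MM" using Kc(1) by (auto simp: MM_def)
  have Np: "0 < N" using Kc(1) MM L0 by (simp add: N_def)
  define tb where "tb t = max 0 t" for t :: real
  define wb where "wb = clamp1"
  have wb: "-1 \<le> wb w" "wb w \<le> 1" for w by (simp_all add: wb_def)
  have tb: "0 \<le> tb t" for t by (simp add: tb_def)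
  define l1 where "l1 w t = enter_a (wb w) (tb t)" for w t
  define l2 where "l2 w t = exit_m (wb w) (tb t)" for w t
  note l1 = enter_a_props[OF wb tb, folded l1_def] and l2 = exit_m_props[OF wb tb, folded l2_def]
  have ctb: "continuous_on S (\<lambda>x. tb (f x))" if "continuous_on S f" for S :: "'z::topological_space set" and f
    unfolding tb_def by (intro continuous_intros that)
  have cwb: "continuous_on S (\<lambda>x. wb (f x))" if "continuous_on S f" for S :: "'z::topological_space set" and f
    unfolding wb_def by (intro cont_of that)
  have cl: "cont2 l1" "cont2 l2"
  proof -
    show "cont2 l1" unfolding cont2_def l1_def enter_a_def
      by (intro continuous_intros cont_of ctb cwb)
    show "cont2 l2" unfolding cont2_def l2_def exit_m_def
      by (intro continuous_intros cont_of ctb cwb)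
  qed
  have cw: "cont2 (\<lambda>w t. wb w)" unfolding cont2_def by (intro cwb continuous_intros)
  define SA where "SA w t = (LINT s:{l1 w t..wb w}|lborel. K2 s * rr (n s + (tb t - a (wb w) - tau)))" for w t
  define SB where "SB w t = (LINT s:{wb w..l2 w t}|lborel. K1 s * p (n s + (- tb t - m (wb w))))" for w t
  define S1 where "S1 w t = (LINT s:{-1..1}|lborel. k1 s * p (a s + (- tb t)))" for w t :: real
  define S2 where "S2 w t = (LINT s:{-1..1}|lborel. k2 s * rr (m s + (tb t - tau)))" for w t :: real
  have cS: "cont2 SA" "cont2 SB" "cont2 S1" "cont2 S2"
    unfolding SA_def[abs_def] SB_def[abs_def] S1_def[abs_def] S2_def[abs_def]
    by (intro sn.source_continuous[OF rr cont_K0(2)] sn.source_continuous[OF p cont_K0(1)] sa.source_continuous[OF p kc(1)]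
        sm.source_continuous[OF rr kc(2)] l1 l2 wb cl cw order_refl;
      (simp add: cont2_def; fail)?; unfold cont2_def; intro continuous_intros cont_of ctb cwb)+
  define J where "J = Kc * ((LINT x|lborel. l12 (rr x)) / (1 / L0)) + Kc * ((LINT x|lborel. l12 (p x)) / (1 / L0))"
  have J1: "0 \<le> Kc * ((LINT x|lborel. l12 (f x)) / (1 / L0))" for f :: "real \<Rightarrow> real"
    using Kc(1) L0 by (intro mult_nonneg_nonneg divide_nonneg_nonneg Bochner_Integration.integral_nonneg) auto
  have bS: "\<bar>SA w t\<bar> \<le> J" "\<bar>SB w t\<bar> \<le> J" "\<bar>S1 w t\<bar> \<le> J" "\<bar>S2 w t\<bar> \<le> J" for w t
    using sn.source_bound(2)[OF rr cont_K0(2) Kc(3) l1(1) wb(2), of w t w "tb t - a (wb w) - tau"]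
      sn.source_bound(2)[OF p cont_K0(1) Kc(2) wb(1) l2(2), of w w t "- tb t - m (wb w)"]
      sa.source_bound(2)[OF p kc(1) kB(1) order_refl order_refl, of "- tb t"]
      sm.source_bound(2)[OF rr kc(2) kB(2) order_refl order_refl, of "tb t - tau"] J1[of rr] J1[of p]
    by (auto simp: SA_def SB_def S1_def S2_def J_def)
  \<comment> \<open>The scalar feedback is the third unknown, read at the dummy position 0.
    \<open>hh\<close> is continuous and vanishes for negative arguments, that is, on characteristics
    that start from the initial data.\<close>
  define hh where "hh f q = f 3 0 (max 0 q) - f 3 0 0" for f :: "3 \<Rightarrow> real \<Rightarrow> real \<Rightarrow> real" and q
  define i1 where "i1 f w t s = K2 s * (h0 + hh f (tb t - a (wb w) + a s - tau + m s) + f 2 s (tb t - a (wb w) + a s))"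
    for f :: "3 \<Rightarrow> real \<Rightarrow> real \<Rightarrow> real" and w t s
  define i2 where "i2 f w t s = K1 s * f 1 s (tb t + m (wb w) - m s)" for f :: "3 \<Rightarrow> real \<Rightarrow> real \<Rightarrow> real" and w t s
  define i3 where "i3 f t s = k1 s * f 1 s (tb t) + k2 s * (h0 + hh f (tb t - tau + m s) + f 2 s (tb t))"
    for f :: "3 \<Rightarrow> real \<Rightarrow> real \<Rightarrow> real" and t s
  define G where "G f i w t = (if i = 1 then SA w t + oint (i1 f w t) (l1 w t) (wb w)
      else if i = 2 then SB w t + oint (i2 f w t) (wb w) (l2 w t)
      else S1 w t + S2 w t + oint (i3 f t) (-1) 1)" for f and i :: 3 and w t
  define om :: "3 \<Rightarrow> real \<Rightarrow> real \<Rightarrow> real" where "om i w t = (if i = 3 then MM else 1) * exp (N * tb t)" for i w t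
  have chh: "continuous_on S (\<lambda>x. hh f (y x))" if f: "\<And>i. cont2 (f i)" and y: "continuous_on S y" for S :: "'z::topological_space set" and f y
    unfolding hh_def by (intro continuous_intros cont2_comp[OF f] y)
  have ci: "continuous_on UNIV (\<lambda>x. i1 f (fst (fst x)) (snd (fst x)) (snd x))"
    "continuous_on UNIV (\<lambda>x. i2 f (fst (fst x)) (snd (fst x)) (snd x))"
    "continuous_on UNIV (\<lambda>x. i3 f (snd (fst x)) (snd x :: real))" if f: "\<And>i. cont2 (f i)" for f
    unfolding i1_def i2_def i3_def
    by (intro continuous_intros cont_of ctb cwb chh[OF f] cont2_comp[OF f] cont1_comp[OF kc(1)] cont1_comp[OF kc(2)])+
  have ci1: "continuous_on S (i1 f w t)" "continuous_on S (i2 f w t)" "continuous_on S (i3 f t)" if f: "\<And>i. cont2 (f i)" for f w t S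
    unfolding i1_def[abs_def] i2_def[abs_def] i3_def[abs_def]
    by (intro continuous_intros cont_of ctb cwb chh[OF f] cont2_comp[OF f] cont1_comp[OF kc(1)] cont1_comp[OF kc(2)])+
  have cG: "cont2 (G f i)" if f: "\<And>i. cont2 (f i)" for f i
  proof -
    have c0: "cont2 (\<lambda>w t. -1)" "cont2 (\<lambda>w t. 1)" by (simp_all add: cont2_def)
    have "cont2 (\<lambda>w t. SA w t + oint (i1 f w t) (l1 w t) (wb w))" "cont2 (\<lambda>w t. SB w t + oint (i2 f w t) (wb w) (l2 w t))"
      "cont2 (\<lambda>w t. S1 w t + S2 w t + oint (i3 f t) (-1) 1)"
      using cont2_oint[OF ci(1)[OF f] cl(1) cw] cont2_oint[OF ci(2)[OF f] cw cl(2)] cont2_oint[where g = "\<lambda>w t. i3 f t", OF ci(3)[OF f] c0] cS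
      unfolding cont2_def by (auto intro: continuous_on_add)
    then show ?thesis unfolding G_def[abs_def] by (cases "i = 1"; cases "i = 2") simp_all
  qed
  have om1: "1 \<le> om i w t" for i w t
  proof -
    have "1 \<le> exp (N * tb t)" using Np tb by simp
    then show ?thesis using MM(1) mult_mono[of 1 MM 1 "exp (N * tb t)"] by (simp add: om_def)
  qed
  have bd0: "\<bar>G (\<lambda>_ _ _. 0) i w t\<bar> \<le> (2 * J + 2 * Kc * \<bar>h0\<bar>) * om i w t" for i w t
  proof -
    have bi: "\<bar>oint f x y\<bar> \<le> 2 * Kc * \<bar>h0\<bar>" if "x \<le> y" "-1 \<le> x" "y \<le> 1" "\<And>s. s \<in> Iv \<Longrightarrow> \<bar>f s\<bar> \<le> Kc * \<bar>h0\<bar>" "continuous_on {x..y} f" for f x y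
    proof -
      have "norm (integral {x..y} f) \<le> (Kc * \<bar>h0\<bar>) * (y - x)"
        using that by (intro integral_bound) auto
      also have "\<dots> \<le> (Kc * \<bar>h0\<bar>) * 2" using that Kc(1) by (intro mult_left_mono) auto
      finally show ?thesis using that(1) by (simp add: oint_le)
    qed
    have z: "cont2 ((\<lambda>_ _ _. 0) i)" for i :: 3 by (simp add: cont2_def)
    have b1: "\<bar>i1 (\<lambda>_ _ _. 0) w t s\<bar> \<le> Kc * \<bar>h0\<bar>" "\<bar>i2 (\<lambda>_ _ _. 0) w t s\<bar> \<le> Kc * \<bar>h0\<bar>" for s
      using Kc by (auto simp: i1_def i2_def hh_def abs_mult intro!: mult_right_mono)
    have b3: "\<bar>i3 (\<lambda>_ _ _. 0) t s\<bar> \<le> Kc * \<bar>h0\<bar>" if "s \<in> Iv" for s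
      using kB[OF that] by (auto simp: i3_def hh_def abs_mult intro!: mult_right_mono)
    have J0: "0 \<le> J" using J1[of rr] J1[of p] by (simp add: J_def)
    have "\<bar>G (\<lambda>_ _ _. 0) i w t\<bar> \<le> 2 * J + 2 * Kc * \<bar>h0\<bar>"
      using bi[OF l1(2,1) wb(2) b1(1) ci1(1)[OF z]] bi[OF l2(1) wb(1) l2(2) b1(2) ci1(2)[OF z]]
        bi[OF _ order_refl order_refl b3 ci1(3)[OF z]] bS[of w t] J0
      by (auto simp: G_def) (smt (verit))+
    also have "\<dots> \<le> (2 * J + 2 * Kc * \<bar>h0\<bar>) * om i w t"
      using mult_left_mono[OF om1[of i w t], of "2 * J + 2 * Kc * \<bar>h0\<bar>"] J0 Kc(1) by simp
    finally show ?thesis .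
  qed
  have contr: "\<bar>G f i w t - G g i w t\<bar> \<le> 1/6 * D * om i w t"
    if f: "\<And>i. cont2 (f i)" and g: "\<And>i. cont2 (g i)" and D: "0 \<le> D"
      and d: "\<And>i w t. \<bar>f i w t - g i w t\<bar> \<le> D * om i w t" for f g D i w t
  proof -
    have kL: "0 < N * (1 / L0)" using Np L0 by simp
    have d1: "\<bar>f 1 s q - g 1 s q\<bar> \<le> D * exp (N * q)" "\<bar>f 2 s q - g 2 s q\<bar> \<le> D * exp (N * q)" "\<bar>f 3 s q - g 3 s q\<bar> \<le> D * MM * exp (N * q)"
      if "0 \<le> q" for s q
      using d[of 1 s q] d[of 2 s q] d[of 3 s q] that by (simp_all add: om_def tb_def)
    \<comment> \<open>Feedback values at \<open>q\<close> and at 0 are both compared, whence the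
      factor 2 here and \<open>1 + 2 * MM\<close> in \<open>N\<close>.\<close>
    have dh: "\<bar>hh f q - hh g q\<bar> \<le> 2 * D * MM * exp (N * q)" for q
    proof (cases "q \<le> 0")
      case True
      then show ?thesis using D MM(1) by (simp add: hh_def)
    next
      case False
      have "D * MM * 1 \<le> D * MM * exp (N * q)" using D MM(1) Np False by (intro mult_left_mono) auto
      then show ?thesis using d1(3)[of q 0] d1(3)[of 0 0] False unfolding hh_def by (simp add: max_def)
    qed
    have dh': "\<bar>hh f q - hh g q\<bar> \<le> 2 * D * MM * exp (N * x)" if "q \<le> x" for q x
      using dh[of q] mult_left_mono[of "exp (N * q)" "exp (N * x)" "2 * D * MM"] that D MM(1) Np by simp
    have ex: "exp (N * q) \<le> exp (N * tb t) * exp (- (N * (1 / L0)) * \<bar>s - z\<bar>)"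
      if "q \<le> tb t - (1 / L0) * \<bar>s - z\<bar>" for q s z
    proof -
      have "N * q \<le> N * (tb t - (1 / L0) * \<bar>s - z\<bar>)" using that Np by (intro mult_left_mono) auto
      then show ?thesis by (simp add: right_diff_distrib flip: exp_add)
    qed
    define E where "E = Kc * D * (1 + 2 * MM) * exp (N * tb t)"
    have E: "0 \<le> E" "E / (N * (1 / L0)) = 1/24 * D * exp (N * tb t)"
    proof -
      show "0 \<le> E" using Kc(1) D MM by (simp add: E_def)
      have aux: "x * y * z * e / (24 * x * z * l * (1 / l)) = 1/24 * y * e" if "x \<noteq> 0" "z \<noteq> 0" "l \<noteq> 0" for x y z e l :: real
        using that by (simp add: field_simps)
      show "E / (N * (1 / L0)) = 1/24 * D * exp (N * tb t)"
        unfolding E_def N_def using Kc(1) MM L0 by (intro aux) auto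
    qed
    have E': "1/24 * D * exp (N * tb t) \<le> 1/6 * D * exp (N * tb t)" using D by simp
    consider "i = 1" | "i = 2" | "i = 3" using exhaust_3 by blast
    then show ?thesis
    proof cases
      case 1
      have "\<bar>integral {l1 w t..wb w} (\<lambda>s. i1 f w t s - i1 g w t s)\<bar> \<le> E / (N * (1 / L0))"
      proof (rule exp_abs_integral_bound[where z = "wb w"])
        fix s assume s: "s \<in> {l1 w t..wb w}"
        define q where "q = tb t - a (wb w) + a s"
        have q0: "0 \<le> q" using l1(3)[of w t s] s by (simp add: q_def)
        have ss: "-1 \<le> s" "s \<le> 1" using s l1(1)[of w t] wb(2)[of w] unfolding atLeastAtMost_iff by linarith+
        have "q \<le> tb t - (1 / L0) * \<bar>s - wb w\<bar>" using a_expand[of s "wb w"] s by (simp add: q_def)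
        note e = ex[OF this]
        have "\<bar>i1 f w t s - i1 g w t s\<bar> = \<bar>K2 s\<bar> * \<bar>(hh f (q - tau + m s) - hh g (q - tau + m s)) + (f 2 s q - g 2 s q)\<bar>"
          unfolding abs_mult[symmetric] by (simp add: i1_def q_def algebra_simps)
        also have "\<dots> \<le> Kc * (2 * D * MM * exp (N * q) + D * exp (N * q))"
          using dh'[of "q - tau + m s" q] d1(2)[OF q0, of s] am_range[OF ss] Kc
          by (intro mult_mono) auto
        also have "\<dots> = Kc * D * (1 + 2 * MM) * exp (N * q)" by (simp add: algebra_simps)
        also have "\<dots> \<le> Kc * D * (1 + 2 * MM) * (exp (N * tb t) * exp (- (N * (1 / L0)) * \<bar>s - wb w\<bar>))"
          using e Kc(1) D MM by (intro mult_left_mono) auto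
        finally show "\<bar>i1 f w t s - i1 g w t s\<bar> \<le> E * exp (- (N * (1 / L0)) * \<bar>s - wb w\<bar>)" by (simp only: E_def mult.assoc)
      qed (use l1(2) kL E f g in \<open>auto intro!: continuous_on_diff ci1\<close>)
      then have "\<bar>oint (i1 f w t) (l1 w t) (wb w) - oint (i1 g w t) (l1 w t) (wb w)\<bar> \<le> 1/24 * D * exp (N * tb t)"
        using l1(2)[of w t] unfolding E(2)
        by (simp add: oint_le Henstock_Kurzweil_Integration.integral_diff integrable_continuous_interval ci1 f g)
      then show ?thesis using E' 1 by (simp add: G_def om_def)
    next
      case 2
      have "\<bar>integral {wb w..l2 w t} (\<lambda>s. i2 f w t s - i2 g w t s)\<bar> \<le> E / (N * (1 / L0))"
      proof (rule exp_abs_integral_bound[where z = "wb w"])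
        fix s assume s: "s \<in> {wb w..l2 w t}"
        define q where "q = tb t + m (wb w) - m s"
        have q0: "0 \<le> q" using l2(3)[of s w t] s by (simp add: q_def)
        have "q \<le> tb t - (1 / L0) * \<bar>s - wb w\<bar>" using m_expand[of "wb w" s] s by (simp add: q_def)
        note e = ex[OF this]
        have "\<bar>i2 f w t s - i2 g w t s\<bar> = \<bar>K1 s\<bar> * \<bar>f 1 s q - g 1 s q\<bar>"
          unfolding abs_mult[symmetric] by (simp add: i2_def q_def algebra_simps)
        also have "\<dots> \<le> Kc * (D * exp (N * q))"
          using d1(1)[OF q0, of s] Kc by (intro mult_mono) auto
        also have "\<dots> \<le> Kc * D * (1 + 2 * MM) * exp (N * q)"
          using Kc(1) D MM by (simp add: algebra_simps)
        also have "\<dots> \<le> Kc * D * (1 + 2 * MM) * (exp (N * tb t) * exp (- (N * (1 / L0)) * \<bar>s - wb w\<bar>))"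
          using e Kc(1) D MM by (intro mult_left_mono) auto
        finally show "\<bar>i2 f w t s - i2 g w t s\<bar> \<le> E * exp (- (N * (1 / L0)) * \<bar>s - wb w\<bar>)" by (simp only: E_def mult.assoc)
      qed (use l2(1) kL E f g in \<open>auto intro!: continuous_on_diff ci1\<close>)
      then have "\<bar>oint (i2 f w t) (wb w) (l2 w t) - oint (i2 g w t) (wb w) (l2 w t)\<bar> \<le> 1/24 * D * exp (N * tb t)"
        using l2(1)[of w t] unfolding E(2)
        by (simp add: oint_le Henstock_Kurzweil_Integration.integral_diff integrable_continuous_interval ci1 f g)
      then show ?thesis using E' 2 by (simp add: G_def om_def)
    next
      case 3
      \<comment> \<open>\<open>y\<close> collects the delayed feedback, whose weight decays away
        from \<open>s = 1\<close>; \<open>x\<close> collects the instantaneous contributions,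
        controlled only through \<open>MM\<close>.\<close>
      define y where "y s = k2 s * (hh f (tb t - tau + m s) - hh g (tb t - tau + m s))" for s
      define x where "x s = k1 s * (f 1 s (tb t) - g 1 s (tb t)) + k2 s * (f 2 s (tb t) - g 2 s (tb t))" for s
      have cxy: "continuous_on {-1..1} x" "continuous_on {-1..1} y"
        unfolding x_def[abs_def] y_def[abs_def]
        by (intro continuous_intros cont_of ctb cwb chh[OF f] chh[OF g] cont2_comp[OF f] cont2_comp[OF g] cont1_comp[OF kc(1)] cont1_comp[OF kc(2)])+
      have "\<bar>integral {-1..1} y\<bar> \<le> E / (N * (1 / L0))"
      proof (rule exp_abs_integral_bound[where z = 1])
        fix s :: real assume s: "s \<in> {-1..1}"
        define q where "q = tb t - tau + m s"
        have "q \<le> tb t - (1 / L0) * \<bar>s - 1\<bar>" using m_expand[of s 1] s by (simp add: q_def tau_def)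
        note e = ex[OF this]
        have "\<bar>y s\<bar> \<le> Kc * (2 * D * MM * exp (N * q))"
          unfolding y_def abs_mult q_def using dh kB[OF s] Kc(1) by (intro mult_mono) auto
        also have "\<dots> \<le> Kc * D * (1 + 2 * MM) * exp (N * q)"
          using Kc(1) D MM by (simp add: algebra_simps)
        also have "\<dots> \<le> Kc * D * (1 + 2 * MM) * (exp (N * tb t) * exp (- (N * (1 / L0)) * \<bar>s - 1\<bar>))"
          using e Kc(1) D MM by (intro mult_left_mono) auto
        finally show "\<bar>y s\<bar> \<le> E * exp (- (N * (1 / L0)) * \<bar>s - 1\<bar>)" by (simp only: E_def mult.assoc)
      qed (use kL E cxy in auto)
      then have by1: "\<bar>integral {-1..1} y\<bar> \<le> 1/24 * D * exp (N * tb t)" unfolding E(2) .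
      have "norm (integral {-1..1} x) \<le> (2 * Kc * D * exp (N * tb t)) * (1 - (-1))"
      proof (rule integral_bound[OF _ cxy(1)])
        fix s :: real assume s: "s \<in> {-1..1}"
        have "\<bar>k1 s\<bar> * \<bar>f 1 s (tb t) - g 1 s (tb t)\<bar> \<le> Kc * (D * exp (N * tb t))"
          "\<bar>k2 s\<bar> * \<bar>f 2 s (tb t) - g 2 s (tb t)\<bar> \<le> Kc * (D * exp (N * tb t))"
          using kB[OF s] d1[OF tb, of s t] Kc(1) by (intro mult_mono; simp)+
        then show "norm (x s) \<le> 2 * Kc * D * exp (N * tb t)"
          unfolding x_def real_norm_def using abs_triangle_ineq[of "k1 s * (f 1 s (tb t) - g 1 s (tb t))" "k2 s * (f 2 s (tb t) - g 2 s (tb t))"]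
          by (simp add: abs_mult)
      qed simp
      then have bx1: "\<bar>integral {-1..1} x\<bar> \<le> 4 * Kc * (D * exp (N * tb t))" by simp
      have "oint (i3 f t) (-1) 1 - oint (i3 g t) (-1) 1 = integral {-1..1} (\<lambda>s. i3 f t s - i3 g t s)"
        by (simp add: oint_le Henstock_Kurzweil_Integration.integral_diff integrable_continuous_interval ci1 f g)
      also have "(\<lambda>s. i3 f t s - i3 g t s) = (\<lambda>s. x s + y s)"
        by (simp add: fun_eq_iff i3_def x_def y_def algebra_simps)
      also have "integral {-1..1} (\<lambda>s. x s + y s) = integral {-1..1} x + integral {-1..1} y"
        by (intro Henstock_Kurzweil_Integration.integral_add integrable_continuous_interval cxy)
      finally have "\<bar>oint (i3 f t) (-1) 1 - oint (i3 g t) (-1) 1\<bar> \<le> 4 * Kc * (D * exp (N * tb t)) + 1/24 * (D * exp (N * tb t))"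
        using by1 bx1 by simp
      also have "\<dots> = (4 * Kc + 1/24) * (D * exp (N * tb t))" by (simp add: algebra_simps)
      also have "\<dots> \<le> (1/6 * MM) * (D * exp (N * tb t))"
        using MM D by (intro mult_right_mono) auto
      finally show ?thesis using 3 by (simp add: G_def om_def mult_ac)
    qed
  qed
  have "\<exists>f C. (\<forall>i. cont2 (f i)) \<and> (\<forall>i x y. \<bar>f i x y\<bar> \<le> C * om i x y) \<and> (\<forall>i x y. f i x y = G f i x y)"
  proof (rule weighted_fixed_point[where q = "1/6" and Cz = "2 * J + 2 * Kc * \<bar>h0\<bar>"])
    show "cont2 (om i)" for i unfolding om_def cont2_def by (intro continuous_intros ctb)
    show "om i x y > 0" for i x y using MM by (simp add: om_def)
  qed (use cG bd0 contr in auto)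
  then obtain f where fc: "\<And>i. cont2 (f i)" and fe: "\<And>i w t. f i w t = G f i w t" by blast
  define h where "h t = f 3 0 t" for t
  show ?thesis
  proof (rule exI[of _ "f 1"], rule exI[of _ "f 2"], rule exI[of _ h], intro conjI allI impI)
    show "cont2 (f 1)" "cont2 (f 2)" by (rule fc)+
    show "continuous_on UNIV h" unfolding h_def[abs_def] by (intro cont2_comp[OF fc] continuous_intros)
    fix w t :: real assume w: "-1 \<le> w" "w \<le> 1" and t: "0 \<le> t"
    have e: "wb w = w" "tb t = t" "l1 w t = enter_a w t" "l2 w t = exit_m w t"
      using w t by (simp_all add: wb_def tb_def l1_def l2_def)
    have hhe: "hh f q = h (max 0 q) - h 0" for q by (simp add: hh_def h_def)
    show "f 1 w t = (LINT s:{enter_a w t..w}|lborel. K2 s * (r (tau - m s - (t - a w + a s)) +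
          (h0 + (h (max 0 (t - a w + a s - tau + m s)) - h 0) + f 2 s (t - a w + a s))))"
    proof -
      have "f 1 w t = (LINT s:{l1 w t..wb w}|lborel. K2 s * rr (n s + (tb t - a (wb w) - tau)) + i1 f w t s)"
        unfolding fe[of 1] G_def SA_def
        using LINT_split_continuous[OF sn.source_bound(1)[OF rr cont_K0(2) Kc(3) l1(1) wb(2)] ci1(1)[OF fc] l1(2)] by simp
      also have "\<dots> = (LINT s:{enter_a w t..w}|lborel. K2 s * (r (tau - m s - (t - a w + a s)) +
          (h0 + (h (max 0 (t - a w + a s - tau + m s)) - h 0) + f 2 s (t - a w + a s))))"
        unfolding e i1_def hhe rr_def n_def by (simp add: distrib_left algebra_simps)
      finally show ?thesis .
    qed
    show "f 2 w t = (LINT s:{w..exit_m w t}|lborel. K1 s * (p (a s - (t + m w - m s)) + f 1 s (t + m w - m s)))"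
    proof -
      have "f 2 w t = (LINT s:{wb w..l2 w t}|lborel. K1 s * p (n s + (- tb t - m (wb w))) + i2 f w t s)"
        unfolding fe[of 2] G_def SB_def
        using LINT_split_continuous[OF sn.source_bound(1)[OF p cont_K0(1) Kc(2) wb(1) l2(2)] ci1(2)[OF fc] l2(1)] by simp
      also have "\<dots> = (LINT s:{w..exit_m w t}|lborel. K1 s * (p (a s - (t + m w - m s)) + f 1 s (t + m w - m s)))"
        unfolding e i2_def n_def by (simp add: distrib_left algebra_simps)
      finally show ?thesis .
    qed
    show "h t = (LINT s:Iv|lborel. k1 s * (p (a s - t) + f 1 s t)) +
            (LINT s:Iv|lborel. k2 s * (r (tau - m s - t) + (h0 + (h (max 0 (t - tau + m s)) - h 0) + f 2 s t)))"
    proof -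
      have ca: "continuous_on UNIV (\<lambda>s. k1 s * f 1 s t)" "continuous_on UNIV (\<lambda>s. k2 s * (h0 + hh f (t - tau + m s) + f 2 s t))"
        by (intro continuous_intros cont_of chh[OF fc] cont2_comp[OF fc] cont1_comp[OF kc(1)] cont1_comp[OF kc(2)])+
      have "oint (i3 f t) (-1) 1 = oint (\<lambda>s. k1 s * f 1 s t) (-1) 1 + oint (\<lambda>s. k2 s * (h0 + hh f (t - tau + m s) + f 2 s t)) (-1) 1"
        unfolding i3_def[abs_def] e
        by (simp add: oint_le Henstock_Kurzweil_Integration.integral_add cont_integrable_on[OF ca(1)] cont_integrable_on[OF ca(2)])
      then have "h t = ((LINT s:{-1..1}|lborel. k1 s * p (a s + (- t))) + oint (\<lambda>s. k1 s * f 1 s t) (-1) 1)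
          + ((LINT s:{-1..1}|lborel. k2 s * rr (m s + (t - tau))) + oint (\<lambda>s. k2 s * (h0 + hh f (t - tau + m s) + f 2 s t)) (-1) 1)"
        unfolding h_def fe[of 3] G_def S1_def S2_def e by simp
      also have "\<dots> = (LINT s:{-1..1}|lborel. k1 s * p (a s + (- t)) + k1 s * f 1 s t)
          + (LINT s:{-1..1}|lborel. k2 s * rr (m s + (t - tau)) + k2 s * (h0 + hh f (t - tau + m s) + f 2 s t))"
        using LINT_split_continuous[OF sa.source_bound(1)[OF p kc(1) kB(1) order_refl order_refl, where Q = "- t"] ca(1)]
          LINT_split_continuous[OF sm.source_bound(1)[OF rr kc(2) kB(2) order_refl order_refl, where Q = "t - tau"] ca(2)] by simp
      also have "\<dots> = (LINT s:Iv|lborel. k1 s * (p (a s - t) + f 1 s t)) +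
            (LINT s:Iv|lborel. k2 s * (r (tau - m s - t) + (h0 + (h (max 0 (t - tau + m s)) - h 0) + f 2 s t)))"
        unfolding hhe rr_def by (simp add: distrib_left algebra_simps)
      finally show ?thesis .
    qed
  qed
qed

end

section \<open>From mild to weak solutions\<close>

lemma lborel_pair_Fubini:
  fixes f :: "'a::euclidean_space \<times> 'b::euclidean_space \<Rightarrow> real"
  assumes f: "integrable lborel f"
  shows "(LINT p|lborel. f p) = (LINT x|lborel. LINT y|lborel. f (x, y))"
    and "(LINT p|lborel. f p) = (LINT y|lborel. LINT x|lborel. f (x, y))"
    and "integrable lborel (\<lambda>x. LINT y|lborel. f (x, y))"
    and "integrable lborel (\<lambda>y. LINT x|lborel. f (x, y))"
    and "AE x in lborel. integrable lborel (\<lambda>y. f (x, y))"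
proof -
  have i: "integrable (lborel \<Otimes>\<^sub>M lborel) f" using f by (simp add: lborel_prod)
  have i2: "integrable (lborel \<Otimes>\<^sub>M lborel) (\<lambda>(x, y). f (x, y))" using i by simp
  show "(LINT p|lborel. f p) = (LINT x|lborel. LINT y|lborel. f (x, y))"
    using lborel_pair.integral_fst'[OF i] by (simp add: lborel_prod)
  show "(LINT p|lborel. f p) = (LINT y|lborel. LINT x|lborel. f (x, y))"
    using lborel_pair.integral_snd[OF i2] by (simp add: lborel_prod)
  show "integrable lborel (\<lambda>x. LINT y|lborel. f (x, y))" by (rule lborel_pair.integrable_fst'[OF i])
  show "integrable lborel (\<lambda>y. LINT x|lborel. f (x, y))" by (rule lborel_pair.integrable_snd[OF i2])
  show "AE x in lborel. integrable lborel (\<lambda>y. f (x, y))" by (rule lborel_pair.AE_integrable_fst'[OF i])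
qed

lemma integrable_product_bound:
  fixes f :: "'a::euclidean_space \<times> 'b::euclidean_space \<Rightarrow> real"
  assumes fm: "f \<in> borel_measurable lborel" and al: "integrable lborel al" and be: "integrable lborel be"
    and b: "\<And>x y. \<bar>f (x, y)\<bar> \<le> al x * be y"
  shows "integrable lborel f"
proof -
  have m: "(\<lambda>p. al (fst p) * be (snd p)) \<in> borel_measurable (lborel \<Otimes>\<^sub>M lborel)"
    using al be by measurable
  have "integrable (lborel \<Otimes>\<^sub>M lborel) (\<lambda>p. al (fst p) * be (snd p))"
  proof (rule lborel_pair.Fubini_integrable[OF m])
    have "(\<lambda>x. LINT y|lborel. norm (al (fst (x, y)) * be (snd (x, y)))) = (\<lambda>x. \<bar>al x\<bar> * (LINT y|lborel. \<bar>be y\<bar>))"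
      by (simp add: abs_mult)
    then show "integrable lborel (\<lambda>x. LINT y|lborel. norm (al (fst (x, y)) * be (snd (x, y))))"
      using integrable_abs[OF al] by simp
    show "AE x in lborel. integrable lborel (\<lambda>y. al (fst (x, y)) * be (snd (x, y)))"
      using be by (intro AE_I2) simp
  qed
  then have i: "integrable lborel (\<lambda>p. al (fst p) * be (snd p))" by (simp add: lborel_prod)
  show ?thesis
  proof (rule Bochner_Integration.integrable_bound[OF i fm], rule AE_I2)
    fix p :: "'a \<times> 'b"
    show "norm (f p) \<le> norm (al (fst p) * be (snd p))"
      using b[of "fst p" "snd p"] by simp
  qed
qed

text \<open>On each line with fixed first coordinate the map is a shift, combined with a reflection
  if \<open>c = -1\<close>, and so preserves length; hence measurability of \<open>eta\<close> is
  enough.\<close>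

lemma integral_shear:
  fixes phi :: "real \<times> real \<Rightarrow> real"
  assumes phi: "phi \<in> borel_measurable borel" and eta: "eta \<in> borel_measurable borel" and c: "\<bar>c\<bar> = 1"
    and i: "integrable lborel (\<lambda>p. phi (fst p, eta (fst p) + c * snd p))"
  shows "integrable lborel phi" "(LINT p|lborel. phi p) = (LINT p|lborel. phi (fst p, eta (fst p) + c * snd p))"
proof -
  have c0: "c \<noteq> 0" using c by auto
  note F = lborel_pair_Fubini[OF i, unfolded fst_conv snd_conv]
  have "integrable (lborel \<Otimes>\<^sub>M lborel) phi"
  proof (rule lborel_pair.Fubini_integrable)
    show "phi \<in> borel_measurable (lborel \<Otimes>\<^sub>M lborel)" using phi by (simp add: lborel_prod)
    have "(LINT y|lborel. norm (phi (x, y))) = (LINT y|lborel. \<bar>phi (x, eta x + c * y)\<bar>)" for x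
      by (subst lborel_integral_real_affine[OF c0, of _ "eta x"]) (simp add: c)
    then show "integrable lborel (\<lambda>x. LINT y|lborel. norm (phi (x, y)))"
      using lborel_pair_Fubini(3)[OF integrable_abs[OF i]] by simp
    show "AE x in lborel. integrable lborel (\<lambda>y. phi (x, y))"
      using F(5) by eventually_elim (subst (asm) lborel_integrable_real_affine_iff[OF c0])
  qed
  then show i': "integrable lborel phi" by (simp add: lborel_prod)
  have "(LINT y|lborel. phi (x, y)) = (LINT y|lborel. phi (x, eta x + c * y))" for x
    by (subst lborel_integral_real_affine[OF c0, of _ "eta x"]) (simp add: c)
  then show "(LINT p|lborel. phi p) = (LINT p|lborel. phi (fst p, eta (fst p) + c * snd p))"
    unfolding F(1) lborel_pair_Fubini(1)[OF i'] by simp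
qed

text \<open>\<open>e w\<close> is the travel time from the inflow point \<open>w0\<close> to \<open>w\<close>, in either direction; \<open>P q\<close> is the initial value at travel time \<open>q\<close> for \<open>q > 0\<close>
  and the boundary value at time \<open>-q\<close> for \<open>q \<le> 0\<close>. Both parts are Fubini along characteristics.\<close>

lemma mild_weak:
  fixes e ei P ed :: "real \<Rightarrow> real" and y h D F :: "real \<Rightarrow> real \<Rightarrow> real" and S T w0 :: real
  assumes ec: "continuous_on UNIV e" and er: "\<And>w. w \<in> Iv \<Longrightarrow> 0 \<le> e w \<and> e w \<le> S"
    and Pm: "P \<in> borel_measurable borel" and Pi: "set_integrable lborel {-T..S} P"
    and hm: "(\<lambda>p. h (fst p) (snd p)) \<in> borel_measurable borel"
    and hi: "set_integrable lborel (Iv \<times> {0..T}) (\<lambda>p. h (fst p) (snd p))"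
    and D: "cont2 D" "\<And>w t. w \<in> Iv \<Longrightarrow> T < t \<Longrightarrow> D w t = 0" and T: "0 \<le> T"
    and FTC: "\<And>s t. s \<in> Iv \<Longrightarrow> 0 \<le> t \<Longrightarrow> (LINT w:{w\<in>Iv. e s \<le> e w}|lborel. D w (t + e w - e s)) = - F s t"
    and w0: "w0 \<in> Iv" "e w0 = 0" and ei: "\<And>q. 0 \<le> q \<Longrightarrow> q \<le> S \<Longrightarrow> ei q \<in> Iv \<and> e (ei q) = q"
    and CoV: "(LINT q:{0<..S}|lborel. P q * F (ei q) 0) = (LINT w:Iv|lborel. P (e w) * F w 0 * ed w)"
    and y: "\<And>w t. w \<in> Iv \<Longrightarrow> 0 \<le> t \<Longrightarrow> y w t = P (e w - t)
        + (LINT s:{s\<in>Iv. e s \<le> e w \<and> 0 \<le> t - e w + e s}|lborel. h s (t - e w + e s))"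
    and yi: "set_integrable lborel Strip (\<lambda>p. y (fst p) (snd p) * D (fst p) (snd p))"
  shows "(LINT p:Strip|lborel. y (fst p) (snd p) * D (fst p) (snd p))
     = - (LINT w:Iv|lborel. P (e w) * F w 0 * ed w) - (LINT t:{0..}|lborel. P (- t) * F w0 t)
       - (LINT p:Strip|lborel. h (fst p) (snd p) * F (fst p) (snd p))"
proof -
  have em [measurable]: "e \<in> borel_measurable borel" by (rule borel_measurable_continuous_onI[OF ec])
  have Dm [measurable]: "(\<lambda>p. D (fst p) (snd p)) \<in> borel_measurable borel"
    using cont2_measurable[OF D(1)] by simp
  have Dcomp [measurable]: "(\<lambda>x. D (f x) (g x)) \<in> borel_measurable M"
    if "f \<in> borel_measurable M" "g \<in> borel_measurable M" for f g and M :: "'z measure"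
  proof -
    have "(\<lambda>x. (f x, g x)) \<in> borel_measurable M" using that by (rule borel_measurable_Pair)
    from measurable_compose[OF this Dm] show ?thesis by simp
  qed
  have hcomp [measurable]: "(\<lambda>x. h (f x) (g x)) \<in> borel_measurable M"
    if "f \<in> borel_measurable M" "g \<in> borel_measurable M" for f g and M :: "'z measure"
  proof -
    have "(\<lambda>x. (f x, g x)) \<in> borel_measurable M" using that by (rule borel_measurable_Pair)
    from measurable_compose[OF this hm] show ?thesis by simp
  qed
  note Pm [measurable]
  have fstm [measurable]: "fst \<in> borel_measurable (borel :: (real \<times> 'x::euclidean_space) measure)"
    "snd \<in> borel_measurable (borel :: (real \<times> 'x::euclidean_space) measure)"
    by (intro borel_measurable_continuous_onI continuous_intros)+
  have "compact ((\<lambda>p. D (fst p) (snd p)) ` (Iv \<times> {0..T}))"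
    by (intro compact_continuous_image continuous_on_subset[OF D(1)[unfolded cont2_def]] compact_Times) auto
  then have "bounded ((\<lambda>p. D (fst p) (snd p)) ` (Iv \<times> {0..T}))" by (rule compact_imp_bounded)
  then obtain C where "\<forall>p\<in>Iv \<times> {0..T}. \<bar>D (fst p) (snd p)\<bar> \<le> C" unfolding bounded_iff by auto
  then have C: "\<bar>D w t\<bar> \<le> C" if "w \<in> Iv" "0 \<le> t" "t \<le> T" for w t using that by auto
  have C0: "0 \<le> C" using C[of 0 0] T by auto
  have Ivi: "integrable lborel (\<lambda>w. C * indicator Iv w :: real)"
    by (intro integrable_mult_right integrable_real_indicator) (auto simp: emeasure_lborel_Icc_eq)

  \<comment> \<open>The transported part in the coordinate \<open>q = e w - t\<close>, where
    \<open>P\<close> no longer depends on \<open>w\<close>.\<close>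
  define f1 where "f1 p = indicator Iv (fst p) * (if snd p \<le> e (fst p) then P (snd p) * D (fst p) (e (fst p) - snd p) else 0)" for p :: "real \<times> real"
  define g1 where "g1 q = \<bar>indicator {-T..S} q *\<^sub>R P q\<bar>" for q
  have f1m: "f1 \<in> borel_measurable borel" unfolding f1_def[abs_def] by measurable
  have f1i: "integrable lborel f1"
  proof (rule integrable_product_bound[OF _ Ivi, of _ g1])
    show "integrable lborel g1" unfolding g1_def using Pi unfolding set_integrable_def by (rule integrable_abs)
    fix w q
    show "\<bar>f1 (w, q)\<bar> \<le> C * indicator Iv w * g1 q"
    proof (cases "w \<in> Iv \<and> q \<le> e w \<and> e w - q \<le> T")
      case True
      then have "q \<in> {-T..S}" using er[of w] by auto
      moreover have "\<bar>P q\<bar> * \<bar>D w (e w - q)\<bar> \<le> \<bar>P q\<bar> * C" using True by (intro mult_left_mono C) auto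
      ultimately show ?thesis using True by (simp add: f1_def g1_def abs_mult mult.commute)
    next
      case False
      then have "f1 (w, q) = 0" using D(2)[of w "e w - q"] by (auto simp: f1_def indicator_def)
      then show ?thesis using C0 by (simp add: g1_def)
    qed
  qed (use f1m in simp)
  note F1 = lborel_pair_Fubini[OF f1i]
  \<comment> \<open>For a fixed label the inner integral is \<open>D\<close> along a single
    characteristic: labels \<open>q \<le> 0\<close> start at the boundary point \<open>w0\<close>,
    labels in \<open>{0<..S}\<close> at \<open>ei q\<close> on the initial line.\<close>
  have f1q: "(LINT w|lborel. f1 (w, q)) = - (indicator {..0} q * (P q * F w0 (- q))) - indicator {0<..S} q * (P q * F (ei q) 0)" for q
  proof -
    have eq: "(LINT w|lborel. f1 (w, q)) = P q * (LINT w:{w\<in>Iv. q \<le> e w}|lborel. D w (e w - q))"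
      unfolding set_lebesgue_integral_def integral_mult_right_zero[symmetric]
      by (intro Bochner_Integration.integral_cong) (auto simp: f1_def indicator_def)
    consider "q \<le> 0" | "0 < q" "q \<le> S" | "S < q" by linarith
    then show ?thesis
    proof cases
      case 1
      have "{w\<in>Iv. q \<le> e w} = {w\<in>Iv. e w0 \<le> e w}" using er w0 1 by fastforce
      then have "(LINT w:{w\<in>Iv. q \<le> e w}|lborel. D w (e w - q)) = - F w0 (- q)"
        using FTC[OF w0(1), of "- q"] 1 w0(2) by (simp add: add.commute)
      then show ?thesis using eq 1 by simp
    next
      case 2
      have "(LINT w:{w\<in>Iv. q \<le> e w}|lborel. D w (e w - q)) = - F (ei q) 0"
        using FTC[of "ei q" 0] ei[of q] 2 by simp
      then show ?thesis using eq 2 by simp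
    next
      case 3
      have "{w\<in>Iv. q \<le> e w} = {}" using er 3 by fastforce
      then show ?thesis using eq 3 w0 er[OF w0(1)] by (simp add: set_lebesgue_integral_def)
    qed
  qed
  have L1: "(LINT p|lborel. f1 p) = - (LINT t:{0..}|lborel. P (- t) * F w0 t) - (LINT w:Iv|lborel. P (e w) * F w 0 * ed w)"
  proof -
    define H where "H q = (LINT w|lborel. f1 (w, q))" for q
    have Hi: "integrable lborel H" unfolding H_def[abs_def] by (rule F1(4))
    have i1: "integrable lborel (\<lambda>q. indicator {..0} q *\<^sub>R H q)" "integrable lborel (\<lambda>q. indicator {0<..} q *\<^sub>R H q)"
      by (intro integrable_mult_indicator Hi; simp)+
    have "(LINT p|lborel. f1 p) = (LINT q|lborel. indicator {..0} q *\<^sub>R H q + indicator {0<..} q *\<^sub>R H q)"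
      unfolding F1(2) H_def[symmetric] by (intro Bochner_Integration.integral_cong) (auto simp: indicator_def)
    also have "\<dots> = (LINT q|lborel. indicator {..0} q *\<^sub>R H q) + (LINT q|lborel. indicator {0<..} q *\<^sub>R H q)"
      by (rule Bochner_Integration.integral_add[OF i1])
    also have "(LINT q|lborel. indicator {..0} q *\<^sub>R H q) = - (LINT q|lborel. indicator {..0} q * (P q * F w0 (- q)))"
      unfolding Bochner_Integration.integral_minus[symmetric]
      by (intro Bochner_Integration.integral_cong) (auto simp: H_def f1q indicator_def)
    also have "(LINT q|lborel. indicator {..0} q * (P q * F w0 (- q))) = (LINT t:{0..}|lborel. P (- t) * F w0 t)"
      unfolding set_lebesgue_integral_def
      by (subst lborel_integral_real_affine[of "-1" _ 0]) (auto simp: indicator_def intro!: Bochner_Integration.integral_cong)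
    also have "(LINT q|lborel. indicator {0<..} q *\<^sub>R H q) = - (LINT q:{0<..S}|lborel. P q * F (ei q) 0)"
      unfolding set_lebesgue_integral_def Bochner_Integration.integral_minus[symmetric]
      by (intro Bochner_Integration.integral_cong) (auto simp: H_def f1q indicator_def)
    finally show ?thesis unfolding CoV by simp
  qed
  define p1 where "p1 p = indicator Strip p * (P (e (fst p) - snd p) * D (fst p) (snd p))" for p
  have p1m: "p1 \<in> borel_measurable borel" unfolding p1_def[abs_def] by measurable
  have p1e: "p1 (fst p, e (fst p) + - 1 * snd p) = f1 p" for p
    by (auto simp: p1_def f1_def indicator_def)
  have p1: "integrable lborel p1" "(LINT p|lborel. p1 p) = (LINT p|lborel. f1 p)"
    using integral_shear[OF p1m em, of "-1"] f1i unfolding p1e by auto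

  \<comment> \<open>The source part as a triple integral: what is emitted at the point
    \<open>snd p\<close> is felt at every later position \<open>fst p\<close> of the same
    characteristic.\<close>
  define G where "G p = indicator Iv (fst p) * (indicator Strip (snd p) * (if e (fst (snd p)) \<le> e (fst p)
      then h (fst (snd p)) (snd (snd p)) * D (fst p) (snd (snd p) + e (fst p) - e (fst (snd p))) else 0))" for p :: "real \<times> real \<times> real"
  define g2 where "g2 x = \<bar>indicator (Iv \<times> {0..T}) x *\<^sub>R h (fst x) (snd x)\<bar>" for x
  have fss [measurable]: "(\<lambda>p. fst (snd p)) \<in> borel_measurable (borel :: (real \<times> real \<times> real) measure)"
    "(\<lambda>p. snd (snd p)) \<in> borel_measurable (borel :: (real \<times> real \<times> real) measure)"
    by (intro borel_measurable_continuous_onI continuous_intros)+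
  have Gm: "G \<in> borel_measurable borel" unfolding G_def[abs_def] by measurable
  have Gi: "integrable lborel G"
  proof (rule integrable_product_bound[OF _ Ivi, of _ g2])
    show "integrable lborel g2" unfolding g2_def using hi unfolding set_integrable_def by (rule integrable_abs)
    fix w and x :: "real \<times> real"
    show "\<bar>G (w, x)\<bar> \<le> C * indicator Iv w * g2 x"
    proof (cases "w \<in> Iv \<and> x \<in> Strip \<and> e (fst x) \<le> e w \<and> snd x + e w - e (fst x) \<le> T")
      case True
      then have "x \<in> Iv \<times> {0..T}" by (auto simp: mem_Times_iff)
      moreover have "\<bar>h (fst x) (snd x)\<bar> * \<bar>D w (snd x + e w - e (fst x))\<bar> \<le> \<bar>h (fst x) (snd x)\<bar> * C"
        using True by (intro mult_left_mono C) (auto simp: mem_Times_iff)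
      ultimately show ?thesis using True by (simp add: G_def g2_def abs_mult mult.commute)
    next
      case False
      then have "G (w, x) = 0" using D(2)[of w "snd x + e w - e (fst x)"] by (auto simp: G_def indicator_def mem_Times_iff)
      then show ?thesis using C0 by (simp add: g2_def)
    qed
  qed (use Gm in simp)
  note F2 = lborel_pair_Fubini[OF Gi]
  have L2: "(LINT p|lborel. G p) = - (LINT p:Strip|lborel. h (fst p) (snd p) * F (fst p) (snd p))"
  proof -
    have "(LINT w|lborel. G (w, x)) = - (indicator Strip x *\<^sub>R (h (fst x) (snd x) * F (fst x) (snd x)))" for x
    proof -
      have "(LINT w|lborel. G (w, x)) = indicator Strip x * (h (fst x) (snd x) *
          (LINT w:{w\<in>Iv. e (fst x) \<le> e w}|lborel. D w (snd x + e w - e (fst x))))"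
        unfolding set_lebesgue_integral_def integral_mult_right_zero[symmetric]
        by (intro Bochner_Integration.integral_cong) (auto simp: G_def indicator_def)
      then show ?thesis using FTC[of "fst x" "snd x"] by (auto simp: indicator_def mem_Times_iff)
    qed
    then show ?thesis unfolding F2(2) set_lebesgue_integral_def by simp
  qed
  \<comment> \<open>What the source contributes to the pairing. Being the difference of two
    integrable functions, it needs no estimate of the source integral.\<close>
  define p2 where "p2 p = indicator Strip p *\<^sub>R (y (fst p) (snd p) * D (fst p) (snd p)) - p1 p" for p
  have p2i: "integrable lborel p2" unfolding p2_def[abs_def]
    using yi p1(1) unfolding set_integrable_def by (rule Bochner_Integration.integrable_diff)
  note F3 = lborel_pair_Fubini[OF p2i]
  \<comment> \<open>At fixed \<open>w\<close>, a shear in time and Fubini exchange emission time and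
    observation time.\<close>
  have "AE w in lborel. (LINT t|lborel. p2 (w, t)) = (LINT x|lborel. G (w, x))"
    using F2(5)
  proof eventually_elim
    case (elim w)
    show ?case
    proof (cases "w \<in> Iv")
      case False
      then have "p2 (w, t) = 0" "G (w, x) = 0" for t x by (auto simp: p2_def p1_def G_def indicator_def)
      then show ?thesis by simp
    next
      case w: True
      define f3 where "f3 x = indicator Iv (fst x) * (if e (fst x) \<le> e w \<and> 0 \<le> snd x - e w + e (fst x)
          then h (fst x) (snd x - e w + e (fst x)) * D w (snd x) else 0)" for x :: "real \<times> real"
      have f3m: "f3 \<in> borel_measurable borel" unfolding f3_def[abs_def] by measurable
      have etam: "(\<lambda>s. e w - e s) \<in> borel_measurable borel" by measurable
      have f3e: "f3 (fst x, (e w - e (fst x)) + 1 * snd x) = G (w, x)" for x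
        using w by (auto simp: f3_def G_def indicator_def mem_Times_iff algebra_simps)
      have f3: "integrable lborel f3" "(LINT x|lborel. f3 x) = (LINT x|lborel. G (w, x))"
        using integral_shear[OF f3m etam, of 1] elim unfolding f3e by auto
      have "(LINT s|lborel. f3 (s, t)) = p2 (w, t)" for t
      proof (cases "0 \<le> t")
        case True
        have "(LINT s|lborel. f3 (s, t)) = D w t * (LINT s:{s\<in>Iv. e s \<le> e w \<and> 0 \<le> t - e w + e s}|lborel. h s (t - e w + e s))"
          unfolding set_lebesgue_integral_def integral_mult_right_zero[symmetric]
          by (intro Bochner_Integration.integral_cong) (auto simp: f3_def indicator_def)
        then show ?thesis using y[OF w True] w True by (simp add: p2_def p1_def algebra_simps)
      next
        case False
        then have "f3 (s, t) = 0" for s by (auto simp: f3_def)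
        moreover have "p2 (w, t) = 0" using False by (simp add: p2_def p1_def)
        ultimately show ?thesis by simp
      qed
      then show ?thesis using lborel_pair_Fubini(2)[OF f3(1)] f3(2) by simp
    qed
  qed
  then have "(LINT p|lborel. p2 p) = (LINT p|lborel. G p)"
    unfolding F3(1) F2(1) using F3(3) F2(3) by (intro integral_cong_AE) auto
  moreover have "(LINT p|lborel. p2 p) = (LINT p:Strip|lborel. y (fst p) (snd p) * D (fst p) (snd p)) - (LINT p|lborel. p1 p)"
    unfolding p2_def set_lebesgue_integral_def
    using yi p1(1) unfolding set_integrable_def by (rule Bochner_Integration.integral_diff)
  ultimately show ?thesis using L1 L2 p1(2) by simp
qed

section \<open>Test functions along characteristics and regularity of transported data\<close>

lemma test_fun_scaled:
  assumes phi: "test_fun phi phiw phit" and k: "\<And>w. (k has_real_derivative k' w) (at w)" and k': "continuous_on UNIV k'"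
  shows "C1_2 (\<lambda>w t. k w * phi w t) (\<lambda>w t. k' w * phi w t + k w * phiw w t) (\<lambda>w t. k w * phit w t)"
proof -
  have ck: "continuous_on UNIV k" using k by (auto simp: continuous_on_eq_continuous_at dest: DERIV_isCont)
  have c: "cont2 phi" "cont2 phiw" "cont2 phit" and d: "\<And>w t. ((\<lambda>x. phi x t) has_real_derivative phiw w t) (at w)"
    "\<And>w t. ((\<lambda>s. phi w s) has_real_derivative phit w t) (at t)"
    using phi unfolding test_fun_def cont2_def case_prod_unfold by blast+
  show ?thesis
  proof (rule C1_2I)
    show "cont2 (\<lambda>w t. k' w * phi w t + k w * phiw w t)" "cont2 (\<lambda>w t. k w * phit w t)" "cont2 (\<lambda>w t. k w * phi w t)"
      unfolding cont2_def
      by (intro continuous_intros cont1_comp[OF ck] cont1_comp[OF k'] cont2_comp[OF c(1)] cont2_comp[OF c(2)] cont2_comp[OF c(3)])+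
    fix w t
    show "((\<lambda>w. k w * phi w t) has_real_derivative k' w * phi w t + k w * phiw w t) (at w)"
      by (rule DERIV_cong[OF DERIV_mult[OF k d(1)]]) simp
    show "((\<lambda>t. k w * phi w t) has_real_derivative k w * phit w t) (at t)"
      by (rule DERIV_cmult[OF d(2)])
  qed
qed

lemma test_fun_support:
  assumes phi: "test_fun phi phiw phit"
  shows "\<exists>S\<ge>0. \<forall>w t. S < t \<longrightarrow> phi w t = 0 \<and> phiw w t = 0 \<and> phit w t = 0"
proof -
  obtain S where S: "\<And>w t. S \<le> t \<Longrightarrow> phi w t = 0" using phi unfolding test_fun_def by blast
  have C: "C1_2 phi phiw phit"
    using phi unfolding test_fun_def C1_2_def cont2_def case_prod_unfold by blast
  have "phiw w t = 0" "phit w t = 0" if "S < t" for w t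
  proof -
    have "((\<lambda>x. phi x t) has_real_derivative phiw w t) (at w)" by (rule C1_2D[OF C])
    moreover have "(\<lambda>x. phi x t) = (\<lambda>_. 0)" using S that by auto
    ultimately have "((\<lambda>_. 0) has_real_derivative phiw w t) (at w)" by simp
    then show "phiw w t = 0" by (rule DERIV_unique) simp
    show "phit w t = 0" by (rule C1_2_zero_after[OF C _ that]) (simp add: S)
  qed
  then show ?thesis using S by (intro exI[of _ "max 0 S"]) auto
qed

text \<open>The integrand is the total derivative of \<open>F\<close> along the curve
  \<open>(w, t + e w)\<close>; sheared coordinates reduce the claim to one variable.\<close>

lemma char_FTC:
  assumes F: "C1_2 F Fw Ft" and e: "\<And>w. (e has_real_derivative e' w) (at w)" and e': "continuous_on UNIV e'" and xy: "x \<le> y"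
  shows "(LINT w:{x..y}|lborel. Fw w (t + e w) + Ft w (t + e w) * e' w) = F y (t + e y) - F x (t + e x)"
proof -
  note C = C1_2_shear[OF F e e']
  have c: "continuous_on {x..y} (\<lambda>w. Fw w (t + e w) + Ft w (t + e w) * e' w)"
    using cont2_comp[OF C1_2D(1)[OF C] continuous_on_id continuous_on_const, of "{x..y}" t] by simp
  have "((\<lambda>w. Fw w (t + e w) + Ft w (t + e w) * e' w) has_integral (F y (t + e y) - F x (t + e x))) {x..y}"
    by (rule fundamental_theorem_of_calculus[OF xy])
      (use C1_2D(4)[OF C] in \<open>auto simp: has_real_derivative_iff_has_vector_derivative[symmetric] intro: has_field_derivative_at_within\<close>)
  then show ?thesis
    using set_borel_integral_eq_integral(2)[OF borel_integrable_atLeastAtMost'[OF c]] by (simp add: integral_unique)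
qed

lemma L2_path_I:
  assumes m: "(\<lambda>p. u (fst p) (snd p)) \<in> borel_measurable borel" "\<And>t. 0 \<le> t \<Longrightarrow> L2_on (\<lambda>w. u w t)"
    "\<And>t0. 0 \<le> t0 \<Longrightarrow> ((\<lambda>t. LINT w:Iv|lborel. (u w t - u w t0)^2) \<longlongrightarrow> 0) (at t0 within {0..})"
  shows "L2_path u"
  using assms unfolding L2_path_def by simp

lemma L2_on_cont:
  assumes "continuous_on UNIV f" shows "L2_on f"
  unfolding L2_on_def
proof
  show "f \<in> borel_measurable lborel" using borel_measurable_continuous_onI[OF assms] by simp
  show "set_integrable lborel Iv (\<lambda>w. (f w)^2)"
    by (intro borel_integrable_atLeastAtMost' continuous_intros continuous_on_subset[OF assms]) simp
qed

lemma L2_on_add: "L2_on f \<Longrightarrow> L2_on g \<Longrightarrow> L2_on (\<lambda>w. f w + g w)"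
  using L2_on_diff[of f "\<lambda>w. 0 - g w"] L2_on_diff[of "\<lambda>_. 0" g] L2_on_const[of 0] by simp

lemma (in speed) L2_path_translate:
  assumes f: "compact_L2 R f" and th: "continuous_on UNIV th" and C: "cont2 C"
  shows "L2_path (\<lambda>w t. f (g w + th t) + C w t)"
proof (rule L2_path_I)
  have fm [measurable]: "f \<in> borel_measurable borel" and fi: "integrable lborel (\<lambda>x. l12 (f x))"
    using f by (auto simp: compact_L2_def)
  have gm [measurable]: "g \<in> borel_measurable borel" "th \<in> borel_measurable borel"
    by (rule borel_measurable_continuous_onI[OF cont_g], rule borel_measurable_continuous_onI[OF th])
  have fs [measurable]: "fst \<in> borel_measurable (borel :: (real \<times> real) measure)" "snd \<in> borel_measurable (borel :: (real \<times> real) measure)"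
    by (intro borel_measurable_continuous_onI continuous_intros)+
  have Cm [measurable]: "(\<lambda>p. C (fst p) (snd p)) \<in> borel_measurable borel"
    using cont2_measurable[OF C] by simp
  show "(\<lambda>p. f (g (fst p) + th (snd p)) + C (fst p) (snd p)) \<in> borel_measurable borel" by measurable
  have Lf: "L2_on (\<lambda>w. f (g w + Q))" for Q
    unfolding L2_on_def
  proof
    show m: "(\<lambda>w. f (g w + Q)) \<in> borel_measurable lborel" by measurable
    show "set_integrable lborel Iv (\<lambda>w. (f (g w + Q))^2)"
      unfolding set_integrable_def
    proof (rule Bochner_Integration.integrable_bound[OF compose_integral_bound(1)[OF fi l12_nonneg g g'_cont g'_ge k, of Q, unfolded set_integrable_def]])
      show "(\<lambda>x. indicat_real Iv x *\<^sub>R (f (g x + Q))\<^sup>2) \<in> borel_measurable lborel" by measurable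
      show "AE x in lborel. norm (indicat_real Iv x *\<^sub>R (f (g x + Q))\<^sup>2) \<le> norm (indicat_real Iv x *\<^sub>R l12 (f (g x + Q)))"
        by (intro AE_I2) (auto simp: l12_def indicator_def)
    qed
  qed
  have cC: "continuous_on UNIV (\<lambda>w. C w t)" for t by (intro cont2_comp[OF C] continuous_intros)
  show "L2_on (\<lambda>w. f (g w + th t) + C w t)" for t by (rule L2_on_add[OF Lf L2_on_cont[OF cC]])
  fix t0 :: real
  define I1 where "I1 t = (LINT w:Iv|lborel. (f (g w + th t) - f (g w + th t0))^2)" for t
  define I2 where "I2 t = (LINT w:Iv|lborel. (C w t - C w t0)^2)" for t
  have cc: "continuous_on S (\<lambda>w. (C w t - C w t0)^2)" for S t
    by (intro continuous_intros cont2_comp[OF C])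
  have ii: "set_integrable lborel Iv (\<lambda>w. (C w t - C w t0)^2)" for t
    by (rule borel_integrable_atLeastAtMost'[OF cc])
  have I2: "I2 t = integral (cbox (-1) 1) (\<lambda>w. (C w t - C w t0)^2)" for t
    unfolding I2_def using set_borel_integral_eq_integral(2)[OF ii] by simp
  have "continuous_on UNIV I2" unfolding I2[abs_def]
    by (rule integral_continuous_on_param) (unfold case_prod_unfold, intro continuous_intros cont2_comp[OF C])
  then have "(I2 \<longlongrightarrow> I2 t0) (at t0 within {0..})"
    by (metis UNIV_I continuous_on_def tendsto_within_subset top_greatest)
  moreover have "I2 t0 = 0" by (simp add: I2_def set_lebesgue_integral_def)
  moreover have "(I1 \<longlongrightarrow> 0) (at t0 within {0..})"
    unfolding I1_def by (rule translation_continuous[OF f th])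
  ultimately have lim: "((\<lambda>t. 2 * I1 t + 2 * I2 t) \<longlongrightarrow> 0) (at t0 within {0..})"
    by (auto intro!: tendsto_eq_intros)
  have le: "(LINT w:Iv|lborel. (f (g w + th t) + C w t - (f (g w + th t0) + C w t0))^2) \<le> 2 * I1 t + 2 * I2 t" for t
  proof -
    have i1: "set_integrable lborel Iv (\<lambda>w. (f (g w + th t) - f (g w + th t0))^2)"
      using L2_on_diff[OF Lf Lf, of "th t" "th t0"] by (simp add: L2_on_def)
    have i3: "set_integrable lborel Iv (\<lambda>w. (f (g w + th t) + C w t - (f (g w + th t0) + C w t0))^2)"
      using L2_on_diff[OF L2_on_add[OF Lf[of "th t"] L2_on_cont[OF cC[of t]]] L2_on_add[OF Lf[of "th t0"] L2_on_cont[OF cC[of t0]]]] by (simp add: L2_on_def)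
    have "(LINT w:Iv|lborel. (f (g w + th t) + C w t - (f (g w + th t0) + C w t0))^2)
      \<le> (LINT w:Iv|lborel. 2 * (f (g w + th t) - f (g w + th t0))^2 + 2 * (C w t - C w t0)^2)"
    proof (rule set_integral_mono[OF i3])
      show "set_integrable lborel Iv (\<lambda>w. 2 * (f (g w + th t) - f (g w + th t0))^2 + 2 * (C w t - C w t0)^2)"
        by (intro set_integral_add set_integrable_mult_right i1 ii)
      have "(x + y - (z + v))^2 \<le> 2 * (x - z)^2 + 2 * (y - v)^2" for x y z v :: real
        using zero_le_power2[of "(x - z) - (y - v)"] by (simp add: power2_eq_square algebra_simps)
      then show "(f (g w + th t) + C w t - (f (g w + th t0) + C w t0))^2 \<le> 2 * (f (g w + th t) - f (g w + th t0))^2 + 2 * (C w t - C w t0)^2" for w .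
    qed
    also have "\<dots> = 2 * I1 t + 2 * I2 t"
      unfolding I1_def I2_def using i1 ii by (subst set_integral_add(2)) simp_all
    finally show ?thesis .
  qed
  show "((\<lambda>t. LINT w:Iv|lborel. (f (g w + th t) + C w t - (f (g w + th t0) + C w t0))^2) \<longlongrightarrow> 0) (at t0 within {0..})"
  proof (rule real_tendsto_sandwich[OF _ _ tendsto_const lim])
    show "\<forall>\<^sub>F t in at t0 within {0..}. 0 \<le> (LINT w:Iv|lborel. (f (g w + th t) + C w t - (f (g w + th t0) + C w t0))^2)"
      unfolding set_lebesgue_integral_def by (intro always_eventually allI Bochner_Integration.integral_nonneg) auto
  qed (use le in simp)
qed

lemma L2_on_l12: "L2_on f \<Longrightarrow> set_integrable lborel Iv (\<lambda>x. l12 (f x))"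
  unfolding l12_def
  by (rule set_integral_add(1)[OF set_integrable_abs[OF L2_on_integrable]]) (simp_all add: L2_on_def)

text \<open>Substitution with \<open>inv g\<close> gives integrability up to the Jacobian, which is
  then removed by multiplying with the bounded function \<open>g' (inv g q)\<close>.\<close>

lemma (in speed) pullback_integrable:
  assumes f: "L2_on f" and inv: "continuous_on UNIV (inv g)" "\<And>q. g (inv g q) = q" "\<And>z. inv g (g z) = z"
    and K: "\<And>w. g' w \<le> K"
  shows "set_integrable lborel {g (-1)..g 1} (\<lambda>q. l12 (f (inv g q)))"
proof -
  have g'p: "0 < g' w" for w using g'_ge[of w] k by linarith
  have d: "(inv g has_real_derivative inverse (g' (inv g q))) (at q)" for q
    by (rule DERIV_inverse_function[where f = g and a = "q - 1" and b = "q + 1"])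
       (use g g'p[of "inv g q"] inv in \<open>auto simp: continuous_on_eq_continuous_at\<close>)
  have cg: "continuous_on UNIV (\<lambda>q. g' (inv g q))" by (rule cont1_comp[OF g'_cont inv(1)])
  have c: "continuous_on UNIV (\<lambda>q. inverse (g' (inv g q)))"
    using g'p by (intro continuous_on_inverse cg) (auto simp: less_imp_neq[symmetric])
  have c': "continuous_on {g (-1)..g 1} (\<lambda>q. inverse (g' (inv g q)))" by (rule continuous_on_subset[OF c]) simp
  have le: "g (-1) \<le> g 1"
  proof (rule DERIV_nonneg_imp_nondecreasing[of "-1" 1 g])
    show "\<exists>y. (g has_real_derivative y) (at x) \<and> 0 \<le> y" for x using g[of x] g'p[of x] less_imp_le by blast
  qed simp
  have s: "set_integrable lborel {inv g (g (-1))..inv g (g 1)} (\<lambda>x. l12 (f x))"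
    using L2_on_l12[OF f] by (simp add: inv)
  have nn: "0 \<le> inverse (g' (inv g q))" for q using g'p[of "inv g q"] by simp
  have 1: "set_integrable lborel {g (-1)..g 1} (\<lambda>q. l12 (f (inv g q)) * inverse (g' (inv g q)))"
    by (rule integral_substitution(1)[OF s d c' nn le])
  have "set_integrable lborel {g (-1)..g 1} (\<lambda>q. l12 (f (inv g q)) * inverse (g' (inv g q)) * g' (inv g q))"
  proof (rule set_integrable_bound_mult[OF 1])
    show "(\<lambda>q. g' (inv g q)) \<in> borel_measurable lborel" using borel_measurable_continuous_onI[OF cg] by simp
    show "\<bar>g' (inv g q)\<bar> \<le> K" for q using K[of "inv g q"] g'p[of "inv g q"] by simp
  qed
  moreover have "l12 (f (inv g q)) * inverse (g' (inv g q)) * g' (inv g q) = l12 (f (inv g q))" for q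
    using g'p[of "inv g q"] by simp
  ultimately show ?thesis by simp
qed

lemma compact_L2_pullback:
  assumes i: "set_integrable lborel {0..E} (\<lambda>q. l12 (f (j q)))" and m: "f \<in> borel_measurable borel" "continuous_on UNIV j" and J: "J \<in> sets borel" "J \<subseteq> {0..E}"
  shows "compact_L2 E (\<lambda>q. if q \<in> J then f (j q) - k else 0)"
  unfolding compact_L2_def
proof (intro conjI allI impI)
  have jm [measurable]: "j \<in> borel_measurable borel" by (rule borel_measurable_continuous_onI[OF m(2)])
  note m(1) [measurable] J(1) [measurable]
  show fm [measurable]: "(\<lambda>q. if q \<in> J then f (j q) - k else 0) \<in> borel_measurable borel" by measurable
  have i2: "integrable lborel (\<lambda>q. 2 * (indicator {0..E} q *\<^sub>R l12 (f (j q))) + 2 * (indicator {0..E} q * l12 (- k)))"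
    using i unfolding set_integrable_def
    by (intro Bochner_Integration.integrable_add integrable_mult_right integrable_mult_left integrable_real_indicator) (auto simp: emeasure_lborel_Icc_eq)
  show "integrable lborel (\<lambda>x. l12 (if x \<in> J then f (j x) - k else 0))"
  proof (rule Bochner_Integration.integrable_bound[OF i2])
    show "(\<lambda>x. l12 (if x \<in> J then f (j x) - k else 0)) \<in> borel_measurable lborel" by measurable
    show "AE x in lborel. norm (l12 (if x \<in> J then f (j x) - k else 0)) \<le> norm (2 * (indicator {0..E} x *\<^sub>R l12 (f (j x))) + 2 * (indicator {0..E} x * l12 (- k)))"
    proof (rule AE_I2)
      fix x
      show "norm (l12 (if x \<in> J then f (j x) - k else 0)) \<le> norm (2 * (indicator {0..E} x *\<^sub>R l12 (f (j x))) + 2 * (indicator {0..E} x * l12 (- k)))"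
        using l12_add[of "f (j x)" "- k"] J(2) by (auto simp: indicator_def l12_def)
    qed
  qed
  fix x show "E < \<bar>x\<bar> \<Longrightarrow> (if x \<in> J then f (j x) - k else 0) = 0" using J(2) by auto
qed

lemma compact_L2_shift:
  assumes "compact_L2 R f" shows "compact_L2 (R + \<bar>c\<bar>) (\<lambda>q. f (c - q))"
proof -
  have "(\<lambda>q. f (c - q)) \<in> borel_measurable borel"
    using assms unfolding compact_L2_def by (intro measurable_compose[where f = "\<lambda>q. c - q" and g = f]) auto
  moreover have "integrable lborel (\<lambda>q. l12 (f (c - q)))"
    using lborel_integrable_real_affine[of "\<lambda>x. l12 (f x)" "-1" c] assms unfolding compact_L2_def by simp
  moreover have "f (c - x) = 0" if "R + \<bar>c\<bar> < \<bar>x\<bar>" for x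
  proof -
    have "R < \<bar>c - x\<bar>" using that by linarith
    then show ?thesis using assms unfolding compact_L2_def by blast
  qed
  ultimately show ?thesis by (simp add: compact_L2_def)
qed

lemma compact_L2_integrable:
  assumes "compact_L2 R f" shows "integrable lborel f"
proof (rule Bochner_Integration.integrable_bound)
  show "integrable lborel (\<lambda>x. l12 (f x))" "f \<in> borel_measurable lborel" using assms by (simp_all add: compact_L2_def)
  show "AE x in lborel. norm (f x) \<le> norm (l12 (f x))" by (intro AE_I2) (simp add: l12_def)
qed

lemma L2_path_integrable_compact:
  assumes u: "L2_path u" and k: "continuous_on UNIV k"
  shows "set_integrable lborel (Iv \<times> {0..T}) (\<lambda>p. k (fst p) * u (fst p) (snd p))"
proof -
  \<comment> \<open>A continuous cutoff equal to 1 up to \<open>T\<close> reduces the sharp time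
    restriction to a continuous weight.\<close>
  define chi where "chi t = max 0 (min 1 (T + 1 - t))" for t :: real
  have "cont2 (\<lambda>w t. k w * chi t)" unfolding cont2_def chi_def
    by (intro continuous_intros cont1_comp[OF k])
  from L2_path_integrable[OF u this, of "T + 1"]
  have i: "set_integrable lborel Strip (\<lambda>p. u (fst p) (snd p) * (k (fst p) * chi (snd p)))"
    by (simp add: chi_def)
  have "set_integrable lborel (Iv \<times> {0..T}) (\<lambda>p. u (fst p) (snd p) * (k (fst p) * chi (snd p)))"
    by (rule set_integrable_subset[OF i]) (auto intro!: borel_closed closed_Times)
  then show ?thesis
    by (rule set_integrable_cong[THEN iffD1, rotated -1]) (auto simp: chi_def)
qed

section \<open>Existence for the closed loop\<close>

context hyp_system begin

lemma closed_loop_exists: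
  fixes k1 k2 u0 v0 :: "real \<Rightarrow> real"
  assumes kc: "continuous_on UNIV k1" "continuous_on UNIV k2" and u0: "L2_on u0" and v0: "L2_on v0"
  shows "\<exists>u v. closed_loop_solution lam lam' mu mu' b c (fb1 (\<lambda>_ _. 0) (\<lambda>_ _. 0)) (fb2 (\<lambda>z _. k1 z) (\<lambda>z _. k2 z)) u0 v0 u v"
proof -
  \<comment> \<open>Feedback value of the initial data. \<open>p\<close> is \<open>u0\<close> in the
    travel time label, extended by 0 because \<open>u\<close> has zero inflow; \<open>r1\<close> is
    \<open>v0 - h0\<close> in the label \<open>m w\<close>, and \<open>r\<close> is the same profile
    measured from the inflow end \<open>w = 1\<close>.\<close>
  define h0 where "h0 = fb2 (\<lambda>z _. k1 z) (\<lambda>z _. k2 z) u0 v0"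
  define p where "p q = (if q \<in> {0<..sigma} then u0 (inv a q) - 0 else 0)" for q
  define r1 where "r1 q = (if q \<in> {0..<tau} then v0 (inv m q) - h0 else 0)" for q
  define r where "r q = r1 (tau - q)" for q
  have ub: "u0 \<in> borel_measurable borel" "v0 \<in> borel_measurable borel" using u0 v0 by (simp_all add: L2_on_def)
  have lb: "1 / lam w \<le> 1 / l0" "1 / mu w \<le> 1 / l0" for w
    using lam_bds mu_bds l0 by (auto intro!: divide_left_mono mult_pos_pos lam_pos mu_pos)
  have p: "compact_L2 sigma p"
    unfolding p_def[abs_def]
    by (rule compact_L2_pullback[OF _ ub(1) a_homeo(3)])
      (use sa.pullback_integrable[OF u0 a_homeo(3,1,2) lb(1)] in \<open>auto simp: sigma_def\<close>)
  have r1: "compact_L2 tau r1"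
    unfolding r1_def[abs_def]
    by (rule compact_L2_pullback[OF _ ub(2) m_homeo(3)])
      (use sm.pullback_integrable[OF v0 m_homeo(3,1,2) lb(2)] in \<open>auto simp: tau_def\<close>)
  have r: "compact_L2 (tau + \<bar>tau\<bar>) r" unfolding r_def[abs_def] by (rule compact_L2_shift[OF r1])
  obtain A B h where AB: "cont2 A" "cont2 B" and ch: "continuous_on UNIV h"
    and fp: "\<forall>w t. -1 \<le> w \<longrightarrow> w \<le> 1 \<longrightarrow> 0 \<le> t \<longrightarrow>
      A w t = (LINT s:{enter_a w t..w}|lborel. K2 s * (r (tau - m s - (t - a w + a s)) +
          (h0 + (h (max 0 (t - a w + a s - tau + m s)) - h 0) + B s (t - a w + a s)))) \<and>
      B w t = (LINT s:{w..exit_m w t}|lborel. K1 s * (p (a s - (t + m w - m s)) + A s (t + m w - m s))) \<and>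
      h t = (LINT s:Iv|lborel. k1 s * (p (a s - t) + A s t)) +
            (LINT s:Iv|lborel. k2 s * (r (tau - m s - t) + (h0 + (h (max 0 (t - tau + m s)) - h 0) + B s t)))"
    using closed_loop_fixed_point[OF kc p r, of h0] by (elim exE conjE) (rule that)
  define u where "u w t = p (a w - t) + A w t" for w t
  define v where "v w t = r (tau - m w - t) + (h0 + (h (max 0 (t - tau + m w)) - h 0) + B w t)" for w t
  have Aeq: "A w t = (LINT s:{enter_a w t..w}|lborel. K2 s * v s (t - a w + a s))"
    and Beq: "B w t = (LINT s:{w..exit_m w t}|lborel. K1 s * u s (t + m w - m s))"
    if "w \<in> Iv" "0 \<le> t" for w t
    using fp that unfolding u_def v_def by auto
  have heq: "h t = fb2 (\<lambda>z _. k1 z) (\<lambda>z _. k2 z) (\<lambda>z. u z t) (\<lambda>z. v z t)" if "0 \<le> t" for t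
    using fp[rule_format, of 0 t] that unfolding u_def v_def fb2_def by (simp add: mult.commute)
  have Lu: "L2_path u"
    using sa.L2_path_translate[OF p _ AB(1), of "\<lambda>t. - t"] by (simp add: u_def[abs_def] continuous_on_minus)
  have Lv: "L2_path v"
  proof -
    have c1: "continuous_on UNIV (\<lambda>t. t - tau :: real)" by (intro continuous_intros)
    have c2: "cont2 (\<lambda>w t. h0 + (h (max 0 (t - tau + m w)) - h 0) + B w t)"
      unfolding cont2_def by (intro continuous_intros cont1_comp[OF ch] cont_of cont2_comp[OF AB(2)])
    show ?thesis
      using sm.L2_path_translate[OF compact_L2_reflect[OF r] c1 c2]
      unfolding v_def[abs_def] by (simp add: algebra_simps)
  qed
  have lt1: "0 < a w" "a w \<le> sigma" "0 \<le> m w" "m w < tau" if "-1 < w" "w < 1" for w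
    using a_homeo(4)[of w "-1"] m_homeo(4)[of 1 w] am_range[of w] that by (auto simp: tau_def)
  \<comment> \<open>Interior points only: at an end point the half-open label ranges give one of the
    two components its boundary value instead.\<close>
  have u_init: "u w 0 = u0 w" and v_init: "v w 0 = v0 w" and p_init: "p (a w) = u0 w" and r_init: "r (tau - m w) + h0 = v0 w"
    if w: "-1 < w" "w < 1" for w
  proof -
    have w': "w \<in> Iv" using w by auto
    have sing: "(LINT s:{w}|lborel. f s) = 0" for f :: "real \<Rightarrow> real"
      unfolding set_lebesgue_integral_def
      by (rule integral_eq_zero_AE)
        (use AE_lborel_singleton[of w] in \<open>auto elim!: eventually_mono\<close>)
    have "enter_a w 0 = w" "exit_m w 0 = w" using lt1[OF w] by (simp_all add: enter_a_def exit_m_def a_homeo m_homeo)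
    then have "A w 0 = 0" "B w 0 = 0" using Aeq[OF w', of 0] Beq[OF w', of 0] sing by simp_all
    then show "p (a w) = u0 w" "r (tau - m w) + h0 = v0 w" "u w 0 = u0 w" "v w 0 = v0 w"
      using lt1[OF w] by (simp_all add: u_def v_def p_def r_def r1_def a_homeo m_homeo)
  qed
  have AE1: "AE w in lborel. w \<noteq> -1 \<and> w \<noteq> (1::real)"
    using AE_lborel_singleton[of "-1::real"] AE_lborel_singleton[of "1::real"] by eventually_elim auto
  have AE_init: "AE w in lborel. w \<in> Iv \<longrightarrow> u w 0 = u0 w \<and> v w 0 = v0 w \<and> p (a w) = u0 w \<and> r (tau - m w) + h0 = v0 w"
    using AE1 by eventually_elim (use u_init v_init p_init r_init in auto)
  have Lu0: "L2_on (\<lambda>w. u w 0)" "L2_on (\<lambda>w. v w 0)" using Lu Lv by (auto simp: L2_path_def)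
  have init_cong: "(LINT w:Iv|lborel. f w * k w) = (LINT w:Iv|lborel. g w * k w)"
    if f: "f \<in> borel_measurable borel" and g: "g \<in> borel_measurable borel" and k: "continuous_on UNIV k" and e: "AE w in lborel. w \<in> Iv \<longrightarrow> f w = g w"
    for f g k :: "real \<Rightarrow> real"
  proof -
    have km: "k \<in> borel_measurable borel" by (rule borel_measurable_continuous_onI[OF k])
    show ?thesis unfolding set_lebesgue_integral_def
    proof (rule integral_cong_AE)
      show "AE x in lborel. indicat_real Iv x *\<^sub>R (f x * k x) = indicat_real Iv x *\<^sub>R (g x * k x)"
        using e by eventually_elim (auto simp: indicator_def)
    qed (use f g km in measurable)
  qed
  \<comment> \<open>The feedback sees the state only almost everywhere, so at time 0 it takes the
    value \<open>h0\<close>. The constant split off earlier is thus the right one, and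
    \<open>P (- t) = h t\<close> holds for \<open>t \<ge> 0\<close>.\<close>
  have h_init: "h 0 = h0"
  proof -
    have "h 0 = (LINT w:Iv|lborel. u w 0 * k1 w) + (LINT w:Iv|lborel. v w 0 * k2 w)"
      using heq[of 0] by (simp add: fb2_def)
    also have "\<dots> = (LINT w:Iv|lborel. u0 w * k1 w) + (LINT w:Iv|lborel. v0 w * k2 w)"
    proof -
      have "(LINT w:Iv|lborel. u w 0 * k1 w) = (LINT w:Iv|lborel. u0 w * k1 w)"
        by (rule init_cong[OF _ ub(1) kc(1)]) (use Lu0 AE_init in \<open>auto simp: L2_on_def elim: eventually_mono\<close>)
      moreover have "(LINT w:Iv|lborel. v w 0 * k2 w) = (LINT w:Iv|lborel. v0 w * k2 w)"
        by (rule init_cong[OF _ ub(2) kc(2)]) (use Lu0 AE_init in \<open>auto simp: L2_on_def elim: eventually_mono\<close>)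
      ultimately show ?thesis by simp
    qed
    finally show ?thesis by (simp add: h0_def fb2_def)
  qed
  define P where "P q = r q + (h0 + (h (max 0 (- q)) - h 0))" for q
  have cP2: "continuous_on UNIV (\<lambda>q. h0 + (h (max 0 (- q)) - h 0))"
    by (intro continuous_intros cont1_comp[OF ch])
  have rm: "r \<in> borel_measurable borel" "p \<in> borel_measurable borel" using r p by (auto simp: compact_L2_def)
  have Pm: "P \<in> borel_measurable borel" unfolding P_def[abs_def]
    using rm(1) borel_measurable_continuous_onI[OF cP2] by measurable
  have Pi: "set_integrable lborel {x..y} P" for x y
  proof -
    have "set_integrable lborel {x..y} r" unfolding set_integrable_def
      using compact_L2_integrable[OF r] by (intro integrable_mult_indicator) auto
    moreover have "set_integrable lborel {x..y} (\<lambda>q. h0 + (h (max 0 (- q)) - h 0))"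
      by (rule borel_integrable_atLeastAtMost'[OF continuous_on_subset[OF cP2]]) simp
    ultimately show ?thesis unfolding P_def by (rule set_integral_add(1))
  qed
  have pi: "set_integrable lborel {x..y} p" for x y unfolding set_integrable_def
    using compact_L2_integrable[OF p] by (intro integrable_mult_indicator) auto
  have uvm: "(\<lambda>p. u (fst p) (snd p)) \<in> borel_measurable borel" "(\<lambda>p. v (fst p) (snd p)) \<in> borel_measurable borel"
    using Lu Lv by (simp_all add: L2_path_def)
  have Kfm: "(\<lambda>p::real \<times> real. K1 (fst p)) \<in> borel_measurable borel" "(\<lambda>p::real \<times> real. K2 (fst p)) \<in> borel_measurable borel"
    by (intro borel_measurable_continuous_onI cont_of continuous_intros)+
  have weak_u: "- (LINT w:Iv|lborel. u0 w * phi w 0)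
        - (LINT p:Strip|lborel. u (fst p) (snd p) * (phit (fst p) (snd p) + lam' (fst p) * phi (fst p) (snd p) + lam (fst p) * phiw (fst p) (snd p)))
        = (LINT p:Strip|lborel. b (fst p) * v (fst p) (snd p) * phi (fst p) (snd p))"
    if phi: "test_fun phi phiw phit" and phi1: "\<And>t. phi 1 t = 0" for phi phiw phit
  proof -
    obtain T where T: "0 \<le> T" "\<And>w t. T < t \<Longrightarrow> phi w t = 0 \<and> phiw w t = 0 \<and> phit w t = 0"
      using test_fun_support[OF phi] by blast
    note F = test_fun_scaled[OF phi lam_deriv cont_lam']
    define D where "D w t = lam' w * phi w t + lam w * phiw w t + lam w * phit w t * (1 / lam w)" for w t
    have Dalt: "D w t = phit w t + lam' w * phi w t + lam w * phiw w t" for w t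
      using lam_pos[of w] by (simp add: D_def)
    have cphi: "cont2 phi" "cont2 phiw" "cont2 phit"
      using phi unfolding test_fun_def cont2_def case_prod_unfold by blast+
    have cD: "cont2 D" unfolding Dalt[abs_def] cont2_def
      by (intro continuous_intros cont_of cont1_comp[OF cont_lam'] cont2_comp[OF cphi(1)] cont2_comp[OF cphi(2)] cont2_comp[OF cphi(3)])
    have D0: "D w t = 0" if "T < t" for w t using T(2)[OF that] by (simp add: Dalt)
    have cphi0: "continuous_on UNIV (\<lambda>w. phi w 0)" by (intro cont2_comp[OF cphi(1)] continuous_intros)
    have ms: "{w\<in>Iv. a s \<le> a w} = {s..1}" if "s \<in> Iv" for s using that by (auto simp: a_homeo(4))
    have FTC: "(LINT w:{w\<in>Iv. a s \<le> a w}|lborel. D w (t + a w - a s)) = - (lam s * phi s t)" if "s \<in> Iv" for s t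
      unfolding ms[OF that] D_def
      using char_FTC[OF F a_deriv cont_inv_speed(1), of s 1 "t - a s"] that phi1 by (simp add: algebra_simps)
    have CoV: "(LINT q:{0<..sigma}|lborel. p q * (lam (inv a q) * phi (inv a q) 0)) = (LINT w:Iv|lborel. p (a w) * (lam w * phi w 0) * (1 / lam w))"
    proof -
      define k where "k q = lam (inv a q) * phi (inv a q) 0" for q
      have ck: "continuous_on UNIV k" unfolding k_def[abs_def]
        by (intro continuous_on_mult cont_of continuous_on_id cont1_comp[OF cphi0])
      have "bounded (k ` {0..sigma})"
        by (intro compact_imp_bounded compact_continuous_image continuous_on_subset[OF ck]) auto
      then obtain Bk where "\<forall>q\<in>{0..sigma}. \<bar>k q\<bar> \<le> Bk" unfolding bounded_iff by auto
      then have s: "set_integrable lborel {a (-1)..a 1} (\<lambda>q. p q * k q)"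
        using borel_measurable_continuous_onI[OF ck] by (intro set_integrable_bound_mult[OF pi]) (auto simp: sigma_def)
      have nn: "0 \<le> 1 / lam w" for w using lam_pos[of w] by simp
      have "(LINT q|lborel. p q * k q * indicator {a (-1)..a 1} q) = (LINT w|lborel. p (a w) * k (a w) * (1 / lam w) * indicator {-1..1} w)"
        by (rule integral_substitution(2)[OF s a_deriv continuous_on_subset[OF cont_inv_speed(1)] nn]) auto
      moreover have "(LINT q:{0<..sigma}|lborel. p q * k q) = (LINT q|lborel. p q * k q * indicator {a (-1)..a 1} q)"
        unfolding set_lebesgue_integral_def
        by (intro Bochner_Integration.integral_cong) (auto simp: p_def indicator_def sigma_def)
      ultimately show ?thesis
        by (simp add: k_def a_homeo(2) set_lebesgue_integral_def mult_ac)
    qed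
    have pt: "(LINT t:{0..}|lborel. p (- t) * (lam (-1) * phi (-1) t)) = 0"
    proof -
      have "(LINT t:{0..}|lborel. p (- t) * (lam (-1) * phi (-1) t)) = (LINT t:{0..}|lborel. 0 * phi (-1) t)"
        by (rule set_lebesgue_integral_cong) (auto simp: p_def)
      then show ?thesis by (simp add: set_lebesgue_integral_def)
    qed
    have ueq: "u w t = p (a w - t) + (LINT s:{s\<in>Iv. a s \<le> a w \<and> 0 \<le> t - a w + a s}|lborel. K2 s * v s (t - a w + a s))"
      if w: "w \<in> Iv" and t: "0 \<le> t" for w t
    proof -
      have "{s\<in>Iv. a s \<le> a w \<and> 0 \<le> t - a w + a s} = {enter_a w t..w}"
      proof (rule set_eqI)
        fix s
        have "enter_a w t \<le> s \<longleftrightarrow> -1 \<le> s \<and> 0 \<le> t - a w + a s" using w t by (intro enter_a_props(3)) auto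
        moreover have "a s \<le> a w \<longleftrightarrow> s \<le> w" by (rule a_homeo(4))
        moreover have "s \<le> w \<longrightarrow> s \<le> 1" using w by auto
        ultimately show "s \<in> {s\<in>Iv. a s \<le> a w \<and> 0 \<le> t - a w + a s} \<longleftrightarrow> s \<in> {enter_a w t..w}"
          unfolding mem_Collect_eq atLeastAtMost_iff by argo
      qed
      then show ?thesis using Aeq[OF w t] by (simp add: u_def)
    qed
    have iu: "set_integrable lborel Strip (\<lambda>p. u (fst p) (snd p) * D (fst p) (snd p))"
      by (rule L2_path_integrable[OF Lu cD D0])
    have "(LINT p:Strip|lborel. u (fst p) (snd p) * D (fst p) (snd p))
       = - (LINT w:Iv|lborel. p (a w) * (lam w * phi w 0) * (1 / lam w)) - (LINT t:{0..}|lborel. p (- t) * (lam (-1) * phi (-1) t))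
         - (LINT p:Strip|lborel. K2 (fst p) * v (fst p) (snd p) * (lam (fst p) * phi (fst p) (snd p)))"
    proof (rule mild_weak[where e = a and ei = "inv a" and S = sigma and T = T and h = "\<lambda>w t. K2 w * v w t"
          and F = "\<lambda>w t. lam w * phi w t" and ed = "\<lambda>w. 1 / lam w"])
      show "(\<lambda>p. K2 (fst p) * v (fst p) (snd p)) \<in> borel_measurable borel"
        using Kfm(2) uvm(2) by (rule borel_measurable_times)
      show "set_integrable lborel (Iv \<times> {0..T}) (\<lambda>p. K2 (fst p) * v (fst p) (snd p))"
        by (rule L2_path_integrable_compact[OF Lv cont_K0(2)])
      show "inv a q \<in> Iv \<and> a (inv a q) = q" if "0 \<le> q" "q \<le> sigma" for q
        using a_homeo(5)[of 0 q] a_homeo(5)[of q "a 1"] that a_homeo(2)[of "-1"] a_homeo(2)[of 1] by (simp add: a_homeo(1) sigma_def)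
    qed (use cont_a0 am_range rm pi cD D0 T FTC CoV ueq iu in auto)
    also have "(LINT w:Iv|lborel. p (a w) * (lam w * phi w 0) * (1 / lam w)) = (LINT w:Iv|lborel. p (a w) * phi w 0)"
      using lam_pos by (intro set_lebesgue_integral_cong) (auto simp: less_imp_neq[symmetric])
    also have "\<dots> = (LINT w:Iv|lborel. u0 w * phi w 0)"
    proof (rule init_cong[OF _ ub(1) cphi0])
      show "(\<lambda>w. p (a w)) \<in> borel_measurable borel"
        using rm(2) borel_measurable_continuous_onI[OF cont_a0] by measurable
      show "AE w in lborel. w \<in> Iv \<longrightarrow> p (a w) = u0 w" using AE_init by eventually_elim auto
    qed
    also have "(LINT p:Strip|lborel. K2 (fst p) * v (fst p) (snd p) * (lam (fst p) * phi (fst p) (snd p)))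
        = (LINT p:Strip|lborel. b (fst p) * v (fst p) (snd p) * phi (fst p) (snd p))"
      using lam_pos by (intro Strip_cong) (auto simp: K2_def less_imp_neq[symmetric])
    finally show ?thesis unfolding pt Dalt by simp
  qed
  have weak_v: "- (LINT w:Iv|lborel. v0 w * psi w 0) - (LINT p:Strip|lborel. v (fst p) (snd p) * psit (fst p) (snd p))
        + (LINT p:Strip|lborel. v (fst p) (snd p) * (mu' (fst p) * psi (fst p) (snd p) + mu (fst p) * psiw (fst p) (snd p)))
        - (LINT t:{0..}|lborel. mu 1 * h t * psi 1 t)
        = (LINT p:Strip|lborel. c (fst p) * u (fst p) (snd p) * psi (fst p) (snd p))"
    if psi: "test_fun psi psiw psit" and psi1: "\<And>t. psi (-1) t = 0" for psi psiw psit
  proof -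
    obtain T where T: "0 \<le> T" "\<And>w t. T < t \<Longrightarrow> psi w t = 0 \<and> psiw w t = 0 \<and> psit w t = 0"
      using test_fun_support[OF psi] by blast
    note F = test_fun_scaled[OF psi mu_deriv cont_mu']
    define D1 where "D1 w t = mu' w * psi w t + mu w * psiw w t" for w t
    \<comment> \<open>\<open>v\<close> travels to the left, so along its characteristics,
      parametrised by increasing \<open>w\<close>, the derivative of \<open>mu * psi\<close> is
      \<open>- D\<close>.\<close>
    define D where "D w t = psit w t - D1 w t" for w t
    have Dalt: "- D w t = mu' w * psi w t + mu w * psiw w t + mu w * psit w t * (- (1 / mu w))" for w t
      using mu_pos[of w] by (simp add: D_def D1_def)
    have cpsi: "cont2 psi" "cont2 psiw" "cont2 psit"
      using psi unfolding test_fun_def cont2_def case_prod_unfold by blast+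
    have cD1: "cont2 D1" unfolding D1_def[abs_def] cont2_def
      by (intro continuous_intros cont_of cont1_comp[OF cont_mu'] cont2_comp[OF cpsi(1)] cont2_comp[OF cpsi(2)])
    have cD: "cont2 D" unfolding D_def[abs_def] cont2_def
      by (intro continuous_intros cont2_comp[OF cD1] cont2_comp[OF cpsi(3)])
    have D0: "D w t = 0" "D1 w t = 0" "psit w t = 0" if "T < t" for w t using T(2)[OF that] by (simp_all add: D_def D1_def)
    have cpsi0: "continuous_on UNIV (\<lambda>w. psi w 0)" by (intro cont2_comp[OF cpsi(1)] continuous_intros)
    have ms: "{w\<in>Iv. tau - m s \<le> tau - m w} = {-1..s}" if "s \<in> Iv" for s using that by (auto simp: m_homeo(4))
    have dm: "((\<lambda>w. - m w) has_real_derivative - (1 / mu w)) (at w)" for w by (intro DERIV_minus m_deriv)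
    have cm: "continuous_on UNIV (\<lambda>w. - (1 / mu w))" by (intro continuous_on_minus cont_inv_speed)
    have FTC: "(LINT w:{w\<in>Iv. tau - m s \<le> tau - m w}|lborel. D w (t + (tau - m w) - (tau - m s))) = - (mu s * psi s t)" if "s \<in> Iv" for s t
    proof -
      have "(LINT w:{-1..s}|lborel. - D w (t + m s + - m w)) = mu s * psi s t"
        unfolding Dalt using char_FTC[OF F dm cm, of "-1" s "t + m s"] that psi1 by simp
      then have "(LINT w:{-1..s}|lborel. D w (t + m s + - m w)) = - (mu s * psi s t)"
        by (simp add: set_lebesgue_integral_def)
      then show ?thesis unfolding ms[OF that] by (simp add: algebra_simps)
    qed
    have CoV: "(LINT q:{0<..tau}|lborel. P q * (mu (inv m (tau - q)) * psi (inv m (tau - q)) 0))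
        = (LINT w:Iv|lborel. P (tau - m w) * (mu w * psi w 0) * (1 / mu w))"
    proof -
      define k where "k q = mu (inv m q) * psi (inv m q) 0" for q
      have ck: "continuous_on UNIV k" unfolding k_def[abs_def]
        by (intro continuous_on_mult cont_of continuous_on_id cont1_comp[OF cpsi0])
      have "bounded (k ` {0..tau})"
        by (intro compact_imp_bounded compact_continuous_image continuous_on_subset[OF ck]) auto
      then obtain Bk where Bk: "\<forall>q\<in>{0..tau}. \<bar>k q\<bar> \<le> Bk" unfolding bounded_iff by auto
      have "set_integrable lborel {0..tau} (\<lambda>q. P (tau - q))"
      proof -
        have "integrable lborel (\<lambda>q. indicator {0..tau} (tau + -1 * q) *\<^sub>R P (tau + -1 * q))"
          using lborel_integrable_real_affine[of "\<lambda>q. indicator {0..tau} q *\<^sub>R P q" "-1" tau] Pi[of 0 tau] by (simp add: set_integrable_def)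
        moreover have "indicator {0..tau} (tau + -1 * q) = (indicator {0..tau} q :: real)" for q by (auto simp: indicator_def)
        ultimately show ?thesis by (simp add: set_integrable_def)
      qed
      then have s: "set_integrable lborel {m (-1)..m 1} (\<lambda>q. P (tau - q) * k q)"
        using borel_measurable_continuous_onI[OF ck] Bk by (intro set_integrable_bound_mult) (auto simp: tau_def)
      have nn: "0 \<le> 1 / mu w" for w using mu_pos[of w] by simp
      have "(LINT q|lborel. P (tau - q) * k q * indicator {m (-1)..m 1} q) = (LINT w|lborel. P (tau - m w) * k (m w) * (1 / mu w) * indicator {-1..1} w)"
        by (rule integral_substitution(2)[OF s m_deriv continuous_on_subset[OF cont_inv_speed(2)] nn]) auto
      moreover have "(LINT q:{0<..tau}|lborel. P q * k (tau - q)) = (LINT q|lborel. P (tau - q) * k q * indicator {m (-1)..m 1} q)"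
      proof -
        have "(LINT q:{0<..tau}|lborel. P q * k (tau - q)) = (LINT q:{0..tau}|lborel. P q * k (tau - q))"
          unfolding set_lebesgue_integral_def
        proof (rule integral_cong_AE)
          show "AE x in lborel. indicat_real {0<..tau} x *\<^sub>R (P x * k (tau - x)) = indicat_real {0..tau} x *\<^sub>R (P x * k (tau - x))"
            using AE_lborel_singleton[of "0::real"] by eventually_elim (auto simp: indicator_def)
        qed (use Pm borel_measurable_continuous_onI[OF ck] in measurable)
        also have "\<dots> = (LINT q|lborel. P (tau - q) * k q * indicator {m (-1)..m 1} q)"
          unfolding set_lebesgue_integral_def
          by (subst lborel_integral_real_affine[of "-1" _ tau]) (auto simp: indicator_def tau_def intro!: Bochner_Integration.integral_cong)
        finally show ?thesis .
      qed
      ultimately show ?thesis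
        by (simp add: k_def m_homeo(2) set_lebesgue_integral_def mult_ac)
    qed
    have veq: "v w t = P (tau - m w - t) + (LINT s:{s\<in>Iv. tau - m s \<le> tau - m w \<and> 0 \<le> t - (tau - m w) + (tau - m s)}|lborel. K1 s * u s (t - (tau - m w) + (tau - m s)))"
      if w: "w \<in> Iv" and t: "0 \<le> t" for w t
    proof -
      have "{s\<in>Iv. tau - m s \<le> tau - m w \<and> 0 \<le> t - (tau - m w) + (tau - m s)} = {w..exit_m w t}"
      proof (rule set_eqI)
        fix s
        have "s \<le> exit_m w t \<longleftrightarrow> s \<le> 1 \<and> 0 \<le> t + m w - m s" using w t by (intro exit_m_props(3)) auto
        moreover have "m w \<le> m s \<longleftrightarrow> w \<le> s" by (rule m_homeo(4))
        moreover have "w \<le> s \<longrightarrow> -1 \<le> s" using w by auto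
        moreover have "tau - m s \<le> tau - m w \<longleftrightarrow> m w \<le> m s" "0 \<le> t - (tau - m w) + (tau - m s) \<longleftrightarrow> 0 \<le> t + m w - m s" by linarith+
        ultimately show "s \<in> {s\<in>Iv. tau - m s \<le> tau - m w \<and> 0 \<le> t - (tau - m w) + (tau - m s)} \<longleftrightarrow> s \<in> {w..exit_m w t}"
          unfolding mem_Collect_eq atLeastAtMost_iff by argo
      qed
      moreover have "t - (tau - m w) + (tau - m s) = t + m w - m s" for s by simp
      ultimately show ?thesis using Beq[OF w t] by (simp add: v_def P_def algebra_simps)
    qed
    have iv: "set_integrable lborel Strip (\<lambda>p. v (fst p) (snd p) * D (fst p) (snd p))"
      by (rule L2_path_integrable[OF Lv cD D0(1)])
    have "(LINT p:Strip|lborel. v (fst p) (snd p) * D (fst p) (snd p))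
       = - (LINT w:Iv|lborel. P (tau - m w) * (mu w * psi w 0) * (1 / mu w)) - (LINT t:{0..}|lborel. P (- t) * (mu 1 * psi 1 t))
         - (LINT p:Strip|lborel. K1 (fst p) * u (fst p) (snd p) * (mu (fst p) * psi (fst p) (snd p)))"
    proof (rule mild_weak[where e = "\<lambda>w. tau - m w" and ei = "\<lambda>q. inv m (tau - q)" and S = tau and T = T and h = "\<lambda>w t. K1 w * u w t"
          and F = "\<lambda>w t. mu w * psi w t" and ed = "\<lambda>w. 1 / mu w"])
      show "(\<lambda>p. K1 (fst p) * u (fst p) (snd p)) \<in> borel_measurable borel"
        using Kfm(1) uvm(1) by (rule borel_measurable_times)
      show "set_integrable lborel (Iv \<times> {0..T}) (\<lambda>p. K1 (fst p) * u (fst p) (snd p))"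
        by (rule L2_path_integrable_compact[OF Lu cont_K0(1)])
      show "inv m (tau - q) \<in> Iv \<and> tau - m (inv m (tau - q)) = q" if "0 \<le> q" "q \<le> tau" for q
        using m_homeo(5)[of 0 "tau - q"] m_homeo(5)[of "tau - q" "m 1"] that m_homeo(2)[of "-1"] m_homeo(2)[of 1] by (simp add: m_homeo(1) tau_def)
      show "continuous_on UNIV (\<lambda>w. tau - m w)" by (intro continuous_intros cont_of)
    qed (use am_range Pm Pi cD D0 T FTC CoV veq iv in \<open>auto simp: tau_def\<close>)
    also have "(LINT w:Iv|lborel. P (tau - m w) * (mu w * psi w 0) * (1 / mu w)) = (LINT w:Iv|lborel. P (tau - m w) * psi w 0)"
      using mu_pos by (intro set_lebesgue_integral_cong) (auto simp: less_imp_neq[symmetric])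
    also have "\<dots> = (LINT w:Iv|lborel. v0 w * psi w 0)"
    proof (rule init_cong[OF _ ub(2) cpsi0])
      show "(\<lambda>w. P (tau - m w)) \<in> borel_measurable borel"
        using Pm borel_measurable_continuous_onI[OF cont_m0] by measurable
      show "AE w in lborel. w \<in> Iv \<longrightarrow> P (tau - m w) = v0 w" using AE_init
      proof eventually_elim
        case (elim w)
        show ?case
        proof
          assume w: "w \<in> Iv"
          then have "max 0 (- (tau - m w)) = 0" using am_range[of w] by auto
          then show "P (tau - m w) = v0 w" using elim w by (simp add: P_def)
        qed
      qed
    qed
    also have "(LINT p:Strip|lborel. K1 (fst p) * u (fst p) (snd p) * (mu (fst p) * psi (fst p) (snd p)))
        = (LINT p:Strip|lborel. c (fst p) * u (fst p) (snd p) * psi (fst p) (snd p))"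
      using mu_pos by (intro Strip_cong) (auto simp: K1_def less_imp_neq[symmetric])
    also have "(LINT t:{0..}|lborel. P (- t) * (mu 1 * psi 1 t)) = (LINT t:{0..}|lborel. mu 1 * h t * psi 1 t)"
      using h_init by (intro set_lebesgue_integral_cong) (auto simp: P_def r_def r1_def)
    finally have E: "(LINT p:Strip|lborel. v (fst p) (snd p) * D (fst p) (snd p)) = - (LINT w:Iv|lborel. v0 w * psi w 0)
       - (LINT t:{0..}|lborel. mu 1 * h t * psi 1 t) - (LINT p:Strip|lborel. c (fst p) * u (fst p) (snd p) * psi (fst p) (snd p))" .
    \<comment> \<open>The second weak identity keeps time and space derivatives in separate
      integrals, so each must be integrable on its own.\<close>
    have "(LINT p:Strip|lborel. v (fst p) (snd p) * D (fst p) (snd p))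
        = (LINT p:Strip|lborel. v (fst p) (snd p) * psit (fst p) (snd p)) - (LINT p:Strip|lborel. v (fst p) (snd p) * D1 (fst p) (snd p))"
      using set_integral_diff(2)[OF L2_path_integrable[OF Lv cpsi(3) D0(3)] L2_path_integrable[OF Lv cD1 D0(2)]]
      by (simp add: D_def right_diff_distrib)
    with E show ?thesis unfolding D1_def by simp
  qed
  have fb1: "fb1 (\<lambda>_ _. 0) (\<lambda>_ _. 0) f g = 0" for f g by (simp add: fb1_def)
  have hfb: "(LINT t:{0..}|lborel. mu 1 * fb2 (\<lambda>z _. k1 z) (\<lambda>z _. k2 z) (\<lambda>z. u z t) (\<lambda>z. v z t) * psi 1 t) = (LINT t:{0..}|lborel. mu 1 * h t * psi 1 t)"
    for psi :: "real \<Rightarrow> real \<Rightarrow> real"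
    by (rule set_lebesgue_integral_cong) (auto simp: heq)
  have "closed_loop_solution lam lam' mu mu' b c (fb1 (\<lambda>_ _. 0) (\<lambda>_ _. 0)) (fb2 (\<lambda>z _. k1 z) (\<lambda>z _. k2 z)) u0 v0 u v"
    unfolding closed_loop_solution_def
  proof (intro conjI allI impI; (elim conjE)?)
    show "AE w in lborel. w \<in> Iv \<longrightarrow> u w 0 = u0 w \<and> v w 0 = v0 w" using AE_init by eventually_elim auto
  next
    fix phi phiw phit assume "test_fun phi phiw phit" "\<forall>t. phi 1 t = 0"
    then show "- (LINT w:Iv|lborel. u0 w * phi w 0)
        - (LINT p:Strip|lborel. u (fst p) (snd p) * (phit (fst p) (snd p) + lam' (fst p) * phi (fst p) (snd p) + lam (fst p) * phiw (fst p) (snd p)))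
        - (LINT t:{0..}|lborel. lam (-1) * fb1 (\<lambda>_ _. 0) (\<lambda>_ _. 0) (\<lambda>z. u z t) (\<lambda>z. v z t) * phi (-1) t)
        = (LINT p:Strip|lborel. b (fst p) * v (fst p) (snd p) * phi (fst p) (snd p))"
      using weak_u unfolding fb1 by (simp add: set_lebesgue_integral_def)
  next
    fix psi psiw psit assume "test_fun psi psiw psit" "\<forall>t. psi (-1) t = 0"
    then show "- (LINT w:Iv|lborel. v0 w * psi w 0) - (LINT p:Strip|lborel. v (fst p) (snd p) * psit (fst p) (snd p))
        + (LINT p:Strip|lborel. v (fst p) (snd p) * (mu' (fst p) * psi (fst p) (snd p) + mu (fst p) * psiw (fst p) (snd p)))
        - (LINT t:{0..}|lborel. mu 1 * fb2 (\<lambda>z _. k1 z) (\<lambda>z _. k2 z) (\<lambda>z. u z t) (\<lambda>z. v z t) * psi 1 t)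
        = (LINT p:Strip|lborel. c (fst p) * u (fst p) (snd p) * psi (fst p) (snd p))"
      unfolding hfb using weak_v by blast
  qed (use Lu Lv in \<open>auto simp: L2_path_def\<close>)
  then show ?thesis by blast
qed

end

section \<open>Extension of the coefficients and conclusion\<close>

lemma continuous_bounded_Icc:
  assumes "continuous_on UNIV (f :: real \<Rightarrow> real)" shows "\<exists>B. \<forall>x\<in>{l..r}. \<bar>f x\<bar> \<le> B"
proof -
  have "bounded (f ` {l..r})"
    by (intro compact_imp_bounded compact_continuous_image continuous_on_subset[OF assms]) auto
  then show ?thesis unfolding bounded_iff by auto
qed

text \<open>Positivity survives because it is the logarithmic derivative that is cut off and integrated.\<close>

lemma extend_positive_C1:
  assumes f: "\<forall>w\<in>Iv. (f has_real_derivative f' w) (at w within Iv)" and f': "continuous_on Iv f'" and pos: "\<forall>w\<in>Iv. 0 < f w"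
  shows "\<exists>F F' l u. (\<forall>w. (F has_real_derivative F' w) (at w)) \<and> continuous_on UNIV F' \<and> 0 < l \<and> (\<forall>w. l \<le> F w \<and> F w \<le> u) \<and>
    (\<forall>w\<in>Iv. F w = f w \<and> F' w = f' w)"
proof -
  \<comment> \<open>The logarithmic derivative, frozen outside \<open>{-1..1}\<close> and cut off to
    0 beyond absolute value 2: its primitive is constant out there, hence bounded, which gives the
    global bounds.\<close>
  define G where "G s = f' (clamp1 s) / f (clamp1 s) * max 0 (min 1 (2 - \<bar>s\<bar>))" for s
  have cc: "continuous_on UNIV clamp1" unfolding clamp1_def[abs_def] by (intro continuous_intros)
  have im: "clamp1 ` UNIV \<subseteq> Iv" by auto
  have cf: "continuous_on Iv f"
    using f by (auto simp: continuous_on_eq_continuous_within intro: DERIV_continuous)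
  have cG: "continuous_on UNIV G" unfolding G_def[abs_def]
    using continuous_on_compose2[OF f' cc im] continuous_on_compose2[OF cf cc im] pos
    by (intro continuous_intros) (auto simp: less_imp_neq[symmetric])
  define L where "L w = ln (f (-1)) + oint G (-1) w" for w
  have dL: "(L has_real_derivative G w) (at w)" for w
    unfolding L_def[abs_def] using DERIV_add[OF DERIV_const oint_deriv[OF cG]] by simp
  have cL: "continuous_on UNIV L" using dL by (auto simp: continuous_on_eq_continuous_at dest: DERIV_isCont)
  have Lf: "L w = ln (f w)" if w: "w \<in> Iv" for w
  proof -
    have "((\<lambda>s. G s) has_integral (ln (f w) - ln (f (-1)))) {-1..w}"
    proof (rule fundamental_theorem_of_calculus)
      fix s assume s: "s \<in> {-1..w}"
      then have s': "s \<in> Iv" using w by auto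
      have "((\<lambda>s. ln (f s)) has_real_derivative (1 / f s * f' s)) (at s within Iv)"
        by (rule DERIV_chain2[OF DERIV_ln_divide]) (use f pos s' in auto)
      moreover have "max 0 (min 1 (2 - \<bar>s\<bar>)) = 1" using s' by auto
      ultimately have "((\<lambda>s. ln (f s)) has_real_derivative G s) (at s within Iv)"
        using s' by (simp add: G_def)
      then show "((\<lambda>s. ln (f s)) has_vector_derivative G s) (at s within {-1..w})"
        using w by (auto simp: has_real_derivative_iff_has_vector_derivative[symmetric] intro: DERIV_subset)
    qed (use w in simp)
    then show ?thesis using w by (simp add: L_def oint_le integral_unique)
  qed
  have tail: "oint G x y = 0" if "2 \<le> x \<and> 2 \<le> y \<or> x \<le> -2 \<and> y \<le> -2" for x y
  proof -
    have "oint G x y = oint (\<lambda>_. 0) x y" by (rule oint_cong) (use that in \<open>auto simp: G_def min_def max_def split: if_splits\<close>)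
    then show ?thesis by (simp add: oint_def)
  qed
  have Lc: "L w = L (max (-2) (min 2 w))" for w
  proof (cases "\<bar>w\<bar> \<le> 2")
    case False
    then have "oint G w (max (-2) (min 2 w)) = 0" by (intro tail) (auto simp: min_def max_def)
    then show ?thesis using oint_combine[OF cG, of "-1" w "max (-2) (min 2 w)"] by (simp add: L_def)
  qed (auto simp: L_def)
  obtain B where B: "\<And>w. w \<in> {-2..2} \<Longrightarrow> \<bar>L w\<bar> \<le> B" using continuous_bounded_Icc[OF cL, of "-2" 2] by blast
  have LB: "\<bar>L w\<bar> \<le> B" for w using B[of "max (-2) (min 2 w)"] Lc[of w] by simp
  define F where "F w = exp (L w)" for w
  show ?thesis
  proof (rule exI[of _ F], rule exI[of _ "\<lambda>w. F w * G w"], rule exI[of _ "exp (- B)"], rule exI[of _ "exp B"], intro conjI allI ballI)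
    fix w
    show "(F has_real_derivative F w * G w) (at w)" unfolding F_def[abs_def] by (rule DERIV_chain2[OF DERIV_exp dL])
    show "exp (- B) \<le> F w" "F w \<le> exp B" using LB[of w] by (auto simp: F_def)
  next
    show "continuous_on UNIV (\<lambda>w. F w * G w)" unfolding F_def by (intro continuous_intros cL cG)
    fix w assume w: "w \<in> Iv"
    then show "F w = f w" using Lf[OF w] pos by (simp add: F_def)
    moreover have "f w \<noteq> 0" "max 0 (min 1 (2 - \<bar>w\<bar>)) = 1" using w pos by force+
    ultimately show "F w * G w = f' w" using w by (simp add: G_def)
  qed simp
qed

lemma extend_continuous:
  assumes f: "continuous_on Iv f"
  shows "\<exists>F B. continuous_on UNIV F \<and> (\<forall>w. \<bar>F w\<bar> \<le> B) \<and> (\<forall>w\<in>Iv. F w = (f w :: real))"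
proof -
  have cc: "continuous_on UNIV clamp1" unfolding clamp1_def[abs_def] by (intro continuous_intros)
  have im: "clamp1 ` UNIV \<subseteq> Iv" by auto
  have "bounded (f ` Iv)" by (intro compact_imp_bounded compact_continuous_image f) auto
  then obtain B where "\<forall>x\<in>Iv. \<bar>f x\<bar> \<le> B" unfolding bounded_iff by auto
  then show ?thesis
    using continuous_on_compose2[OF f cc im] by (intro exI[of _ "\<lambda>w. f (clamp1 w)"] exI[of _ B]) auto
qed

text \<open>The integrals of the weak formulation range over \<open>{-1..1}\<close> in space and its
  boundary terms use values at \<open>-1\<close> and \<open>1\<close>, so extended coefficients
  define the same solutions.\<close>

lemma closed_loop_solution_cong:
  assumes e: "\<And>w. w \<in> Iv \<Longrightarrow> lam w = lam2 w" "\<And>w. w \<in> Iv \<Longrightarrow> lam' w = lam2' w" "\<And>w. w \<in> Iv \<Longrightarrow> mu w = mu2 w"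
    "\<And>w. w \<in> Iv \<Longrightarrow> mu' w = mu2' w" "\<And>w. w \<in> Iv \<Longrightarrow> b w = b2 w" "\<And>w. w \<in> Iv \<Longrightarrow> c w = c2 w"
  shows "closed_loop_solution lam lam' mu mu' b c U1 U2 u0 v0 u v \<longleftrightarrow> closed_loop_solution lam2 lam2' mu2 mu2' b2 c2 U1 U2 u0 v0 u v"
proof -
  have 1: "(LINT p:Strip|lborel. u (fst p) (snd p) * (phit (fst p) (snd p) + lam' (fst p) * phi (fst p) (snd p) + lam (fst p) * phiw (fst p) (snd p)))
      = (LINT p:Strip|lborel. u (fst p) (snd p) * (phit (fst p) (snd p) + lam2' (fst p) * phi (fst p) (snd p) + lam2 (fst p) * phiw (fst p) (snd p)))"
    for phi phiw phit by (rule Strip_cong) (simp add: e)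
  have 2: "(LINT p:Strip|lborel. b (fst p) * v (fst p) (snd p) * phi (fst p) (snd p)) = (LINT p:Strip|lborel. b2 (fst p) * v (fst p) (snd p) * phi (fst p) (snd p))"
    for phi by (rule Strip_cong) (simp add: e)
  have 3: "(LINT p:Strip|lborel. v (fst p) (snd p) * (mu' (fst p) * phi (fst p) (snd p) + mu (fst p) * phiw (fst p) (snd p)))
     = (LINT p:Strip|lborel. v (fst p) (snd p) * (mu2' (fst p) * phi (fst p) (snd p) + mu2 (fst p) * phiw (fst p) (snd p)))"
    for phi phiw by (rule Strip_cong) (simp add: e)
  have 4: "(LINT p:Strip|lborel. c (fst p) * u (fst p) (snd p) * phi (fst p) (snd p)) = (LINT p:Strip|lborel. c2 (fst p) * u (fst p) (snd p) * phi (fst p) (snd p))"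
    for phi by (rule Strip_cong) (simp add: e)
  have 5: "lam (-1) = lam2 (-1)" "mu 1 = mu2 1" by (simp_all add: e)
  show ?thesis unfolding closed_loop_solution_def 1 2 3 4 5 by (rule refl)
qed

text \<open>A feedback law reads its kernels only at \<open>w = -1\<close> or \<open>w = 1\<close>;
  a gain may therefore be extended constantly in the second argument.\<close>

lemma bounded_kernel_const:
  assumes "continuous_on UNIV k" shows "bounded_kernel (\<lambda>z _. k z)"
proof -
  have "bounded (k ` {-1..1})"
    by (intro compact_imp_bounded compact_continuous_image continuous_on_subset[OF assms]) auto
  moreover have "(\<lambda>(z, w). k z) ` kernel_dom \<subseteq> k ` {-1..1}" by (auto simp: kernel_dom_def)
  ultimately have "bounded ((\<lambda>(z, w). k z) ` kernel_dom)" by (rule bounded_subset)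
  moreover have "(\<lambda>p::real\<times>real. k (fst p)) \<in> borel_measurable borel"
    by (intro borel_measurable_continuous_onI cont1_comp[OF assms] continuous_intros)
  ultimately show ?thesis by (simp add: bounded_kernel_def)
qed

theorem theorem5:
  fixes lam lam' mu mu' b c :: "real \<Rightarrow> real"
  assumes lam_deriv: "\<forall>w\<in>{-1..1}. (lam has_real_derivative lam' w) (at w within {-1..1})"
      and lam'_cont: "continuous_on {-1..1} lam'"
      and mu_deriv: "\<forall>w\<in>{-1..1}. (mu has_real_derivative mu' w) (at w within {-1..1})"
      and mu'_cont: "continuous_on {-1..1} mu'"
      and lam_pos: "\<forall>w\<in>{-1..1}. lam w > 0"
      and mu_pos: "\<forall>w\<in>{-1..1}. mu w > 0"
      and lam_mu: "\<forall>w\<in>{-1..1}. lam w < mu (-w)"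
      and b_cont: "continuous_on {-1..1} b"
      and c_cont: "continuous_on {-1..1} c"
  shows "\<exists>L11 L12 L21 L22.
           bounded_kernel L11 \<and> bounded_kernel L12 \<and> bounded_kernel L21 \<and> bounded_kernel L22 \<and>
           (\<forall>u0 v0. L2_on u0 \<and> L2_on v0 \<longrightarrow>
              (\<exists>u v. closed_loop_solution lam lam' mu mu' b c (fb1 L11 L12) (fb2 L21 L22) u0 v0 u v) \<and>
              (\<exists>T\<ge>0. \<forall>u v. closed_loop_solution lam lam' mu mu' b c (fb1 L11 L12) (fb2 L21 L22) u0 v0 u v
                        \<longrightarrow> (\<forall>t\<ge>T. AE w in lborel. w \<in> {-1..1} \<longrightarrow> u w t = 0 \<and> v w t = 0)))"
proof -
  obtain la la' l1 h1 where la: "\<And>w. (la has_real_derivative la' w) (at w)" "continuous_on UNIV la'" "0 < l1" "\<And>w. l1 \<le> la w \<and> la w \<le> h1"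
    "\<And>w. w \<in> Iv \<Longrightarrow> la w = lam w \<and> la' w = lam' w"
    using extend_positive_C1[OF lam_deriv lam'_cont lam_pos] by blast
  obtain mv mv' l2 h2 where mv: "\<And>w. (mv has_real_derivative mv' w) (at w)" "continuous_on UNIV mv'" "0 < l2" "\<And>w. l2 \<le> mv w \<and> mv w \<le> h2"
    "\<And>w. w \<in> Iv \<Longrightarrow> mv w = mu w \<and> mv' w = mu' w"
    using extend_positive_C1[OF mu_deriv mu'_cont mu_pos] by blast
  obtain be B1 where be: "continuous_on UNIV be" "\<And>w. \<bar>be w\<bar> \<le> B1" "\<And>w. w \<in> Iv \<Longrightarrow> be w = b w"
    using extend_continuous[OF b_cont] by blast
  obtain ce B2 where ce: "continuous_on UNIV ce" "\<And>w. \<bar>ce w\<bar> \<le> B2" "\<And>w. w \<in> Iv \<Longrightarrow> ce w = c w"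
    using extend_continuous[OF c_cont] by blast
  interpret S: hyp_system la la' mv mv' be ce "min l1 l2" "max h1 h2" "max B1 B2"
    by unfold_locales (use la mv be ce in \<open>auto simp: le_max_iff_disj min_le_iff_disj\<close>)
  obtain M N where "cont2 M \<and> cont2 N \<and>
     (\<forall>th z. -1 \<le> z \<longrightarrow> z \<le> 1 \<longrightarrow> S.m z \<le> th \<longrightarrow> th \<le> S.tau \<longrightarrow>
        M th z = S.gdiag (inv S.n (th + S.a z)) + oint (\<lambda>s. S.K1 s * N (th + S.a z - S.a s) s) z (inv S.n (th + S.a z)) \<and>
        N th z = oint (\<lambda>s. S.K2 s * M (th - S.m z + S.m s) s) (-1) z)"
    using S.kernel_exists by (elim exE) (rule that)
  then interpret K: hyp_kernel la la' mv mv' be ce "min l1 l2" "max h1 h2" "max B1 B2" M N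
    by unfold_locales auto
  let ?Z = "\<lambda>_ _. 0 :: real" and ?L21 = "\<lambda>z _. K.k1 z" and ?L22 = "\<lambda>z _. K.k2 z"
  have cong: "closed_loop_solution lam lam' mu mu' b c (fb1 ?Z ?Z) (fb2 ?L21 ?L22) u0 v0 u v
      \<longleftrightarrow> closed_loop_solution la la' mv mv' be ce (fb1 ?Z ?Z) (fb2 ?L21 ?L22) u0 v0 u v" for u0 v0 u v
    by (rule closed_loop_solution_cong) (simp_all add: la mv be ce)
  \<comment> \<open>Extinction holds strictly after \<open>tau + sigma\<close>; the summand 1 yields
    a closed range of times.\<close>
  have T: "0 \<le> S.tau + S.sigma + 1" using S.sigma_tau_nonneg by simp
  show ?thesis
  proof (rule exI[of _ ?Z], rule exI[of _ ?Z], rule exI[of _ ?L21], rule exI[of _ ?L22], intro conjI allI impI)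
    show "bounded_kernel ?Z" by (rule bounded_kernel_const) simp
    then show "bounded_kernel ?Z" .
    show "bounded_kernel ?L21" "bounded_kernel ?L22" by (rule bounded_kernel_const[OF K.cont_k(1)], rule bounded_kernel_const[OF K.cont_k(2)])
    fix u0 v0 assume "L2_on u0 \<and> L2_on v0"
    then show "\<exists>u v. closed_loop_solution lam lam' mu mu' b c (fb1 ?Z ?Z) (fb2 ?L21 ?L22) u0 v0 u v"
      unfolding cong using S.closed_loop_exists[OF K.cont_k] by blast
    show "\<exists>T\<ge>0. \<forall>u v. closed_loop_solution lam lam' mu mu' b c (fb1 ?Z ?Z) (fb2 ?L21 ?L22) u0 v0 u v
        \<longrightarrow> (\<forall>t\<ge>T. AE w in lborel. w \<in> {-1..1} \<longrightarrow> u w t = 0 \<and> v w t = 0)"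
    proof (rule exI[of _ "S.tau + S.sigma + 1"], intro conjI allI impI)
      fix u v t assume "closed_loop_solution lam lam' mu mu' b c (fb1 ?Z ?Z) (fb2 ?L21 ?L22) u0 v0 u v" and "S.tau + S.sigma + 1 \<le> t"
      then show "AE w in lborel. w \<in> {-1..1} \<longrightarrow> u w t = 0 \<and> v w t = 0"
        unfolding cong by (intro K.closed_loop_extinction) auto
    qed (rule T)
  qed
qed

end
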